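(* Let $d=1$, let $m\ge1$ be an integer, and let $\Omega$ be either $\mathbb{R}$, $(-\infty,L_1)$ or $(L_2,\infty)$, where $L_1,L_2$ are arbitrary real numbers. Let $v:\overline{\Omega}\to\mathbb{R}$ be a $C^m$ function satisfying: (1) $|v'(y)|+|v''(y)|+\cdots+|v^{(m)}(y)|>0$ for all $y\in\overline{\Omega}$; (2) there exists $c_0>0$ such that $\liminf_{|y|\to\infty}|v'(y)|\ge c_0$. Then there exists a constant $C>0$ such that, for all $\nu>0$ and all real $k\neq0$, $$\Psi(H_{\nu,k})\ge C\,\lambda_{\nu,k},$$ where $$\lambda_{\nu,k}=\begin{cases}\nu^{\frac{m}{m+2}}|k|^{\frac{2}{m+2}}, & \text{if } 0<\nu\le|k|,\\[1ex] \dfrac{k^2}{\nu}, & \text{if } 0<|k|\le\nu.\end{cases}$$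
   Context: For $\nu>0$ and real $k\neq0$, $H_{\nu,k}=-\nu\,\partial_y^2+\mathrm{i}k\,v(y)$ is regarded as a linear operator on the Hilbert space $X=L^2(\Omega)$ with domain $D(H_{\nu,k})=\{g\in H^2(\Omega):\ \mathcal{N}\cdot\nabla g=0\ \text{on }\partial\Omega\}$, where $\mathcal{N}$ is the outward unit normal on $\partial\Omega$ (homogeneous Neumann condition). Its pseudospectral abscissa is $$\Psi(H_{\nu,k})=\Bigl(\sup_{z\in\mathrm{i}\mathbb{R}}\|(H_{\nu,k}-z)^{-1}\|_{X\to X}\Bigr)^{-1}.$$
   Formalization: Since (2) makes v unbounded, H need not map the stated domain into X: D(H) is restricted to those g with Hg in L²(Ω), and (H-z)^{-1} is read as the resolvent of the closure of H, because H need not be closed for steep v; if H is closed this is the usual resolvent. *)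

theory Defs
  imports "HOL-Analysis.Analysis"
begin

section \<open>The Hilbert space X\<close>

text \<open>Elements of the space are represented by functions; two functions represent the same element
  iff they agree almost everywhere on \<open>\<Omega>\<close>. Values outside \<open>\<Omega>\<close> are irrelevant.\<close>

definition L2 :: "real set \<Rightarrow> (real \<Rightarrow> complex) set" where
  "L2 \<Omega> = {f \<in> borel_measurable (lebesgue_on \<Omega>). integrable (lebesgue_on \<Omega>) (\<lambda>y. (cmod (f y))\<^sup>2)}"

definition L2norm :: "real set \<Rightarrow> (real \<Rightarrow> complex) \<Rightarrow> real" where
  "L2norm \<Omega> f = sqrt (LINT y|lebesgue_on \<Omega>. (cmod (f y))\<^sup>2)"

definition L2eq :: "real set \<Rightarrow> (real \<Rightarrow> complex) \<Rightarrow> (real \<Rightarrow> complex) \<Rightarrow> bool" where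
  "L2eq \<Omega> f g \<longleftrightarrow> (AE y in lebesgue_on \<Omega>. f y = g y)"


section \<open>Weak derivatives, Sobolev space, Neumann condition\<close>

definition test_function :: "real set \<Rightarrow> (real \<Rightarrow> real) \<Rightarrow> bool" where
  "test_function \<Omega> \<phi> \<longleftrightarrow> (\<forall>n. (deriv ^^ n) \<phi> differentiable_on UNIV)
     \<and> compact (closure {y. \<phi> y \<noteq> 0}) \<and> closure {y. \<phi> y \<noteq> 0} \<subseteq> \<Omega>"

definition locally_integrable :: "real set \<Rightarrow> (real \<Rightarrow> complex) \<Rightarrow> bool" where
  "locally_integrable \<Omega> g \<longleftrightarrow> (\<forall>K. compact K \<and> K \<subseteq> \<Omega> \<longrightarrow> integrable (lebesgue_on K) g)"

definition is_weak_deriv :: "real set \<Rightarrow> (real \<Rightarrow> complex) \<Rightarrow> (real \<Rightarrow> complex) \<Rightarrow> bool" where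
  "is_weak_deriv \<Omega> g h \<longleftrightarrow> locally_integrable \<Omega> g \<and> locally_integrable \<Omega> h \<and>
     (\<forall>\<phi>. test_function \<Omega> \<phi> \<longrightarrow>
        (LINT y|lebesgue_on \<Omega>. g y * of_real (deriv \<phi> y))
        = - (LINT y|lebesgue_on \<Omega>. h y * of_real (\<phi> y)))"

text \<open>The weak derivative is unique up to null sets, so the choice is immaterial.\<close>

definition weak_deriv :: "real set \<Rightarrow> (real \<Rightarrow> complex) \<Rightarrow> real \<Rightarrow> complex" where
  "weak_deriv \<Omega> g = (SOME h. is_weak_deriv \<Omega> g h)"

definition H2 :: "real set \<Rightarrow> (real \<Rightarrow> complex) set" where
  "H2 \<Omega> = {g \<in> L2 \<Omega>. \<exists>g1\<in>L2 \<Omega>. \<exists>g2\<in>L2 \<Omega>. is_weak_deriv \<Omega> g g1 \<and> is_weak_deriv \<Omega> g1 g2}"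

text \<open>In one dimension the normal derivative is \<open>\<plusminus>g'\<close>. For \<open>g\<close> in \<^term>\<open>H2 \<Omega>\<close> the weak derivative has
  a unique representative that is continuous up to the boundary; the condition is that this
  representative vanishes there.\<close>

definition neumann :: "real set \<Rightarrow> (real \<Rightarrow> complex) \<Rightarrow> bool" where
  "neumann \<Omega> g \<longleftrightarrow> (\<exists>h. is_weak_deriv \<Omega> g h \<and> continuous_on (closure \<Omega>) h
     \<and> (\<forall>y\<in>frontier \<Omega>. h y = 0))"


section \<open>The operator\<close>

definition H_op :: "real set \<Rightarrow> (real \<Rightarrow> real) \<Rightarrow> real \<Rightarrow> real \<Rightarrow> (real \<Rightarrow> complex) \<Rightarrow> real \<Rightarrow> complex" where
  "H_op \<Omega> v \<nu> k g = (\<lambda>y. - of_real \<nu> * weak_deriv \<Omega> (weak_deriv \<Omega> g) y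
     + \<i> * of_real k * of_real (v y) * g y)"

text \<open>The last condition makes the operator take values in X; it is automatic for bounded \<open>v\<close>, but
  not for unbounded \<open>v\<close>.\<close>

definition H_dom :: "real set \<Rightarrow> (real \<Rightarrow> real) \<Rightarrow> real \<Rightarrow> real \<Rightarrow> (real \<Rightarrow> complex) set" where
  "H_dom \<Omega> v \<nu> k = {g \<in> H2 \<Omega>. neumann \<Omega> g \<and> H_op \<Omega> v \<nu> k g \<in> L2 \<Omega>}"


section \<open>Resolvents and pseudospectral abscissa\<close>

definition linear_L2 :: "real set \<Rightarrow> ((real \<Rightarrow> complex) \<Rightarrow> real \<Rightarrow> complex) \<Rightarrow> bool" where
  "linear_L2 \<Omega> R \<longleftrightarrow> (\<forall>f\<in>L2 \<Omega>. R f \<in> L2 \<Omega>)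
     \<and> (\<forall>f\<in>L2 \<Omega>. \<forall>g\<in>L2 \<Omega>. L2eq \<Omega> (R (\<lambda>y. f y + g y)) (\<lambda>y. R f y + R g y))
     \<and> (\<forall>c. \<forall>f\<in>L2 \<Omega>. L2eq \<Omega> (R (\<lambda>y. c * f y)) (\<lambda>y. c * R f y))"

definition op_norm :: "real set \<Rightarrow> ((real \<Rightarrow> complex) \<Rightarrow> real \<Rightarrow> complex) \<Rightarrow> ennreal" where
  "op_norm \<Omega> R = (SUP f\<in>{f \<in> L2 \<Omega>. L2norm \<Omega> f \<le> 1}. ennreal (L2norm \<Omega> (R f)))"

text \<open>The closure (in \<open>X \<times> X\<close>) of the graph of an operator \<open>T\<close> with domain \<open>D\<close>.\<close>

definition closed_graph ::
  "real set \<Rightarrow> (real \<Rightarrow> complex) set \<Rightarrow> ((real \<Rightarrow> complex) \<Rightarrow> real \<Rightarrow> complex)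
    \<Rightarrow> ((real \<Rightarrow> complex) \<times> (real \<Rightarrow> complex)) set" where
  "closed_graph \<Omega> D T = {(g, f). g \<in> L2 \<Omega> \<and> f \<in> L2 \<Omega> \<and>
     (\<exists>gs::nat \<Rightarrow> real \<Rightarrow> complex. (\<forall>n. gs n \<in> D)
        \<and> (\<lambda>n. L2norm \<Omega> (\<lambda>y. gs n y - g y)) \<longlonglongrightarrow> 0
        \<and> (\<lambda>n. L2norm \<Omega> (\<lambda>y. T (gs n) y - f y)) \<longlonglongrightarrow> 0)}"

text \<open>\<open>R\<close> is a bounded everywhere defined two-sided inverse of \<open>T - z\<close>, where \<open>T\<close> is identified with
  its closure: for rapidly growing \<open>v\<close>, an operator of the form \<open>- \<nu> \<partial>\<^sup>2 + \<i> k v\<close> on the domain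
  \<^const>\<open>H_dom\<close> need not be closed, and the inverse of \<open>T - z\<close> is then only densely defined, \<open>R\<close> being its
  continuous extension to X. If \<open>T\<close> is closed, this is the usual resolvent.\<close>

definition is_resolvent ::
  "real set \<Rightarrow> (real \<Rightarrow> complex) set \<Rightarrow> ((real \<Rightarrow> complex) \<Rightarrow> real \<Rightarrow> complex) \<Rightarrow> complex
    \<Rightarrow> ((real \<Rightarrow> complex) \<Rightarrow> real \<Rightarrow> complex) \<Rightarrow> bool" where
  "is_resolvent \<Omega> D T z R \<longleftrightarrow> linear_L2 \<Omega> R \<and> op_norm \<Omega> R < \<infinity>
     \<and> (\<forall>f\<in>L2 \<Omega>. (R f, \<lambda>y. f y + z * R f y) \<in> closed_graph \<Omega> D T)
     \<and> (\<forall>(g, h) \<in> closed_graph \<Omega> D T. L2eq \<Omega> (R (\<lambda>y. h y - z * g y)) g)"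

text \<open>The resolvent is unique up to null sets, so the infimum is just its norm; if \<open>z\<close> is in the
  spectrum, the infimum is over the empty set and equals \<open>\<infinity>\<close>, which is the usual convention.\<close>

definition resolvent_norm ::
  "real set \<Rightarrow> (real \<Rightarrow> complex) set \<Rightarrow> ((real \<Rightarrow> complex) \<Rightarrow> real \<Rightarrow> complex) \<Rightarrow> complex \<Rightarrow> ennreal" where
  "resolvent_norm \<Omega> D T z = (INF R\<in>{R. is_resolvent \<Omega> D T z R}. op_norm \<Omega> R)"

text \<open>In \<^typ>\<open>ennreal\<close>, \<open>inverse \<infinity> = 0\<close>.\<close>

definition pseudospectral_abscissa ::
  "real set \<Rightarrow> (real \<Rightarrow> complex) set \<Rightarrow> ((real \<Rightarrow> complex) \<Rightarrow> real \<Rightarrow> complex) \<Rightarrow> ennreal" where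
  "pseudospectral_abscissa \<Omega> D T = inverse (SUP z\<in>{z. Re z = 0}. resolvent_norm \<Omega> D T z)"

definition \<Psi> :: "real set \<Rightarrow> (real \<Rightarrow> real) \<Rightarrow> real \<Rightarrow> real \<Rightarrow> ennreal" where
  "\<Psi> \<Omega> v \<nu> k = pseudospectral_abscissa \<Omega> (H_dom \<Omega> v \<nu> k) (H_op \<Omega> v \<nu> k)"


section \<open>The profile and the rate\<close>

text \<open>Iterated derivatives relative to a set \<open>S\<close>, one-sided at the endpoints of an interval.\<close>

primrec nderiv_on :: "real set \<Rightarrow> nat \<Rightarrow> (real \<Rightarrow> real) \<Rightarrow> real \<Rightarrow> real" where
  "nderiv_on S 0 f = f"
| "nderiv_on S (Suc j) f = (\<lambda>y. vector_derivative (nderiv_on S j f) (at y within S))"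

definition Cm_on :: "nat \<Rightarrow> real set \<Rightarrow> (real \<Rightarrow> real) \<Rightarrow> bool" where
  "Cm_on m S f \<longleftrightarrow> (\<forall>j<m. nderiv_on S j f differentiable_on S) \<and> continuous_on S (nderiv_on S m f)"

definition rate :: "nat \<Rightarrow> real \<Rightarrow> real \<Rightarrow> real" where
  "rate m \<nu> k = (if \<nu> \<le> \<bar>k\<bar>
     then \<nu> powr (real m / (real m + 2)) * \<bar>k\<bar> powr (2 / (real m + 2))
     else k\<^sup>2 / \<nu>)"

end

(*
Fix z = i k l on the imaginary axis and put F = (H - z) g, with norms in L2. Testing F against g
controls nu ||g'||^2, and testing it against X g, where X is a smoothed sign of v - l, controls the
integral of |k| |v - l| |g|^2 away from the points where v is close to l. By condition (1) and the
mean value theorem those points lie in boundedly many intervals of length of order delta, outside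
of which |v - l| >= c delta^m; condition (2) makes this uniform at infinity. On these intervals
sup |g|^2 <= 2 ||g|| ||g'|| is used. Choosing delta = (nu/|k|)^(1/(m+2)) if nu <= |k|, and
delta = 1 otherwise, yields ||F|| >= C lambda ||g||.

The same estimate holds on every bounded interval with Neumann or Dirichlet conditions at the ends
(not both Neumann), with the same constant. There the equation is solved by shooting, and a cutoff
at infinity turns these solutions into elements of the domain, so H - z has dense range. With the
lower bound, its closure has a bounded inverse of norm at most 1/(C lambda).
*)
theory Submission
  imports Defs "HOL-Computational_Algebra.Polynomial"
begin

section \<open>The space L2\<close>

text \<open>The growth of \<open>v\<close> is arbitrary, so all estimates are made on compact
  intervals, where \<open>v\<close> is bounded and boundary terms are explicit. Passing to infinity
  costs only the commutator of a cutoff at scale R with the second derivative; it involves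
  \<open>G\<close> and \<open>G1\<close> but not \<open>v\<close>, hence is O(1/R) however fast
  \<open>v\<close> grows. This needs constants that do not depend on the length of the interval.
  They have two sources: the number of exceptional intervals is bounded uniformly in
  \<open>l\<close> and \<delta>, and from a Dirichlet end |G|^2 is recovered by integrating its
  derivative, with no term containing the length. The cutoff supplies such an end even if \<Omega>
  has a Neumann end. The scale \<delta> balances diffusion \<nu>/\<delta>^2 against transport |k|
  \<delta>^m; both then equal \<lambda>. For \<nu> > |k| the balance would need \<delta> > 1,
  outside the range of the nondegeneracy bound; at \<delta> = 1 the binding constraint is \<nu>
  \<lambda> \<le> k^2, the origin of k^2/\<nu>. The spectral parameter only shifts the level
  \<open>l\<close>, so uniformity in \<open>l\<close> is uniformity along the imaginary
  axis.\<close>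

lemma L2_measurable: "f \<in> L2 S \<Longrightarrow> f \<in> borel_measurable (lebesgue_on S)"
  by (simp add: L2_def)

lemma L2_integrable: "f \<in> L2 S \<Longrightarrow> integrable (lebesgue_on S) (\<lambda>y. (cmod (f y))\<^sup>2)"
  by (simp add: L2_def)

lemma L2norm_nonneg [simp]: "0 \<le> L2norm S f"
  by (simp add: L2norm_def)

lemma L2norm_sq: "(L2norm S f)\<^sup>2 = (LINT y|lebesgue_on S. (cmod (f y))\<^sup>2)"
  by (simp add: L2norm_def)

lemma L2_product_integrable:
  assumes "f \<in> L2 S" "g \<in> L2 S"
  shows "integrable (lebesgue_on S) (\<lambda>y. cmod (f y) * cmod (g y))"
proof (rule Bochner_Integration.integrable_bound)
  show "integrable (lebesgue_on S) (\<lambda>y. (cmod (f y))\<^sup>2 + (cmod (g y))\<^sup>2)"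
    using assms by (auto simp: L2_def)
  show "(\<lambda>y. cmod (f y) * cmod (g y)) \<in> borel_measurable (lebesgue_on S)"
    using assms by (auto simp: L2_def)
  have "a * b \<le> a\<^sup>2 + b\<^sup>2" if "0 \<le> a" "0 \<le> b" for a b :: real
    using that sum_squares_bound[of a b] zero_le_square[of a] mult_nonneg_nonneg[OF that]
    by linarith
  then show "AE y in lebesgue_on S. norm (cmod (f y) * cmod (g y))
      \<le> norm ((cmod (f y))\<^sup>2 + (cmod (g y))\<^sup>2)"
    by (intro AE_I2) (simp add: abs_of_nonneg)
qed

lemma L2_Cauchy_Schwarz:
  assumes "f \<in> L2 S" "g \<in> L2 S"
  shows "(LINT y|lebesgue_on S. cmod (f y) * cmod (g y)) \<le> L2norm S f * L2norm S g"
proof -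
  let ?M = "lebesgue_on S"
  let ?I = "LINT y|?M. cmod (f y) * cmod (g y)"
  have [measurable]: "f \<in> borel_measurable ?M" "g \<in> borel_measurable ?M"
    using assms by (auto simp: L2_def)
  have "(\<integral>\<^sup>+y. ennreal (cmod (f y)) * ennreal (cmod (g y)) \<partial>?M)\<^sup>2
      \<le> (\<integral>\<^sup>+y. ennreal (cmod (f y)) ^ 2 \<partial>?M) * (\<integral>\<^sup>+y. ennreal (cmod (g y)) ^ 2 \<partial>?M)"
    by (rule Cauchy_Schwarz_nn_integral) auto
  also have "(\<integral>\<^sup>+y. ennreal (cmod (f y)) * ennreal (cmod (g y)) \<partial>?M) = ennreal ?I"
    using L2_product_integrable[OF assms]
    by (subst nn_integral_eq_integral[symmetric]) (auto simp: ennreal_mult)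
  also have "(\<integral>\<^sup>+y. ennreal (cmod (f y)) ^ 2 \<partial>?M) = ennreal ((L2norm S f)\<^sup>2)"
    unfolding L2norm_sq using L2_integrable[OF assms(1)]
    by (subst nn_integral_eq_integral[symmetric]) (auto simp: ennreal_power)
  also have "(\<integral>\<^sup>+y. ennreal (cmod (g y)) ^ 2 \<partial>?M) = ennreal ((L2norm S g)\<^sup>2)"
    unfolding L2norm_sq using L2_integrable[OF assms(2)]
    by (subst nn_integral_eq_integral[symmetric]) (auto simp: ennreal_power)
  finally have "?I\<^sup>2 \<le> (L2norm S f * L2norm S g)\<^sup>2"
    by (simp add: ennreal_power ennreal_mult[symmetric] power_mult_distrib)
  then show ?thesis
    by (rule power2_le_imp_le) simp
qed

lemma L2_cmult: "f \<in> L2 S \<Longrightarrow> (\<lambda>y. c * f y) \<in> L2 S"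
  by (auto simp: L2_def norm_mult power_mult_distrib)

lemma L2norm_cmult: "L2norm S (\<lambda>y. c * f y) = cmod c * L2norm S f"
  by (simp add: L2norm_def norm_mult power_mult_distrib real_sqrt_mult)

lemma L2_add:
  assumes "f \<in> L2 S" "g \<in> L2 S"
  shows "(\<lambda>y. f y + g y) \<in> L2 S"
proof -
  have "integrable (lebesgue_on S) (\<lambda>y. (cmod (f y + g y))\<^sup>2)"
  proof (rule Bochner_Integration.integrable_bound)
    show "integrable (lebesgue_on S)
        (\<lambda>y. (cmod (f y))\<^sup>2 + 2 * (cmod (f y) * cmod (g y)) + (cmod (g y))\<^sup>2)"
      using assms L2_product_integrable[OF assms] by (auto simp: L2_def)
    show "(\<lambda>y. (cmod (f y + g y))\<^sup>2) \<in> borel_measurable (lebesgue_on S)"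
      using assms by (auto simp: L2_def)
    have "(cmod (a + b))\<^sup>2 \<le> (cmod a)\<^sup>2 + 2 * (cmod a * cmod b) + (cmod b)\<^sup>2" for a b
      using power_mono[OF norm_triangle_ineq[of a b], of 2] by (simp add: power2_sum)
    then show "AE y in lebesgue_on S. norm ((cmod (f y + g y))\<^sup>2)
      \<le> norm ((cmod (f y))\<^sup>2 + 2 * (cmod (f y) * cmod (g y)) + (cmod (g y))\<^sup>2)"
      by (intro AE_I2) (simp add: abs_of_nonneg)
  qed
  then show ?thesis
    using assms by (auto simp: L2_def)
qed

lemma L2norm_triangle:
  assumes "f \<in> L2 S" "g \<in> L2 S"
  shows "L2norm S (\<lambda>y. f y + g y) \<le> L2norm S f + L2norm S g"
proof (rule power2_le_imp_le)
  have "(L2norm S (\<lambda>y. f y + g y))\<^sup>2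
     \<le> (LINT y|lebesgue_on S. (cmod (f y))\<^sup>2 + 2 * (cmod (f y) * cmod (g y)) + (cmod (g y))\<^sup>2)"
    unfolding L2norm_sq
  proof (rule integral_mono)
    show "integrable (lebesgue_on S) (\<lambda>y. (cmod (f y + g y))\<^sup>2)"
      by (rule L2_integrable[OF L2_add[OF assms]])
    show "integrable (lebesgue_on S)
        (\<lambda>y. (cmod (f y))\<^sup>2 + 2 * (cmod (f y) * cmod (g y)) + (cmod (g y))\<^sup>2)"
      using assms L2_product_integrable[OF assms] by (auto simp: L2_def)
    show "(cmod (f y + g y))\<^sup>2 \<le> (cmod (f y))\<^sup>2 + 2 * (cmod (f y) * cmod (g y)) + (cmod (g y))\<^sup>2" for y
      using power_mono[OF norm_triangle_ineq[of "f y" "g y"], of 2] by (simp add: power2_sum)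
  qed
  also have "\<dots> = (L2norm S f)\<^sup>2 + 2 * (LINT y|lebesgue_on S. cmod (f y) * cmod (g y)) + (L2norm S g)\<^sup>2"
    using L2_product_integrable[OF assms] L2_integrable[OF assms(1)] L2_integrable[OF assms(2)]
    by (simp add: L2norm_sq)
  also have "\<dots> \<le> (L2norm S f + L2norm S g)\<^sup>2"
    using L2_Cauchy_Schwarz[OF assms] by (simp add: power2_sum)
  finally show "(L2norm S (\<lambda>y. f y + g y))\<^sup>2 \<le> (L2norm S f + L2norm S g)\<^sup>2" .
qed simp

lemma L2_uminus: "f \<in> L2 S \<Longrightarrow> (\<lambda>y. - f y) \<in> L2 S"
  using L2_cmult[of f S "-1"] by simp

lemma L2norm_uminus [simp]: "L2norm S (\<lambda>y. - f y) = L2norm S f"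
  by (simp add: L2norm_def)

lemma L2_diff:
  assumes "f \<in> L2 S" "g \<in> L2 S"
  shows "(\<lambda>y. f y - g y) \<in> L2 S"
  using L2_add[OF assms(1) L2_uminus[OF assms(2)]] by simp

lemma L2norm_minus_commute: "L2norm S (\<lambda>y. f y - g y) = L2norm S (\<lambda>y. g y - f y)"
  by (simp add: L2norm_def norm_minus_commute)

lemma L2norm_diff_triangle:
  assumes "f \<in> L2 S" "g \<in> L2 S"
  shows "L2norm S (\<lambda>y. f y - g y) \<le> L2norm S f + L2norm S g"
  using L2norm_triangle[OF assms(1) L2_uminus[OF assms(2)]] by simp

lemma L2norm_triangle_sub:
  assumes "f \<in> L2 S" "g \<in> L2 S"
  shows "L2norm S f \<le> L2norm S g + L2norm S (\<lambda>y. f y - g y)"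
  using L2norm_triangle[OF assms(2) L2_diff[OF assms]] by simp

lemma borel_measurable_lebesgue_on_AE:
  fixes f g :: "real \<Rightarrow> complex"
  assumes "f \<in> borel_measurable (lebesgue_on S)" "AE y in lebesgue_on S. f y = g y"
    "S \<in> sets lebesgue"
  shows "g \<in> borel_measurable (lebesgue_on S)"
proof -
  have "AE y in lebesgue. (if y \<in> S then f y else 0) = (if y \<in> S then g y else 0)"
    using assms(2,3) by (auto simp: AE_restrict_space_iff)
  then have "(\<lambda>y. if y \<in> S then g y else 0) \<in> borel_measurable lebesgue"
    by (rule borel_measurable_AE[OF borel_measurable_if_I[OF assms(1,3)]])
  then show ?thesis
    by (rule borel_measurable_if_D)
qed

lemma L2_cong_AE:
  assumes "f \<in> L2 S" "AE y in lebesgue_on S. f y = g y" "S \<in> sets lebesgue"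
  shows "g \<in> L2 S"
proof -
  have m: "g \<in> borel_measurable (lebesgue_on S)"
    using borel_measurable_lebesgue_on_AE assms L2_measurable by blast
  moreover have "integrable (lebesgue_on S) (\<lambda>y. (cmod (g y))\<^sup>2)"
  proof (rule integrable_cong_AE_imp[OF L2_integrable[OF assms(1)]])
    show "AE y in lebesgue_on S. (cmod (f y))\<^sup>2 = (cmod (g y))\<^sup>2"
      using assms(2) by eventually_elim simp
  qed (use m in measurable)
  ultimately show ?thesis
    by (simp add: L2_def)
qed

lemma L2norm_cong_AE:
  assumes "AE y in lebesgue_on S. f y = g y" "f \<in> L2 S" "S \<in> sets lebesgue"
  shows "L2norm S f = L2norm S g"
proof -
  have "g \<in> L2 S" by (rule L2_cong_AE[OF assms(2,1,3)])
  then have "(LINT y|lebesgue_on S. (cmod (f y))\<^sup>2) = (LINT y|lebesgue_on S. (cmod (g y))\<^sup>2)"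
    by (intro integral_cong_AE) (use assms in \<open>auto simp: L2_def\<close>)
  then show ?thesis by (simp add: L2norm_def)
qed

lemma L2norm_0_iff:
  assumes "f \<in> L2 S"
  shows "L2norm S f = 0 \<longleftrightarrow> (AE y in lebesgue_on S. f y = 0)"
  using integral_nonneg_eq_0_iff_AE[OF L2_integrable[OF assms]] by (simp add: L2norm_def)


text \<open>Riesz-Fischer for elements given as functions. A subsequence with differences of norm at
  most 4^-k converges almost everywhere, since the weighted sum of 8^k |d_k|^2 has finite integral;
  Fatou's lemma turns this into convergence in norm.\<close>

lemma L2_complete:
  assumes L2: "\<And>n. f n \<in> L2 S"
    and Cauchy: "\<And>e. e > 0 \<Longrightarrow> \<exists>N. \<forall>m\<ge>N. \<forall>n\<ge>N. L2norm S (\<lambda>y. f m y - f n y) < e"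
  shows "\<exists>g\<in>L2 S. (\<lambda>n. L2norm S (\<lambda>y. f n y - g y)) \<longlonglongrightarrow> 0"
proof -
  let ?M = "lebesgue_on S"
  have [measurable]: "f n \<in> borel_measurable ?M" for n
    using L2_measurable[OF L2] .
  have nn: "(\<integral>\<^sup>+y. ennreal ((cmod (h y))\<^sup>2) \<partial>?M) = ennreal ((L2norm S h)\<^sup>2)" if "h \<in> L2 S" for h
    using L2_integrable[OF that] by (simp add: nn_integral_eq_integral L2norm_sq)
  have "\<forall>k. \<exists>N. \<forall>m\<ge>N. \<forall>n\<ge>N. L2norm S (\<lambda>y. f m y - f n y) < (1/4)^k"
    using Cauchy by simp
  then obtain N where N: "\<And>k m n. m \<ge> N k \<Longrightarrow> n \<ge> N k \<Longrightarrow> L2norm S (\<lambda>y. f m y - f n y) < (1/4)^k"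
    by metis
  \<comment> \<open>The maximum makes both \<open>r k\<close> and \<open>r (Suc k)\<close> at least
    \<open>N k\<close>; the summand \<open>k\<close> makes \<open>r\<close> tend to infinity, which
    the Fatou step uses.\<close>
  define r where "r k = Max (N ` {..k}) + k" for k
  have rN: "r k \<ge> N k" for k
  proof -
    have "N k \<le> Max (N ` {..k})" by (rule Max_ge) auto
    then show ?thesis unfolding r_def by linarith
  qed
  have rN': "r (Suc k) \<ge> N k" for k
  proof -
    have "N k \<le> Max (N ` {..Suc k})" by (rule Max_ge) auto
    then show ?thesis unfolding r_def by linarith
  qed
  define d where "d k y = f (r (Suc k)) y - f (r k) y" for k y
  have dL2: "d k \<in> L2 S" for k
    unfolding d_def by (intro L2_diff L2)
  have [measurable]: "d k \<in> borel_measurable ?M" for k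
    using L2_measurable[OF dL2] .
  have dnorm: "L2norm S (d k) \<le> (1/4)^k" for k
    unfolding d_def using N[OF rN' rN] by (simp add: less_imp_le)
  have "(\<integral>\<^sup>+y. (\<Sum>k. ennreal (8^k * (cmod (d k y))\<^sup>2)) \<partial>?M)
      = (\<Sum>k. \<integral>\<^sup>+y. ennreal (8^k * (cmod (d k y))\<^sup>2) \<partial>?M)"
    by (rule nn_integral_suminf) auto
  also have "\<dots> = (\<Sum>k. ennreal (8^k * (L2norm S (d k))\<^sup>2))"
    by (simp add: ennreal_mult nn_integral_cmult nn[OF dL2])
  also have "\<dots> \<le> (\<Sum>k. ennreal ((1/2)^k))"
  proof (intro suminf_le allI)
    fix k
    have "8^k * (L2norm S (d k))\<^sup>2 \<le> 8^k * ((1/4)^k)\<^sup>2"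
      using dnorm by (intro mult_left_mono power_mono) auto
    also have "\<dots> = (8 * (1/4 * (1/4)) :: real)^k"
      by (simp only: power_mult_distrib power2_eq_square)
    also have "\<dots> = (1/2)^k" by simp
    finally show "ennreal (8^k * (L2norm S (d k))\<^sup>2) \<le> ennreal ((1/2)^k)"
      by (rule ennreal_leI)
  qed auto
  also have "\<dots> = ennreal (\<Sum>k. (1/2)^k)"
    by (rule suminf_ennreal2) (auto intro: summable_geometric)
  also have "\<dots> < \<infinity>" by simp
  finally have fin: "(\<integral>\<^sup>+y. (\<Sum>k. ennreal (8^k * (cmod (d k y))\<^sup>2)) \<partial>?M) \<noteq> \<infinity>"
    by simp
  have "AE y in ?M. (\<Sum>k. ennreal (8^k * (cmod (d k y))\<^sup>2)) \<noteq> \<infinity>"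
    by (rule nn_integral_PInf_AE) (use fin in auto)
  then have conv: "AE y in ?M. convergent (\<lambda>k. f (r k) y)"
  proof eventually_elim
    fix y
    assume fin: "(\<Sum>k. ennreal (8^k * (cmod (d k y))\<^sup>2)) \<noteq> \<infinity>"
    have sm: "summable (\<lambda>k. 8^k * (cmod (d k y))\<^sup>2)"
      by (rule summable_suminf_not_top) (use fin in auto)
    then have "bounded (range (\<lambda>k. 8^k * (cmod (d k y))\<^sup>2))"
      using summable_LIMSEQ_zero convergent_imp_bounded by blast
    then obtain B where B: "\<And>k. \<bar>8^k * (cmod (d k y))\<^sup>2\<bar> \<le> B"
      by (auto simp: bounded_iff)
    \<comment> \<open>The weight 8^k exceeds 4^k, which is what this bound needs, and stays below
      16^k, the rate at which the squared norms of \<open>d k\<close> decay.\<close>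
    have "cmod (d k y) \<le> sqrt B * (1/2)^k" for k
    proof -
      have "(2^k)\<^sup>2 = (4::real)^k"
        by (simp add: power2_eq_square flip: power_mult_distrib)
      then have "(2^k * cmod (d k y))\<^sup>2 = 4^k * (cmod (d k y))\<^sup>2"
        by (simp only: power_mult_distrib)
      also have "\<dots> \<le> 8^k * (cmod (d k y))\<^sup>2"
        by (intro mult_right_mono power_mono) auto
      also have "\<dots> \<le> B" using B[of k] by simp
      finally have "2^k * cmod (d k y) \<le> sqrt B"
        by (rule real_le_rsqrt)
      then show ?thesis
        by (simp add: field_simps power_divide)
    qed
    moreover have "summable (\<lambda>k. sqrt B * (1/2)^k)"
      by (intro summable_mult summable_geometric) simp
    ultimately have "summable (\<lambda>k. d k y)"
      by (rule summable_comparison_test'[where N=0, rotated])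
    then have "convergent (\<lambda>k. f (r 0) y + (\<Sum>i<k. d i y))"
      by (intro convergent_add convergent_const) (simp add: summable_iff_convergent)
    moreover have "(\<Sum>i<k. d i y) = f (r k) y - f (r 0) y" for k
      unfolding d_def by (rule sum_lessThan_telescope)
    ultimately show "convergent (\<lambda>k. f (r k) y)"
      by simp
  qed
  define g where "g y = lim (\<lambda>k. f (r k) y)" for y
  have [measurable]: "g \<in> borel_measurable ?M"
    unfolding g_def by (rule borel_measurable_lim_metric) auto
  have lim: "AE y in ?M. (\<lambda>k. f (r k) y) \<longlonglongrightarrow> g y"
    using conv by eventually_elim (simp add: g_def convergent_LIMSEQ_iff)
  have key: "(\<integral>\<^sup>+y. ennreal ((cmod (f n y - g y))\<^sup>2) \<partial>?M) \<le> ennreal (((1/4)^j)\<^sup>2)" if n: "n \<ge> N j" for n j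
  proof -
    have "(\<integral>\<^sup>+y. ennreal ((cmod (f n y - g y))\<^sup>2) \<partial>?M)
        = (\<integral>\<^sup>+y. liminf (\<lambda>k. ennreal ((cmod (f n y - f (r k) y))\<^sup>2)) \<partial>?M)"
    proof (rule nn_integral_cong_AE)
      show "AE y in ?M. ennreal ((cmod (f n y - g y))\<^sup>2)
          = liminf (\<lambda>k. ennreal ((cmod (f n y - f (r k) y))\<^sup>2))"
        using lim
      proof eventually_elim
        fix y assume "(\<lambda>k. f (r k) y) \<longlonglongrightarrow> g y"
        then have "(\<lambda>k. ennreal ((cmod (f n y - f (r k) y))\<^sup>2)) \<longlonglongrightarrow> ennreal ((cmod (f n y - g y))\<^sup>2)"
          by (intro tendsto_intros)
        then show "ennreal ((cmod (f n y - g y))\<^sup>2) = liminf (\<lambda>k. ennreal ((cmod (f n y - f (r k) y))\<^sup>2))"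
          by (intro lim_imp_Liminf[symmetric]) auto
      qed
    qed
    also have "\<dots> \<le> liminf (\<lambda>k. \<integral>\<^sup>+y. ennreal ((cmod (f n y - f (r k) y))\<^sup>2) \<partial>?M)"
      by (rule nn_integral_liminf) auto
    also have "\<dots> \<le> ennreal (((1/4)^j)\<^sup>2)"
    proof (rule Liminf_le)
      show "\<forall>\<^sub>F k in sequentially. (\<integral>\<^sup>+y. ennreal ((cmod (f n y - f (r k) y))\<^sup>2) \<partial>?M) \<le> ennreal (((1/4)^j)\<^sup>2)"
        using eventually_ge_at_top[of "N j"]
      proof eventually_elim
        fix k assume "k \<ge> N j"
        then have "r k \<ge> N j" by (simp add: r_def)
        then have "(L2norm S (\<lambda>y. f n y - f (r k) y))\<^sup>2 \<le> ((1/4)^j)\<^sup>2"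
          using N[OF n] by (intro power_mono) (auto intro: less_imp_le)
        then show "(\<integral>\<^sup>+y. ennreal ((cmod (f n y - f (r k) y))\<^sup>2) \<partial>?M) \<le> ennreal (((1/4)^j)\<^sup>2)"
          by (subst nn[OF L2_diff[OF L2 L2]]) (rule ennreal_leI)
      qed
    qed auto
    finally show ?thesis .
  qed
  have diff: "(\<lambda>y. f n y - g y) \<in> L2 S" if n: "n \<ge> N j" for n j
  proof -
    have "integrable ?M (\<lambda>y. (cmod (f n y - g y))\<^sup>2)"
      using key[OF n] by (intro integrableI_bounded) (auto intro: le_less_trans simp: less_top)
    then show ?thesis by (auto simp: L2_def)
  qed
  \<comment> \<open>The limit is one approximant minus its difference from the limit, and both are
    known to be square integrable.\<close>
  have "(\<lambda>y. f (N 0) y - (f (N 0) y - g y)) \<in> L2 S"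
    by (intro L2_diff L2 diff[of 0]) auto
  then have gL2: "g \<in> L2 S" by simp
  have bound: "L2norm S (\<lambda>y. f n y - g y) \<le> (1/4)^j" if n: "n \<ge> N j" for n j
  proof (rule power2_le_imp_le)
    show "(L2norm S (\<lambda>y. f n y - g y))\<^sup>2 \<le> ((1/4)^j)\<^sup>2"
      using key[OF n] by (simp add: nn[OF diff[OF n]])
  qed simp
  have "(\<lambda>n. L2norm S (\<lambda>y. f n y - g y)) \<longlonglongrightarrow> 0"
  proof (rule LIMSEQ_I)
    fix e :: real assume "e > 0"
    then obtain j where "(1/4)^j < e"
      using real_arch_pow_inv[of e "1/4"] by auto
    then show "\<exists>no. \<forall>n\<ge>no. norm (L2norm S (\<lambda>y. f n y - g y) - 0) < e"
      using bound[where j=j] by (intro exI[of _ "N j"]) (auto intro: le_less_trans)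
  qed
  with gL2 show ?thesis by blast
qed

section \<open>Antiderivatives of integrable functions\<close>

lemma integrable_lebesgue_on_mono:
  fixes f :: "real \<Rightarrow> 'b::{banach, second_countable_topology}"
  assumes "integrable (lebesgue_on S) f" "T \<subseteq> S" "S \<in> sets lebesgue" "T \<in> sets lebesgue"
  shows "integrable (lebesgue_on T) f"
proof -
  have "integrable lebesgue (\<lambda>y. indicat_real S y *\<^sub>R f y)"
    using assms by (simp add: integrable_restrict_space)
  then have "integrable lebesgue (\<lambda>y. indicat_real T y *\<^sub>R (indicat_real S y *\<^sub>R f y))"
    by (rule integrable_mult_indicator[OF assms(4)])
  also have "(\<lambda>y. indicat_real T y *\<^sub>R (indicat_real S y *\<^sub>R f y)) = (\<lambda>y. indicat_real T y *\<^sub>R f y)"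
    using assms(2) by (auto simp: fun_eq_iff indicator_def)
  finally show ?thesis
    using assms by (simp add: integrable_restrict_space)
qed

lemma integral_lebesgue_on_combine:
  fixes f :: "real \<Rightarrow> complex"
  assumes "integrable (lebesgue_on {a..c}) f" "a \<le> b" "b \<le> c"
  shows "(LINT y|lebesgue_on {a..c}. f y)
    = (LINT y|lebesgue_on {a..b}. f y) + (LINT y|lebesgue_on {b..c}. f y)"
proof -
  have ab: "integrable (lebesgue_on {a..b}) f" and bc: "integrable (lebesgue_on {b..c}) f"
    using assms by (auto intro: integrable_lebesgue_on_mono)
  show ?thesis
    using Henstock_Kurzweil_Integration.integral_combine[OF assms(2,3) integrable_on_lebesgue_on[OF assms(1)]]
    by (simp add: lebesgue_integral_eq_integral assms(1) ab bc)
qed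

lemma continuous_on_integrable_lebesgue_on:
  fixes f :: "real \<Rightarrow> 'b::euclidean_space"
  assumes "continuous_on {a..b} f"
  shows "integrable (lebesgue_on {a..b}) f"
  using assms by (rule continuous_imp_integrable_real)

text \<open>\<open>AD S f F\<close> says that \<open>F\<close> is absolutely continuous on the interval \<open>S\<close> with derivative \<open>f\<close>
  almost everywhere; the integral form avoids differentiating \<open>F\<close>.\<close>

definition AD :: "real set \<Rightarrow> (real \<Rightarrow> complex) \<Rightarrow> (real \<Rightarrow> complex) \<Rightarrow> bool" where
  "AD S f F \<longleftrightarrow> (\<forall>a\<in>S. \<forall>b\<in>S. a \<le> b \<longrightarrow> integrable (lebesgue_on {a..b}) f
     \<and> F b - F a = (LINT y|lebesgue_on {a..b}. f y))"

lemma AD_D: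
  assumes "AD S f F" "a \<in> S" "b \<in> S" "a \<le> b"
  shows "integrable (lebesgue_on {a..b}) f" "F b - F a = (LINT y|lebesgue_on {a..b}. f y)"
  using assms by (auto simp: AD_def)

lemma AD_subset: "AD S f F \<Longrightarrow> T \<subseteq> S \<Longrightarrow> AD T f F"
  by (auto simp: AD_def)

lemma is_interval_Icc_subset:
  assumes "is_interval S" "a \<in> S" "b \<in> S"
  shows "{a..b::real} \<subseteq> S"
  by (rule subsetI, rule mem_is_interval_1_I[OF assms]) auto

lemma AD_cong:
  assumes "AD S f F" "\<And>y. y \<in> S \<Longrightarrow> f y = g y" "\<And>y. y \<in> S \<Longrightarrow> F y = G y" "is_interval S"
  shows "AD S g G"
  unfolding AD_def
proof (intro ballI impI conjI)
  fix a b assume ab: "a \<in> S" "b \<in> S" "a \<le> b"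
  have sub: "{a..b} \<subseteq> S" using is_interval_Icc_subset[OF assms(4) ab(1,2)] .
  show "integrable (lebesgue_on {a..b}) g"
    using AD_D(1)[OF assms(1) ab] sub assms(2)
    by (subst Bochner_Integration.integrable_cong[OF refl, of _ g f]) auto
  have "(LINT y|lebesgue_on {a..b}. f y) = (LINT y|lebesgue_on {a..b}. g y)"
    using sub assms(2) by (intro Bochner_Integration.integral_cong) auto
  then show "G b - G a = (LINT y|lebesgue_on {a..b}. g y)"
    using AD_D(2)[OF assms(1) ab] assms(3) ab by simp
qed

lemma AE_lebesgue_on_mono:
  assumes "AE y in lebesgue_on S. P y" "T \<subseteq> S" "S \<in> sets lebesgue" "T \<in> sets lebesgue"
  shows "AE y in lebesgue_on T. P y"
proof -
  have "AE y in lebesgue. y \<in> S \<longrightarrow> P y"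
    using assms(1,3) by (simp add: AE_restrict_space_iff)
  then have "AE y in lebesgue. y \<in> T \<longrightarrow> P y"
    by eventually_elim (use assms(2) in blast)
  then show ?thesis
    using assms(4) by (simp add: AE_restrict_space_iff)
qed

lemma AE_lebesgue_onI:
  assumes "AE y in lebesgue. P y" "S \<in> sets lebesgue"
  shows "AE y in lebesgue_on S. P y"
proof -
  have "AE y in lebesgue. y \<in> S \<longrightarrow> P y"
    using assms(1) by eventually_elim simp
  then show ?thesis
    using assms(2) by (simp add: AE_restrict_space_iff)
qed

lemma AD_cong_AE:
  assumes "AD S f F" "AE y in lebesgue_on S. f y = g y" "is_interval S" "S \<in> sets lebesgue"
  shows "AD S g F"
  unfolding AD_def
proof (intro ballI impI conjI)
  fix a b assume ab: "a \<in> S" "b \<in> S" "a \<le> b"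
  have ae: "AE y in lebesgue_on {a..b}. f y = g y"
    by (rule AE_lebesgue_on_mono[OF assms(2) is_interval_Icc_subset[OF assms(3) ab(1,2)] assms(4)]) simp
  have f: "integrable (lebesgue_on {a..b}) f"
    using AD_D(1)[OF assms(1) ab] .
  have g: "g \<in> borel_measurable (lebesgue_on {a..b})"
    by (rule borel_measurable_lebesgue_on_AE[OF _ ae]) (use f in auto)
  show "integrable (lebesgue_on {a..b}) g"
    by (rule integrable_cong_AE_imp[OF f g]) (use ae in simp)
  show "F b - F a = (LINT y|lebesgue_on {a..b}. g y)"
    using AD_D(2)[OF assms(1) ab] integral_cong_AE[OF _ g ae] f by simp
qed

lemma AD_add:
  assumes "AD S f F" "AD S g G"
  shows "AD S (\<lambda>y. f y + g y) (\<lambda>y. F y + G y)"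
  unfolding AD_def
proof (intro ballI impI conjI)
  fix a b assume ab: "a \<in> S" "b \<in> S" "a \<le> b"
  show "integrable (lebesgue_on {a..b}) (\<lambda>y. f y + g y)"
    using AD_D(1)[OF assms(1) ab] AD_D(1)[OF assms(2) ab] by simp
  show "F b + G b - (F a + G a) = (LINT y|lebesgue_on {a..b}. f y + g y)"
    using AD_D[OF assms(1) ab] AD_D[OF assms(2) ab] by (simp add: algebra_simps)
qed

lemma AD_cmult:
  assumes "AD S f F"
  shows "AD S (\<lambda>y. c * f y) (\<lambda>y. c * F y)"
  unfolding AD_def
proof (intro ballI impI conjI)
  fix a b assume ab: "a \<in> S" "b \<in> S" "a \<le> b"
  show "integrable (lebesgue_on {a..b}) (\<lambda>y. c * f y)"
    using AD_D(1)[OF assms ab] by simp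
  show "c * F b - c * F a = (LINT y|lebesgue_on {a..b}. c * f y)"
    by (simp only: integral_mult_right_zero AD_D(2)[OF assms ab, symmetric] right_diff_distrib)
qed

lemma AD_cnj:
  assumes "AD S f F"
  shows "AD S (\<lambda>y. cnj (f y)) (\<lambda>y. cnj (F y))"
  unfolding AD_def
proof (intro ballI impI conjI)
  fix a b assume ab: "a \<in> S" "b \<in> S" "a \<le> b"
  show "integrable (lebesgue_on {a..b}) (\<lambda>y. cnj (f y))"
    using AD_D(1)[OF assms ab] by simp
  show "cnj (F b) - cnj (F a) = (LINT y|lebesgue_on {a..b}. cnj (f y))"
    using AD_D(2)[OF assms ab] by (metis complex_cnj_diff Bochner_Integration.integral_cnj)
qed

lemma AD_const: "AD S (\<lambda>y. 0) (\<lambda>y. c)"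
  by (simp add: AD_def)

lemma AD_indefinite:
  assumes "integrable (lebesgue_on {a..b}) f"
  shows "AD {a..b} f (\<lambda>y. c + (LINT t|lebesgue_on {a..y}. f t))"
  unfolding AD_def
proof (intro ballI impI conjI)
  fix x y assume xy: "x \<in> {a..b}" "y \<in> {a..b}" "x \<le> y"
  show "integrable (lebesgue_on {x..y}) f"
    by (rule integrable_lebesgue_on_mono[OF assms]) (use xy in auto)
  have "integrable (lebesgue_on {a..y}) f"
    by (rule integrable_lebesgue_on_mono[OF assms]) (use xy in auto)
  from integral_lebesgue_on_combine[OF this, of x] xy
  show "c + (LINT t|lebesgue_on {a..y}. f t) - (c + (LINT t|lebesgue_on {a..x}. f t))
      = (LINT y|lebesgue_on {x..y}. f y)" by simp
qed

text \<open>The interval \<open>S\<close> may be half-open or unbounded, so continuity is tested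
  along sequences: a convergent sequence together with its limit spans a compact subinterval of
  \<open>S\<close>, on which indefinite integrals are continuous.\<close>

lemma AD_continuous:
  assumes AD: "AD S f F" and S: "is_interval S"
  shows "continuous_on S F"
proof (unfold continuous_on_sequentially, safe)
  fix x u assume x: "x \<in> S" and u: "\<forall>n. u n \<in> S" and lim: "u \<longlonglongrightarrow> x"
  let ?K = "insert x (range u)"
  have K: "compact ?K" using compact_sequence_with_limit[OF lim] .
  obtain a b where a: "a \<in> ?K" "\<And>y. y \<in> ?K \<Longrightarrow> a \<le> y" and b: "b \<in> ?K" "\<And>y. y \<in> ?K \<Longrightarrow> y \<le> b"
    using compact_attains_inf[OF K] compact_attains_sup[OF K] by (metis empty_not_insert)
  have abS: "a \<in> S" "b \<in> S" using a(1) b(1) x u by auto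
  have sub: "{a..b} \<subseteq> S" using is_interval_Icc_subset[OF S abS] .
  have ab: "a \<le> b" using a b by auto
  have int: "integrable (lebesgue_on {a..b}) f" using AD_D(1)[OF AD abS ab] .
  have eq: "F y = F a + integral {a..y} f" if "y \<in> {a..b}" for y
  proof -
    have "y \<in> S" "a \<le> y" using that sub by auto
    from AD_D[OF AD abS(1) this] show ?thesis
      by (simp add: lebesgue_integral_eq_integral algebra_simps)
  qed
  have "continuous_on {a..b} (\<lambda>y. F a + integral {a..y} f)"
    by (intro continuous_intros indefinite_integral_continuous_1 integrable_on_lebesgue_on[OF int]) simp
  then have "continuous_on {a..b} F"
    by (rule continuous_on_eq) (simp only: eq)
  moreover have "\<forall>n. u n \<in> {a..b}" "x \<in> {a..b}"
    using a(2)[of "u _"] b(2)[of "u _"] a(2)[of x] b(2)[of x] by simp_all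
  ultimately show "(F \<circ> u) \<longlonglongrightarrow> F x"
    using lim unfolding continuous_on_sequentially by blast
qed

lemma AD_C1:
  assumes S: "is_interval S" and d: "\<And>y. y \<in> S \<Longrightarrow> (F has_vector_derivative f y) (at y within S)"
    and c: "continuous_on S f"
  shows "AD S f F"
  unfolding AD_def
proof (intro ballI impI conjI)
  fix a b assume ab: "a \<in> S" "b \<in> S" "a \<le> b"
  have sub: "{a..b} \<subseteq> S" using is_interval_Icc_subset[OF S ab(1,2)] .
  have int: "integrable (lebesgue_on {a..b}) f"
    by (rule continuous_on_integrable_lebesgue_on) (rule continuous_on_subset[OF c sub])
  then show "integrable (lebesgue_on {a..b}) f" .
  have "(f has_integral F b - F a) {a..b}"
    by (rule fundamental_theorem_of_calculus[OF ab(3)])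
       (use d sub in \<open>blast intro: has_vector_derivative_within_subset\<close>)
  then show "F b - F a = (LINT y|lebesgue_on {a..b}. f y)"
    by (simp add: lebesgue_integral_eq_integral[OF int] integral_unique)
qed

text \<open>The square is split along its diagonal, and each term on the left is the integral over
  one triangle. This is integration by parts for two functions that vanish at
  \<open>a\<close>.\<close>

lemma integral_triangle_Fubini:
  fixes f g :: "real \<Rightarrow> complex"
  assumes f: "integrable (lebesgue_on {a..b}) f" and g: "integrable (lebesgue_on {a..b}) g"
  shows "(LINT y|lebesgue_on {a..b}. f y * (LINT t|lebesgue_on {a..y}. g t))
       + (LINT y|lebesgue_on {a..b}. (LINT t|lebesgue_on {a..y}. f t) * g y)
       = (LINT y|lebesgue_on {a..b}. f y) * (LINT y|lebesgue_on {a..b}. g y)"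
proof -
  let ?M = "lebesgue_on {a..b}"
  interpret M: finite_measure ?M
    by (rule finite_measure_lebesgue_on) simp
  interpret P: pair_sigma_finite ?M ?M ..
  have [measurable]: "f \<in> borel_measurable ?M" "g \<in> borel_measurable ?M"
    using f g by auto
  have [measurable]: "(\<lambda>x. x) \<in> borel_measurable ?M"
    by (simp add: measurable_restrict_space1 measurable_completion)
  \<comment> \<open>\<open>k\<close> is the indicator of a triangle. The two triangles overlap in
    the diagonal, so they add up to the square only almost everywhere.\<close>
  define k where "k = (\<lambda>(y::real) (t::real). if t \<le> y then 1 else 0 :: complex)"
  have [measurable]: "(\<lambda>(t,y). k y t) \<in> borel_measurable (?M \<Otimes>\<^sub>M ?M)"
    unfolding k_def by measurable
  have [measurable]: "(\<lambda>(t,y). k t y) \<in> borel_measurable (?M \<Otimes>\<^sub>M ?M)"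
    unfolding k_def by measurable
  have prod: "integrable (?M \<Otimes>\<^sub>M ?M) (\<lambda>(t,y). f t * g y)"
    by (rule P.Fubini_integrable) (use f g in \<open>auto simp: norm_mult\<close>)
  have int1: "integrable (?M \<Otimes>\<^sub>M ?M) (\<lambda>(t,y). k y t * (f t * g y))"
    by (rule Bochner_Integration.integrable_bound[OF prod]) (auto simp: k_def)
  have int2: "integrable (?M \<Otimes>\<^sub>M ?M) (\<lambda>(t,y). k t y * (f t * g y))"
    by (rule Bochner_Integration.integrable_bound[OF prod]) (auto simp: k_def)
  have k: "(LINT t|lebesgue_on {a..y}. h t) = (LINT t|?M. k y t * h t)" if "y \<in> {a..b}" for y h
  proof -
    have "(LINT t|?M. k y t * h t) = (LINT t|?M. (if t \<in> {a..y} then h t else 0))"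
      by (rule Bochner_Integration.integral_cong) (auto simp: k_def)
    also have "\<dots> = (LINT t|lebesgue_on {a..y}. h t)"
      using that by (intro integral_restrict) auto
    finally show ?thesis ..
  qed
  have "(LINT y|?M. f y * (LINT t|lebesgue_on {a..y}. g t)) = (LINT y|?M. LINT t|?M. k y t * (f y * g t))"
  proof (rule Bochner_Integration.integral_cong[OF refl])
    fix y assume "y \<in> space ?M"
    then have "(LINT t|lebesgue_on {a..y}. g t) = (LINT t|?M. k y t * g t)"
      by (intro k) simp
    then have "(LINT t|?M. f y * (k y t * g t)) = f y * (LINT t|lebesgue_on {a..y}. g t)"
      by (simp only: integral_mult_right_zero)
    then show "f y * (LINT t|lebesgue_on {a..y}. g t) = (LINT t|?M. k y t * (f y * g t))"
      by (simp only: mult.left_commute)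
  qed
  moreover have "(LINT y|?M. (LINT t|lebesgue_on {a..y}. f t) * g y) = (LINT y|?M. LINT t|?M. k y t * (f t * g y))"
  proof (rule Bochner_Integration.integral_cong[OF refl])
    fix y assume "y \<in> space ?M"
    then have "(LINT t|lebesgue_on {a..y}. f t) = (LINT t|?M. k y t * f t)"
      by (intro k) simp
    then have "(LINT t|?M. (k y t * f t) * g y) = (LINT t|lebesgue_on {a..y}. f t) * g y"
      by (simp only: integral_mult_left_zero)
    then show "(LINT t|lebesgue_on {a..y}. f t) * g y = (LINT t|?M. k y t * (f t * g y))"
      by (simp only: mult.assoc)
  qed
  moreover have "\<dots> = (LINT t|?M. LINT y|?M. k y t * (f t * g y))"
    by (rule P.Fubini_integral[OF int1])
  moreover have "(LINT t|?M. LINT y|?M. k t y * (f t * g y)) + (LINT t|?M. LINT y|?M. k y t * (f t * g y))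
     = (LINT z|(?M \<Otimes>\<^sub>M ?M). (case z of (t,y) \<Rightarrow> k t y * (f t * g y)) + (case z of (t,y) \<Rightarrow> k y t * (f t * g y)))"
    using P.integral_fst'[OF int1] P.integral_fst'[OF int2] int1 int2 by simp
  moreover have "\<dots> = (LINT t|?M. LINT y|?M. f t * g y)"
  proof -
    have "\<dots> = (LINT t|?M. LINT y|?M. k t y * (f t * g y) + k y t * (f t * g y))"
      using P.integral_fst'[OF Bochner_Integration.integrable_add[OF int2 int1]] by simp
    also have "\<dots> = (LINT t|?M. LINT y|?M. f t * g y)"
    proof (rule Bochner_Integration.integral_cong[OF refl])
      fix t :: real
      have "AE y in lebesgue. y \<noteq> t"
        by (intro AE_completion AE_lborel_singleton)
      then have "AE y in ?M. y \<noteq> t"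
        by (rule AE_lebesgue_onI) simp
      then have "AE y in ?M. k t y * (f t * g y) + k y t * (f t * g y) = f t * g y"
        by eventually_elim (auto simp: k_def)
      then show "(LINT y|?M. k t y * (f t * g y) + k y t * (f t * g y)) = (LINT y|?M. f t * g y)"
        by (intro integral_cong_AE) (auto simp: k_def)
    qed
    finally show ?thesis .
  qed
  moreover have "\<dots> = (LINT y|?M. f y) * (LINT y|?M. g y)"
    by simp
  ultimately show ?thesis by simp
qed

lemma continuous_on_Icc_norm_bounded:
  fixes h :: "real \<Rightarrow> complex"
  assumes "continuous_on {a..b} h"
  obtains B where "B \<ge> 0" "\<And>y. y \<in> {a..b} \<Longrightarrow> norm (h y) \<le> B"
proof -
  have "bounded (h ` {a..b})"
    by (intro compact_imp_bounded compact_continuous_image[OF assms]) simp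
  then obtain B where "\<forall>y\<in>{a..b}. norm (h y) \<le> B" unfolding bounded_iff by blast
  then show thesis by (intro that[of "max 0 B"]) (auto simp: le_max_iff_disj)
qed

lemma integrable_mult_continuous:
  fixes h H :: "real \<Rightarrow> complex"
  assumes h: "integrable (lebesgue_on {a..b}) h" and H: "continuous_on {a..b} H"
  shows "integrable (lebesgue_on {a..b}) (\<lambda>y. h y * H y)"
proof -
  obtain B where B: "B \<ge> 0" "\<And>y. y \<in> {a..b} \<Longrightarrow> norm (H y) \<le> B"
    using continuous_on_Icc_norm_bounded[OF H] by blast
  have m: "H \<in> borel_measurable (lebesgue_on {a..b})"
    by (rule continuous_imp_measurable_on_sets_lebesgue[OF H]) simp
  show ?thesis
  proof (rule Bochner_Integration.integrable_bound)
    show "integrable (lebesgue_on {a..b}) (\<lambda>y. B * norm (h y))" using h by auto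
    show "(\<lambda>y. h y * H y) \<in> borel_measurable (lebesgue_on {a..b})" using h m by auto
    show "AE y in lebesgue_on {a..b}. norm (h y * H y) \<le> norm (B * norm (h y))"
    proof (rule AE_I2)
      fix y assume "y \<in> space (lebesgue_on {a..b})"
      then have "norm (H y) \<le> \<bar>B\<bar>" using B(2)[of y] by simp
      from mult_right_mono[OF this norm_ge_zero[of "h y"]]
      show "norm (h y * H y) \<le> norm (B * norm (h y))"
        by (simp add: norm_mult abs_mult mult.commute)
    qed
  qed
qed

text \<open>After subtraction of the values at \<open>a\<close> both factors are indefinite
  integrals, whose product is handled by \<open>integral_triangle_Fubini\<close>; the remaining
  terms are linear. This is the integration by parts behind every energy identity below.\<close>

lemma AD_mult:
  assumes F: "AD S f F" and G: "AD S g G" and S: "is_interval S"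
  shows "AD S (\<lambda>y. f y * G y + F y * g y) (\<lambda>y. F y * G y)"
  unfolding AD_def
proof (intro ballI impI)
  fix a b assume ab: "a \<in> S" "b \<in> S" "a \<le> b"
  let ?M = "lebesgue_on {a..b}"
  have sub: "{a..b} \<subseteq> S" using is_interval_Icc_subset[OF S ab(1,2)] .
  have f: "integrable ?M f" and g: "integrable ?M g"
    using AD_D(1)[OF F ab] AD_D(1)[OF G ab] .
  have cont: "continuous_on {a..b} F" "continuous_on {a..b} G"
    using AD_continuous[OF F S] AD_continuous[OF G S] sub by (blast intro: continuous_on_subset)+
  have int1: "integrable ?M (\<lambda>y. f y * G y)" using integrable_mult_continuous[OF f cont(2)] .
  have int2: "integrable ?M (\<lambda>y. F y * g y)" using integrable_mult_continuous[OF g cont(1)] by (simp add: mult.commute)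
  define IF where "IF y = (LINT t|lebesgue_on {a..y}. f t)" for y
  define IG where "IG y = (LINT t|lebesgue_on {a..y}. g t)" for y
  have Feq: "IF y = F y - F a" and Geq: "IG y = G y - G a" if "y \<in> {a..b}" for y
    using AD_D(2)[OF F ab(1), of y] AD_D(2)[OF G ab(1), of y] that sub
    by (auto simp: IF_def IG_def)
  have "continuous_on {a..b} (\<lambda>y. F y - F a)"
    by (intro continuous_intros cont)
  then have cI1: "continuous_on {a..b} IF"
    by (rule continuous_on_eq) (simp add: Feq)
  have "continuous_on {a..b} (\<lambda>y. G y - G a)"
    by (intro continuous_intros cont)
  then have cI2: "continuous_on {a..b} IG"
    by (rule continuous_on_eq) (simp add: Geq)
  have i1: "integrable ?M (\<lambda>y. f y * IG y)" using integrable_mult_continuous[OF f cI2] .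
  have i2: "integrable ?M (\<lambda>y. IF y * g y)" using integrable_mult_continuous[OF g cI1] by (simp add: mult.commute)
  have "(LINT y|?M. f y * G y + F y * g y)
      = (LINT y|?M. G a * f y + F a * g y + (f y * IG y + IF y * g y))"
    by (rule Bochner_Integration.integral_cong) (auto simp: Feq Geq algebra_simps)
  also have "\<dots> = G a * (LINT y|?M. f y) + F a * (LINT y|?M. g y)
      + ((LINT y|?M. f y * IG y) + (LINT y|?M. IF y * g y))"
    using f g i1 i2 by simp
  also have "(LINT y|?M. f y * IG y) + (LINT y|?M. IF y * g y) = IF b * IG b"
    using integral_triangle_Fubini[OF f g] by (simp add: IF_def IG_def)
  also have "(LINT y|?M. f y) = IF b"
    by (simp add: IF_def)
  also have "(LINT y|?M. g y) = IG b"
    by (simp add: IG_def)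
  also have "G a * IF b + F a * IG b + IF b * IG b = F b * G b - F a * G a"
    using ab by (simp add: Feq[of b] Geq[of b] algebra_simps)
  finally show "integrable ?M (\<lambda>y. f y * G y + F y * g y) \<and>
     F b * G b - F a * G a = (LINT y|?M. f y * G y + F y * g y)"
    using int1 int2 by simp
qed

section \<open>Test functions\<close>

text \<open>Differentiability up to order n + 1, phrased by recursion on the derivative. Unlike the
  iterate \<open>deriv ^^ n\<close> in \<open>test_function\<close>, this form lets sums, products
  and compositions be treated by induction with the functions generalised. \<open>Ck n\<close> for
  all n is smoothness.\<close>

primrec Ck :: "nat \<Rightarrow> (real \<Rightarrow> real) \<Rightarrow> bool" where
  "Ck 0 f \<longleftrightarrow> f differentiable_on UNIV"
| "Ck (Suc n) f \<longleftrightarrow> f differentiable_on UNIV \<and> Ck n (deriv f)"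

lemma Ck_funpow: "Ck n f \<Longrightarrow> (deriv ^^ n) f differentiable_on UNIV"
  by (induction n arbitrary: f) (auto simp: funpow_swap1)

lemma funpow_Ck: "(\<And>i. (deriv ^^ i) f differentiable_on UNIV) \<Longrightarrow> Ck n f"
proof (induction n arbitrary: f)
  case 0
  then show ?case using "0"[of 0] by simp
next
  case (Suc n)
  have "(deriv ^^ i) (deriv f) differentiable_on UNIV" for i
    using Suc.prems[of "Suc i"] by (simp add: funpow_swap1)
  then show ?case using Suc.IH Suc.prems[of 0] by simp
qed

lemma Ck_differentiable: "Ck n f \<Longrightarrow> f differentiable_on UNIV"
  by (cases n) auto

lemma Ck_DERIV: "Ck n f \<Longrightarrow> (f has_real_derivative deriv f x) (at x)"
  using Ck_differentiable[of n f] DERIV_deriv_iff_real_differentiable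
  by (auto simp: differentiable_on_def)

lemma Ck_SucI:
  assumes "\<And>x. (f has_real_derivative f' x) (at x)" "Ck n f'"
  shows "Ck (Suc n) f"
proof -
  have "deriv f = f'" using assms(1) by (intro ext DERIV_imp_deriv)
  moreover have "f differentiable_on UNIV"
    using assms(1) by (auto simp: differentiable_on_def real_differentiable_def)
  ultimately show ?thesis using assms(2) by simp
qed

lemma Ck_0I:
  assumes "\<And>x. (f has_real_derivative f' x) (at x)"
  shows "Ck 0 f"
  using assms by (auto simp: differentiable_on_def real_differentiable_def)

lemma Ck_Suc_D: "Ck (Suc n) f \<Longrightarrow> Ck n f"
  by (induction n arbitrary: f) auto

lemma Ck_const: "Ck n (\<lambda>x. c)"
proof (induction n arbitrary: c)
  case 0
  show ?case by (rule Ck_0I) (auto intro!: derivative_eq_intros)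
next
  case (Suc n)
  show ?case by (rule Ck_SucI[OF _ Suc.IH[of 0]]) auto
qed

lemma Ck_add:
  assumes "Ck n f" "Ck n g"
  shows "Ck n (\<lambda>x. f x + g x)"
  using assms
proof (induction n arbitrary: f g)
  case 0
  then show ?case
    by (intro Ck_0I) (rule DERIV_add[OF Ck_DERIV[OF "0"(1)] Ck_DERIV[OF "0"(2)]])
next
  case (Suc n)
  show ?case
    by (rule Ck_SucI[OF DERIV_add[OF Ck_DERIV[OF Suc.prems(1)] Ck_DERIV[OF Suc.prems(2)]]])
       (use Suc in auto)
qed

lemma Ck_mult:
  assumes "Ck n f" "Ck n g"
  shows "Ck n (\<lambda>x. f x * g x)"
  using assms
proof (induction n arbitrary: f g)
  case 0
  then show ?case
    by (intro Ck_0I) (rule DERIV_mult[OF Ck_DERIV[OF "0"(1)] Ck_DERIV[OF "0"(2)]])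
next
  case (Suc n)
  have "Ck n f" "Ck n g" using Suc.prems Ck_Suc_D by blast+
  then have "Ck n (\<lambda>x. deriv f x * g x + deriv g x * f x)"
    using Suc by (intro Ck_add) auto
  then show ?case
    by (rule Ck_SucI[OF DERIV_mult[OF Ck_DERIV[OF Suc.prems(1)] Ck_DERIV[OF Suc.prems(2)]]])
qed

lemma Ck_cmult: "Ck n f \<Longrightarrow> Ck n (\<lambda>x. c * f x)"
  by (rule Ck_mult[OF Ck_const])

lemma Ck_affine:
  assumes "Ck n f"
  shows "Ck n (\<lambda>x. f (a * x + b))"
  using assms
proof (induction n arbitrary: f)
  case 0
  have "((\<lambda>x. f (a * x + b)) has_real_derivative deriv f (a * x + b) * a) (at x)" for x
    by (rule DERIV_chain2[OF Ck_DERIV[OF "0"]]) (auto intro!: derivative_eq_intros)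
  then show ?case by (rule Ck_0I)
next
  case (Suc n)
  have "((\<lambda>x. f (a * x + b)) has_real_derivative deriv f (a * x + b) * a) (at x)" for x
    by (rule DERIV_chain2[OF Ck_DERIV[OF Suc.prems]]) (auto intro!: derivative_eq_intros)
  moreover have "Ck n (\<lambda>x. deriv f (a * x + b) * a)"
    by (rule Ck_mult[OF Suc.IH Ck_const]) (use Suc.prems in simp)
  ultimately show ?case by (rule Ck_SucI)
qed

lemma Ck_exp:
  assumes "Ck n f"
  shows "Ck n (\<lambda>x. exp (f x))"
  using assms
proof (induction n arbitrary: f)
  case 0
  have "((\<lambda>x. exp (f x)) has_real_derivative exp (f x) * deriv f x) (at x)" for x
    by (rule DERIV_chain2[OF DERIV_exp Ck_DERIV[OF "0"]])
  then show ?case by (rule Ck_0I)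
next
  case (Suc n)
  have "((\<lambda>x. exp (f x)) has_real_derivative exp (f x) * deriv f x) (at x)" for x
    by (rule DERIV_chain2[OF DERIV_exp Ck_DERIV[OF Suc.prems]])
  moreover have "Ck n (\<lambda>x. exp (f x) * deriv f x)"
    by (rule Ck_mult) (use Suc Ck_Suc_D in auto)
  ultimately show ?case by (rule Ck_SucI)
qed

text \<open>The family \<open>p(1/x) exp(-1/x)\<close>, with \<open>p\<close> a polynomial, is closed under differentiation.\<close>

definition flat :: "real poly \<Rightarrow> real \<Rightarrow> real" where
  "flat p x = (if x > 0 then poly p (1/x) * exp (-1/x) else 0)"

lemma poly_times_exp_tendsto_0: "((\<lambda>t. poly p t * exp (-t)) \<longlongrightarrow> 0) (at_top :: real filter)"
proof -
  have "((\<lambda>t. \<Sum>i\<le>degree p. coeff p i * (t ^ i / exp t)) \<longlongrightarrow> (\<Sum>i\<le>degree p. coeff p i * 0)) at_top"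
    by (intro tendsto_sum tendsto_mult tendsto_const tendsto_power_div_exp_0)
  then show ?thesis
    by (simp add: poly_altdef exp_minus divide_inverse sum_distrib_right mult.assoc)
qed

text \<open>With t = 1/x the derivative on x > 0 is t^2 (p - p')(t) exp(-t), and
  \<open>[:0,0,1:]\<close> is t^2. At 0 the difference quotient from the right is t p(t) exp(-t),
  which tends to 0.\<close>

lemma flat_DERIV: "(flat p has_real_derivative flat ([:0,0,1:] * (p - pderiv p)) x) (at x)"
proof -
  consider "x > 0" | "x < 0" | "x = 0" by linarith
  then show ?thesis
  proof cases
    case 1
    have "((\<lambda>x. poly p (1/x) * exp (-1/x)) has_real_derivative
        flat ([:0,0,1:] * (p - pderiv p)) x) (at x)"
      using 1 by (auto intro!: derivative_eq_intros DERIV_chain2[OF poly_DERIV]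
          simp: flat_def field_simps power2_eq_square)
    moreover have "open {0<..<(x+1)}" "x \<in> {0<..<(x+1)}" using 1 by auto
    ultimately show ?thesis
      by (rule has_field_derivative_transform_within_open) (auto simp: flat_def)
  next
    case 2
    have "((\<lambda>x. 0) has_real_derivative flat ([:0,0,1:] * (p - pderiv p)) x) (at x)"
      using 2 by (auto simp: flat_def)
    moreover have "open {..<0::real}" "x \<in> {..<0}" using 2 by auto
    ultimately show ?thesis
      by (rule has_field_derivative_transform_within_open) (auto simp: flat_def)
  next
    case 3
    have "((\<lambda>y. flat p y / y) \<longlongrightarrow> 0) (at_right 0)"
    proof -
      have "((\<lambda>y. poly (pCons 0 p) (inverse y) * exp (- inverse y)) \<longlongrightarrow> 0) (at_right (0::real))"
        by (rule filterlim_compose[OF poly_times_exp_tendsto_0 filterlim_inverse_at_top_right])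
      then show ?thesis
      proof (rule Lim_transform_eventually)
        show "\<forall>\<^sub>F y in at_right 0. poly (pCons 0 p) (inverse y) * exp (- inverse y) = flat p y / y"
          using eventually_at_right_less[of "0::real"]
          by eventually_elim (simp add: flat_def field_simps)
      qed
    qed
    moreover have "((\<lambda>y. flat p y / y) \<longlongrightarrow> 0) (at_left 0)"
    proof (rule tendsto_eventually)
      show "\<forall>\<^sub>F y in at_left 0. flat p y / y = 0"
        by (auto simp: eventually_at_filter flat_def)
    qed
    ultimately have "((\<lambda>y. flat p y / y) \<longlongrightarrow> 0) (at 0)"
      by (rule filterlim_split_at[rotated])
    then show ?thesis
      using 3 by (simp add: has_field_derivative_iff flat_def)
  qed
qed

lemma Ck_flat: "Ck n (flat p)"
proof (induction n arbitrary: p)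
  case 0
  show ?case by (rule Ck_0I[OF flat_DERIV])
next
  case (Suc n)
  show ?case by (rule Ck_SucI[OF flat_DERIV Suc.IH])
qed

definition bump :: "real \<Rightarrow> real \<Rightarrow> real \<Rightarrow> real" where
  "bump a b x = flat 1 (x - a) * flat 1 (b - x)"

lemma Ck_bump: "Ck n (bump a b)"
proof -
  have "Ck n (\<lambda>x. flat 1 (1 * x + (- a)) * flat 1 ((-1) * x + b))"
    by (intro Ck_mult Ck_affine Ck_flat)
  then show ?thesis by (simp add: bump_def[abs_def] algebra_simps)
qed

lemma bump_pos: "a < x \<Longrightarrow> x < b \<Longrightarrow> bump a b x > 0"
  by (simp add: bump_def flat_def)

lemma bump_nonneg: "bump a b x \<ge> 0"
  by (simp add: bump_def flat_def)

lemma bump_eq_0: "x \<notin> {a<..<b} \<Longrightarrow> bump a b x = 0"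
  by (auto simp: bump_def flat_def)

lemma test_functionI:
  assumes "\<And>n. Ck n \<phi>" "\<And>x. x \<notin> {a..b} \<Longrightarrow> \<phi> x = 0" "{a..b} \<subseteq> \<Omega>"
  shows "test_function \<Omega> \<phi>"
proof -
  have sub: "{y. \<phi> y \<noteq> 0} \<subseteq> {a..b}"
    using assms(2) by blast
  then have cl: "closure {y. \<phi> y \<noteq> 0} \<subseteq> {a..b}"
    by (rule closure_minimal) simp
  have "bounded {y. \<phi> y \<noteq> 0}"
    by (rule bounded_subset[OF bounded_closed_interval sub])
  then have "compact (closure {y. \<phi> y \<noteq> 0})"
    by (simp add: compact_closure)
  then show ?thesis
    using assms(3) cl Ck_funpow[OF assms(1)] by (auto simp: test_function_def)
qed

text \<open>The functions 1 - exp(-n b), with b a bump positive exactly on the open interval,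
  increase to the indicator. Their support does not move with n, so all are test functions on any
  open set containing the closed interval.\<close>

lemma test_function_approx_indicator:
  obtains \<phi> :: "nat \<Rightarrow> real \<Rightarrow> real"
  where "\<And>n k. Ck k (\<phi> n)" "\<And>n x. x \<notin> {a<..<b} \<Longrightarrow> \<phi> n x = 0"
    "\<And>n x. \<bar>\<phi> n x\<bar> \<le> 1" "\<And>x. x \<in> {a<..<b} \<Longrightarrow> (\<lambda>n. \<phi> n x) \<longlonglongrightarrow> 1"
proof
  define \<phi> where "\<phi> n x = 1 + (-1) * exp ((- real n) * bump a b x)" for n :: nat and x
  show "Ck k (\<phi> n)" for n k
    unfolding \<phi>_def by (intro Ck_add Ck_const Ck_cmult Ck_exp Ck_bump)
  show "\<phi> n x = 0" if "x \<notin> {a<..<b}" for n x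
    using bump_eq_0[OF that] by (simp add: \<phi>_def)
  show "\<bar>\<phi> n x\<bar> \<le> 1" for n x
  proof -
    have "0 < exp ((- real n) * bump a b x)" "exp ((- real n) * bump a b x) \<le> 1"
      using bump_nonneg[of a b x] by simp_all
    then show ?thesis unfolding \<phi>_def by linarith
  qed
  show "(\<lambda>n. \<phi> n x) \<longlonglongrightarrow> 1" if "x \<in> {a<..<b}" for x
  proof -
    have pos: "bump a b x > 0" using bump_pos that by simp
    have "filterlim (\<lambda>n. bump a b x * real n) at_top sequentially"
      by (rule filterlim_tendsto_pos_mult_at_top[OF tendsto_const pos filterlim_real_sequentially])
    then have "filterlim (\<lambda>n. - (bump a b x * real n)) at_bot sequentially"
      by (simp add: filterlim_uminus_at_bot)
    then have "(\<lambda>n. exp (- (bump a b x * real n))) \<longlonglongrightarrow> 0"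
      by (rule filterlim_compose[OF exp_at_bot])
    then have "(\<lambda>n. 1 + (-1) * exp (- (bump a b x * real n))) \<longlonglongrightarrow> 1 + (-1) * 0"
      by (intro tendsto_intros)
    then show ?thesis by (simp add: \<phi>_def mult.commute)
  qed
qed


section \<open>Reduction to compact subintervals, and the fundamental lemma of the calculus of
  variations\<close>

lemma open_interval_compact_subset:
  fixes \<Omega> :: "real set"
  assumes "open \<Omega>" "is_interval \<Omega>" "\<Omega> \<noteq> {}" "compact K" "K \<subseteq> \<Omega>"
  obtains A B where "A \<in> \<Omega>" "B \<in> \<Omega>" "A < B" "K \<subseteq> {A<..<B}" "{A..B} \<subseteq> \<Omega>"
proof -
  obtain p where p: "p \<in> \<Omega>" using assms(3) by blast
  have K: "compact (insert p K)" using assms(4) by simp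
  obtain a b where a: "a \<in> insert p K" "\<And>y. y \<in> insert p K \<Longrightarrow> a \<le> y"
    and b: "b \<in> insert p K" "\<And>y. y \<in> insert p K \<Longrightarrow> y \<le> b"
    using compact_attains_inf[OF K] compact_attains_sup[OF K] by (metis empty_not_insert)
  have ab: "a \<in> \<Omega>" "b \<in> \<Omega>" using a(1) b(1) p assms(5) by blast+
  obtain e where e: "e > 0" "cball a e \<subseteq> \<Omega>" using assms(1) ab(1) open_contains_cball by blast
  obtain e' where e': "e' > 0" "cball b e' \<subseteq> \<Omega>" using assms(1) ab(2) open_contains_cball by blast
  have "a - e \<in> cball a e" "b + e' \<in> cball b e'" using e(1) e'(1) by (auto simp: dist_real_def)
  then have AB: "a - e \<in> \<Omega>" "b + e' \<in> \<Omega>" using e e' by blast+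
  show thesis
  proof (rule that[OF AB])
    have "a \<le> b" using a(2)[of b] b(1) by blast
    then show "a - e < b + e'" using e(1) e'(1) by linarith
    show "K \<subseteq> {a - e<..<b + e'}"
    proof
      fix y assume "y \<in> K"
      then have "a \<le> y" "y \<le> b" using a(2) b(2) by blast+
      then show "y \<in> {a - e<..<b + e'}" using e(1) e'(1) by simp
    qed
    show "{a - e..b + e'} \<subseteq> \<Omega>" by (rule is_interval_Icc_subset[OF assms(2) AB])
  qed
qed

lemma test_functionD:
  assumes "test_function \<Omega> \<phi>" "open \<Omega>" "is_interval \<Omega>" "\<Omega> \<noteq> {}"
  obtains A B where "A \<in> \<Omega>" "B \<in> \<Omega>" "A < B" "{A..B} \<subseteq> \<Omega>"
    "\<And>y. y \<notin> {A<..<B} \<Longrightarrow> \<phi> y = 0" "\<And>y. y \<notin> {A<..<B} \<Longrightarrow> deriv \<phi> y = 0"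
    "\<And>y. (\<phi> has_real_derivative deriv \<phi> y) (at y)" "continuous_on UNIV (deriv \<phi>)"
    "\<And>n. Ck n \<phi>"
proof -
  let ?K = "closure {y. \<phi> y \<noteq> 0}"
  have K: "compact ?K" "?K \<subseteq> \<Omega>" using assms(1) by (auto simp: test_function_def)
  obtain A B where AB: "A \<in> \<Omega>" "B \<in> \<Omega>" "A < B" "?K \<subseteq> {A<..<B}" "{A..B} \<subseteq> \<Omega>"
    using open_interval_compact_subset[OF assms(2-4) K] .
  have Ck: "Ck n \<phi>" for n
    using assms(1) by (intro funpow_Ck) (auto simp: test_function_def)
  have z: "\<phi> y = 0" if "y \<notin> ?K" for y
    using that closure_subset[of "{y. \<phi> y \<noteq> 0}"] by blast
  show thesis
  proof (rule that[OF AB(1-3,5)])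
    fix y assume y: "y \<notin> {A<..<B}"
    then have yK: "y \<in> - ?K" using AB(4) by blast
    then show "\<phi> y = 0" using z by blast
    have "((\<lambda>y. 0) has_real_derivative 0) (at y)" by simp
    moreover have "open (- ?K)" by (simp add: open_Compl)
    ultimately have "(\<phi> has_real_derivative 0) (at y)"
      using yK by (rule has_field_derivative_transform_within_open) (rule z[symmetric], simp)
    then show "deriv \<phi> y = 0" by (rule DERIV_imp_deriv)
  next
    show "(\<phi> has_real_derivative deriv \<phi> y) (at y)" for y by (rule Ck_DERIV[OF Ck[of 0]])
    show "continuous_on UNIV (deriv \<phi>)"
      using Ck[of 1] by (auto intro: differentiable_imp_continuous_on)
    show "Ck n \<phi>" for n by (rule Ck)
  qed
qed

lemma integral_supported:
  fixes f :: "real \<Rightarrow> complex"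
  assumes "\<And>y. y \<notin> {A<..<B} \<Longrightarrow> f y = 0" "{A..B} \<subseteq> S" "S \<in> sets lebesgue"
  shows "(LINT y|lebesgue_on S. f y) = (LINT y|lebesgue_on {A..B}. f y)"
proof -
  have "(LINT y|lebesgue_on S. f y) = (LINT y|lebesgue_on S. (if y \<in> {A..B} then f y else 0))"
    by (rule Bochner_Integration.integral_cong) (use assms(1) in auto)
  also have "\<dots> = (LINT y|lebesgue_on {A..B}. f y)"
    by (rule integral_restrict) (use assms in auto)
  finally show ?thesis .
qed

lemma open_sets_lebesgue: "open \<Omega> \<Longrightarrow> \<Omega> \<in> sets lebesgue"
  by (simp add: borel_open sets_completionI_sets)

lemma locally_integrable_Icc:
  "locally_integrable \<Omega> u \<Longrightarrow> {a..b} \<subseteq> \<Omega> \<Longrightarrow> integrable (lebesgue_on {a..b}) u"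
  by (simp add: locally_integrable_def)

text \<open>By Lebesgue differentiation almost every value is a limit of means over short intervals,
  and all these means vanish. The argument is local, on compact intervals with rational end points,
  of which countably many cover \<Omega>.\<close>

lemma AE_zero_if_Icc_integrals_zero:
  fixes u :: "real \<Rightarrow> complex"
  assumes \<Omega>: "open \<Omega>" "is_interval \<Omega>"
    and int: "\<And>a b. a \<le> b \<Longrightarrow> {a..b} \<subseteq> \<Omega> \<Longrightarrow> integrable (lebesgue_on {a..b}) u"
    and zero: "\<And>a b. a \<le> b \<Longrightarrow> {a..b} \<subseteq> \<Omega> \<Longrightarrow> (LINT y|lebesgue_on {a..b}. u y) = 0"
  shows "AE y in lebesgue_on \<Omega>. u y = 0"
proof -
  have loc: "AE y in lebesgue. y \<in> {c..d} \<longrightarrow> u y = 0" if cd: "{c..d} \<subseteq> \<Omega>" for c d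
  proof -
    \<comment> \<open>Extension by zero makes the integrals over all intervals vanish, also over
      those that leave {c..d}.\<close>
    define f where "f y = (if y \<in> {c..d} then u y else 0)" for y
    have f0: "f integrable_on {a..b} \<and> integral {a..b} f = 0" for a b
    proof (cases "max a c \<le> min b d")
      case True
      let ?a = "max a c" and ?b = "min b d"
      have eq: "{c..d} \<inter> {a..b} = {?a..?b}" by auto
      have sub: "{?a..?b} \<subseteq> \<Omega>" using cd by auto
      have "integral {?a..?b} u = 0" "u integrable_on {?a..?b}"
        using zero[OF True sub] lebesgue_integral_eq_integral[OF int[OF True sub]]
          integrable_on_lebesgue_on[OF int[OF True sub]] by auto
      then show ?thesis
        unfolding f_def by (simp only: integrable_restrict_Int integral_restrict_Int eq)
    next
      case False
      then have "\<And>y. y \<in> {a..b} \<Longrightarrow> f y = 0" by (auto simp: f_def)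
      then have "(f has_integral 0) {a..b}" by (rule has_integral_is_0)
      then show ?thesis by (auto simp: integrable_on_def integral_unique)
    qed
    obtain N where N: "negligible N" "\<And>x e. \<lbrakk>x \<notin> N; 0 < e\<rbrakk> \<Longrightarrow> \<exists>d>0. \<forall>h. 0 < h \<and> h < d \<longrightarrow>
          norm (integral (cbox x (x + h *\<^sub>R One)) f /\<^sub>R h ^ DIM(real) - f x) < e"
      using integrable_ccontinuous_explicit[of f] f0 by auto
    have fz: "f x = 0" if x: "x \<notin> N" for x
    proof (rule ccontr)
      assume "f x \<noteq> 0"
      then obtain d where "d > 0" and d: "\<forall>h. 0 < h \<and> h < d \<longrightarrow>
          norm (integral (cbox x (x + h *\<^sub>R One)) f /\<^sub>R h ^ DIM(real) - f x) < norm (f x)"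
        using N(2)[OF x, of "norm (f x)"] by auto
      then show False using spec[OF d, of "d/2"] f0 by simp
    qed
    have "AE y in lebesgue. y \<notin> N"
      using N(1) by (simp add: AE_not_in negligible_iff_null_sets)
    then show ?thesis
    proof eventually_elim
      fix y assume "y \<notin> N"
      from fz[OF this] show "y \<in> {c..d} \<longrightarrow> u y = 0" by (auto simp: f_def split: if_splits)
    qed
  qed
  let ?I = "{(c,d). c \<in> \<rat> \<and> d \<in> \<rat> \<and> {c..d} \<subseteq> \<Omega>}"
  have "countable ?I"
  proof (rule countable_subset)
    show "?I \<subseteq> \<rat> \<times> \<rat>" by blast
    show "countable (\<rat> \<times> \<rat> :: (real \<times> real) set)"
      by (intro countable_SIGMA countable_rat)
  qed
  then have "AE y in lebesgue. \<forall>i\<in>?I. y \<in> {fst i..snd i} \<longrightarrow> u y = 0"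
    by (subst AE_ball_countable) (use loc in auto)
  then have "AE y in lebesgue. y \<in> \<Omega> \<longrightarrow> u y = 0"
  proof eventually_elim
    fix y assume H: "\<forall>i\<in>?I. y \<in> {fst i..snd i} \<longrightarrow> u y = 0"
    show "y \<in> \<Omega> \<longrightarrow> u y = 0"
    proof
      assume "y \<in> \<Omega>"
      then obtain e where e: "e > 0" "ball y e \<subseteq> \<Omega>" using \<Omega>(1) open_contains_ball by blast
      obtain c where c: "c \<in> \<rat>" "y - e < c" "c < y" using Rats_dense_in_real[of "y - e" y] e(1) by auto
      obtain d where d: "d \<in> \<rat>" "y < d" "d < y + e" using Rats_dense_in_real[of y "y + e"] e(1) by auto
      have "{c..d} \<subseteq> ball y e" using c d by (auto simp: dist_real_def)
      then have "(c, d) \<in> ?I" using c d e(2) by auto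
      then show "u y = 0" using H c d by fastforce
    qed
  qed
  then show ?thesis
    using open_sets_lebesgue[OF \<Omega>(1)] by (simp add: AE_restrict_space_iff)
qed

text \<open>Test functions converging to the indicator of a compact interval turn the hypothesis, by
  dominated convergence, into the vanishing of all integrals over compact intervals.\<close>

lemma fundamental_lemma_calculus_variations:
  fixes u :: "real \<Rightarrow> complex"
  assumes \<Omega>: "open \<Omega>" "is_interval \<Omega>"
    and u: "locally_integrable \<Omega> u"
    and zero: "\<And>\<phi>. test_function \<Omega> \<phi> \<Longrightarrow> (LINT y|lebesgue_on \<Omega>. u y * of_real (\<phi> y)) = 0"
  shows "AE y in lebesgue_on \<Omega>. u y = 0"
proof (rule AE_zero_if_Icc_integrals_zero[OF \<Omega>])
  fix a b :: real assume ab: "a \<le> b" "{a..b} \<subseteq> \<Omega>"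
  show int: "integrable (lebesgue_on {a..b}) u"
    by (rule locally_integrable_Icc[OF u ab(2)])
  obtain \<phi> :: "nat \<Rightarrow> real \<Rightarrow> real"
    where Ck: "\<And>n k. Ck k (\<phi> n)" and supp: "\<And>n x. x \<notin> {a<..<b} \<Longrightarrow> \<phi> n x = 0"
    and bd: "\<And>n x. \<bar>\<phi> n x\<bar> \<le> 1" and lim: "\<And>x. x \<in> {a<..<b} \<Longrightarrow> (\<lambda>n. \<phi> n x) \<longlonglongrightarrow> 1"
    using test_function_approx_indicator[of a b] by blast
  have z: "(LINT y|lebesgue_on {a..b}. u y * of_real (\<phi> n y)) = 0" for n
  proof -
    have "test_function \<Omega> (\<phi> n)"
      by (rule test_functionI[OF Ck _ ab(2)]) (auto intro: supp)
    then have "(LINT y|lebesgue_on \<Omega>. u y * of_real (\<phi> n y)) = 0" by (rule zero)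
    then show ?thesis
      using integral_supported[of a b "\<lambda>y. u y * of_real (\<phi> n y)" \<Omega>] supp ab(2) open_sets_lebesgue[OF \<Omega>(1)]
      by simp
  qed
  have "(\<lambda>n. LINT y|lebesgue_on {a..b}. u y * of_real (\<phi> n y)) \<longlonglongrightarrow> (LINT y|lebesgue_on {a..b}. u y)"
  proof (rule integral_dominated_convergence[where w="\<lambda>y. norm (u y)"])
    show "u \<in> borel_measurable (lebesgue_on {a..b})" "integrable (lebesgue_on {a..b}) (\<lambda>y. norm (u y))"
      using int by auto
    show "(\<lambda>y. u y * of_real (\<phi> n y)) \<in> borel_measurable (lebesgue_on {a..b})" for n
    proof -
      have "continuous_on {a..b} (\<phi> n)"
        using Ck_differentiable[OF Ck] differentiable_imp_continuous_on continuous_on_subset by blast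
      then have "\<phi> n \<in> borel_measurable (lebesgue_on {a..b})"
        by (rule continuous_imp_measurable_on_sets_lebesgue) simp
      then show ?thesis using int by auto
    qed
    have "AE y in lebesgue. y \<noteq> a" "AE y in lebesgue. y \<noteq> b"
      by (intro AE_completion AE_lborel_singleton)+
    then have "AE y in lebesgue. y \<noteq> a \<and> y \<noteq> b"
      by eventually_elim simp
    then have "AE y in lebesgue_on {a..b}. y \<noteq> a \<and> y \<noteq> b"
      by (rule AE_lebesgue_onI) simp
    with AE_space have "AE y in lebesgue_on {a..b}. y \<in> {a<..<b}"
      by eventually_elim auto
    then show "AE y in lebesgue_on {a..b}. (\<lambda>n. u y * of_real (\<phi> n y)) \<longlonglongrightarrow> u y"
    proof eventually_elim
      fix y assume "y \<in> {a<..<b}"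
      then have "(\<lambda>n. u y * of_real (\<phi> n y)) \<longlonglongrightarrow> u y * of_real 1"
        by (intro tendsto_intros lim)
      then show "(\<lambda>n. u y * of_real (\<phi> n y)) \<longlonglongrightarrow> u y" by simp
    qed
    show "AE y in lebesgue_on {a..b}. norm (u y * of_real (\<phi> n y)) \<le> norm (u y)" for n
      using bd[of n] by (intro AE_I2) (simp add: norm_mult mult_left_le)
  qed
  then show "(LINT y|lebesgue_on {a..b}. u y) = 0"
    by (simp add: z LIMSEQ_const_iff)
qed

section \<open>Weak derivatives\<close>

text \<open>A primitive of \<open>\<eta>\<close> is constant to the right of the support, and zero
  mean makes this constant 0, so the primitive has compact support as well.\<close>

lemma Ck_antiderivative:
  assumes \<eta>: "\<And>n. Ck n \<eta>" and supp: "\<And>y. y \<notin> {A<..<B} \<Longrightarrow> \<eta> y = 0"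
    and zero: "(LINT y|lebesgue_on {A..B}. \<eta> y) = 0" and AB: "A < B"
  obtains \<phi> where "\<And>n. Ck n \<phi>" "\<And>y. y \<notin> {A..B} \<Longrightarrow> \<phi> y = 0" "deriv \<phi> = \<eta>"
proof -
  have cont: "continuous_on S \<eta>" for S
    using Ck_differentiable[OF \<eta>] differentiable_imp_continuous_on continuous_on_subset by blast
  \<comment> \<open>Starting one unit to the left of the support leaves room for two-sided
    derivatives at all points of [A, B].\<close>
  define \<phi> where "\<phi> y = integral {A-1..y} \<eta>" for y
  have left: "\<phi> y = 0" if "y \<le> A" for y
  proof -
    have "(\<eta> has_integral 0) {A-1..y}"
      by (rule has_integral_is_0) (use that supp in auto)
    then show ?thesis by (simp add: \<phi>_def integral_unique)
  qed
  have right: "\<phi> y = 0" if "y \<ge> B" for y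
  proof -
    have int: "\<eta> integrable_on {A-1..y}" by (rule integrable_continuous_real[OF cont])
    have int': "\<eta> integrable_on {A..y}" by (rule integrable_continuous_real[OF cont])
    have "integral {A-1..A} \<eta> + integral {A..y} \<eta> = \<phi> y"
      unfolding \<phi>_def by (rule Henstock_Kurzweil_Integration.integral_combine[OF _ _ int]) (use that AB in auto)
    moreover have "integral {A..B} \<eta> + integral {B..y} \<eta> = integral {A..y} \<eta>"
      by (rule Henstock_Kurzweil_Integration.integral_combine[OF _ _ int']) (use that AB in auto)
    moreover have "integral {B..y} \<eta> = 0"
    proof -
      have "(\<eta> has_integral 0) {B..y}"
        by (rule has_integral_is_0) (use supp in auto)
      then show ?thesis by (simp add: integral_unique)
    qed
    moreover have "integral {A..B} \<eta> = 0"
      using zero lebesgue_integral_eq_integral[OF continuous_on_integrable_lebesgue_on[OF cont, of A B]] by simp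
    moreover have "integral {A-1..A} \<eta> = 0"
      using left[of A] by (simp add: \<phi>_def)
    ultimately show ?thesis by simp
  qed
  have D: "(\<phi> has_real_derivative \<eta> y) (at y)" for y
  proof -
    consider "y < A" | "y > B" | "y \<in> {A-1<..<B+1}" by force
    then show ?thesis
    proof cases
      case 1
      have "((\<lambda>y. 0) has_real_derivative \<eta> y) (at y)" using 1 supp by simp
      moreover have "open {..<A}" "y \<in> {..<A}" using 1 by auto
      ultimately show ?thesis
        by (rule has_field_derivative_transform_within_open) (simp add: left)
    next
      case 2
      have "((\<lambda>y. 0) has_real_derivative \<eta> y) (at y)" using 2 supp by simp
      moreover have "open {B<..}" "y \<in> {B<..}" using 2 by auto
      ultimately show ?thesis
        by (rule has_field_derivative_transform_within_open) (simp add: right)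
    next
      case 3
      have "(\<phi> has_real_derivative \<eta> y) (at y within {A-1..B+1})"
        unfolding \<phi>_def by (rule integral_has_real_derivative[OF cont]) (use 3 in auto)
      moreover have "at y within {A-1..B+1} = at y"
        by (rule at_within_interior) (use 3 in simp)
      ultimately show ?thesis by simp
    qed
  qed
  have "Ck n \<phi>" for n
    by (rule Ck_Suc_D, rule Ck_SucI[OF D \<eta>])
  moreover have "deriv \<phi> = \<eta>" using D by (intro ext DERIV_imp_deriv)
  ultimately show thesis
    by (intro that[of \<phi>]) (auto intro: left right)
qed

lemma integral_of_real_mult_supported:
  fixes u :: "real \<Rightarrow> complex" and \<phi> :: "real \<Rightarrow> real"
  assumes "\<And>y. y \<notin> {A<..<B} \<Longrightarrow> \<phi> y = 0" "{A..B} \<subseteq> \<Omega>" "open \<Omega>"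
  shows "(LINT y|lebesgue_on \<Omega>. u y * of_real (\<phi> y)) = (LINT y|lebesgue_on {A..B}. u y * of_real (\<phi> y))"
  by (rule integral_supported) (use assms open_sets_lebesgue in auto)

lemma integrable_mult_test:
  fixes u :: "real \<Rightarrow> complex"
  assumes "locally_integrable \<Omega> u" "{A..B} \<subseteq> \<Omega>" "open \<Omega>" "continuous_on {A..B} \<phi>"
    "\<And>y. y \<notin> {A<..<B} \<Longrightarrow> \<phi> y = 0"
  shows "integrable (lebesgue_on \<Omega>) (\<lambda>y. u y * of_real (\<phi> y))"
proof -
  have "integrable (lebesgue_on {A..B}) (\<lambda>y. u y * of_real (\<phi> y))"
    by (rule integrable_mult_continuous[OF locally_integrable_Icc[OF assms(1,2)]])
       (use assms(4) in \<open>auto intro!: continuous_intros\<close>)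
  then have "integrable lebesgue (\<lambda>y. if y \<in> {A..B} then u y * of_real (\<phi> y) else 0)"
    by (rule iffD2[OF Lebesgue_Measure.integrable_restrict_UNIV, rotated]) simp
  also have "(\<lambda>y. if y \<in> {A..B} then u y * of_real (\<phi> y) else 0)
      = (\<lambda>y. if y \<in> \<Omega> then u y * of_real (\<phi> y) else 0)"
    using assms(2,5) by (force simp: fun_eq_iff)
  finally show ?thesis
    using Lebesgue_Measure.integrable_restrict_UNIV[OF open_sets_lebesgue[OF assms(3)], of "\<lambda>y. u y * of_real (\<phi> y)"] by simp
qed

lemma locally_integrable_diff:
  "locally_integrable \<Omega> u \<Longrightarrow> locally_integrable \<Omega> w \<Longrightarrow> locally_integrable \<Omega> (\<lambda>y. u y - w y)"
  by (simp add: locally_integrable_def)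

lemma locally_integrable_const: "locally_integrable \<Omega> (\<lambda>y. c)"
proof (unfold locally_integrable_def, intro allI impI)
  fix K assume "compact K \<and> K \<subseteq> \<Omega>"
  then have "K \<in> lmeasurable" by (simp add: lmeasurable_compact)
  then show "integrable (lebesgue_on K) (\<lambda>y. c)"
    by (intro finite_measure.integrable_const finite_measure_lebesgue_on)
qed

text \<open>A test function of mean zero is the derivative of a test function. An arbitrary
  \<open>\<psi>\<close> is reduced to mean zero by subtracting a multiple of a fixed
  \<open>\<rho>\<close> of integral 1, so \<open>G\<close> minus a constant annihilates all test
  functions and the fundamental lemma applies.\<close>

lemma du_Bois_Reymond:
  fixes G :: "real \<Rightarrow> complex"
  assumes \<Omega>: "open \<Omega>" "is_interval \<Omega>" "\<Omega> \<noteq> {}"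
    and G: "locally_integrable \<Omega> G"
    and zero: "\<And>\<phi>. test_function \<Omega> \<phi> \<Longrightarrow> (LINT y|lebesgue_on \<Omega>. G y * of_real (deriv \<phi> y)) = 0"
  obtains c where "AE y in lebesgue_on \<Omega>. G y = c"
proof -
  obtain a b where ab: "a < b" "{a..b} \<subseteq> \<Omega>"
    by (rule open_interval_compact_subset[OF \<Omega>, of "{}"]) auto
  have contb: "continuous_on S (bump a b)" for S
    using Ck_differentiable[OF Ck_bump] differentiable_imp_continuous_on continuous_on_subset by blast
  have intb: "integrable (lebesgue_on {a..b}) (bump a b)"
    by (rule continuous_on_integrable_lebesgue_on[OF contb])
  define I where "I = (LINT y|lebesgue_on {a..b}. bump a b y)"
  have "I \<noteq> 0"
  proof
    assume "I = 0"
    then have "integral {a..b} (bump a b) = 0"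
      by (simp add: I_def lebesgue_integral_eq_integral[OF intb])
    then have "\<forall>x\<in>{a..b}. bump a b x = 0"
      using integral_eq_0_iff[OF contb ab(1)] bump_nonneg by blast
    then show False using bump_pos[of a "(a+b)/2" b] ab(1) by (auto dest!: bspec[of _ _ "(a+b)/2"])
  qed
  define \<rho> where "\<rho> y = (1/I) * bump a b y" for y
  have Ck\<rho>: "Ck n \<rho>" for n unfolding \<rho>_def by (intro Ck_cmult Ck_bump)
  have supp\<rho>: "\<rho> y = 0" if "y \<notin> {a<..<b}" for y using bump_eq_0[OF that] by (simp add: \<rho>_def)
  have int\<rho>: "(LINT y|lebesgue_on {a..b}. \<rho> y) = 1"
    using \<open>I \<noteq> 0\<close> by (simp add: \<rho>_def I_def)
  \<comment> \<open>The mean of \<open>G\<close> against \<open>\<rho>\<close> is the only constant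
    for which testing with \<open>\<rho>\<close> itself gives 0.\<close>
  define c where "c = (LINT y|lebesgue_on \<Omega>. G y * of_real (\<rho> y))"
  have "AE y in lebesgue_on \<Omega>. G y - c = 0"
  proof (rule fundamental_lemma_calculus_variations[OF \<Omega>(1,2)])
    show "locally_integrable \<Omega> (\<lambda>y. G y - c)"
      by (intro locally_integrable_diff G locally_integrable_const)
    fix \<psi> assume \<psi>: "test_function \<Omega> \<psi>"
    obtain A' B' where AB': "A' \<in> \<Omega>" "B' \<in> \<Omega>" "\<And>y. y \<notin> {A'<..<B'} \<Longrightarrow> \<psi> y = 0" and Ck\<psi>: "\<And>n. Ck n \<psi>"
      using test_functionD[OF \<psi> \<Omega>] by metis
    \<comment> \<open>The interval has to contain the supports of both \<open>\<psi>\<close> and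
      \<open>\<rho>\<close>.\<close>
    define A B where "A = min A' a" and "B = max B' b"
    have "A \<in> \<Omega>" "B \<in> \<Omega>" using AB'(1,2) ab by (auto simp: A_def B_def min_def max_def)
    then have sub: "{A..B} \<subseteq> \<Omega>" by (rule is_interval_Icc_subset[OF \<Omega>(2)])
    have AB: "A < B" using ab(1) by (auto simp: A_def B_def)
    have s\<psi>: "\<psi> y = 0" if "y \<notin> {A<..<B}" for y
      by (rule AB'(3)) (use that in \<open>auto simp: A_def B_def\<close>)
    have s\<rho>: "\<rho> y = 0" if "y \<notin> {A<..<B}" for y
      by (rule supp\<rho>) (use that in \<open>auto simp: A_def B_def\<close>)
    have cont: "continuous_on S \<psi>" "continuous_on S \<rho>" for S
      using Ck_differentiable[OF Ck\<psi>] Ck_differentiable[OF Ck\<rho>]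
        differentiable_imp_continuous_on continuous_on_subset by blast+
    define J where "J = (LINT y|lebesgue_on {A..B}. \<psi> y)"
    define \<eta> where "\<eta> y = \<psi> y + (- J) * \<rho> y" for y
    have i\<psi>: "integrable (lebesgue_on {A..B}) \<psi>" and i\<rho>: "integrable (lebesgue_on {A..B}) \<rho>"
      by (intro continuous_on_integrable_lebesgue_on cont)+
    have "(LINT y|lebesgue_on {A..B}. \<rho> y) = (LINT y|lebesgue_on {A..B}. (if y \<in> {a..b} then \<rho> y else 0))"
      by (rule Bochner_Integration.integral_cong) (auto intro: supp\<rho>)
    also have "\<dots> = 1"
      by (subst integral_restrict) (auto simp: A_def B_def int\<rho>)
    finally have \<rho>1: "(LINT y|lebesgue_on {A..B}. \<rho> y) = 1" .
    have "(LINT y|lebesgue_on {A..B}. \<eta> y) = 0"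
      unfolding \<eta>_def using i\<psi> i\<rho> by (simp add: \<rho>1 J_def)
    moreover have "Ck n \<eta>" for n unfolding \<eta>_def by (intro Ck_add Ck_cmult Ck\<psi> Ck\<rho>)
    moreover have "\<eta> y = 0" if "y \<notin> {A<..<B}" for y using s\<psi>[OF that] s\<rho>[OF that] by (simp add: \<eta>_def)
    ultimately obtain \<phi> where \<phi>: "\<And>n. Ck n \<phi>" "\<And>y. y \<notin> {A..B} \<Longrightarrow> \<phi> y = 0" "deriv \<phi> = \<eta>"
      using Ck_antiderivative[OF _ _ _ AB] by metis
    have "test_function \<Omega> \<phi>" by (rule test_functionI[OF \<phi>(1,2) sub])
    from zero[OF this] have "(LINT y|lebesgue_on \<Omega>. G y * of_real (\<eta> y)) = 0" by (simp add: \<phi>(3))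
    moreover have iG\<psi>: "integrable (lebesgue_on \<Omega>) (\<lambda>y. G y * of_real (\<psi> y))"
      by (rule integrable_mult_test[OF G sub \<Omega>(1) cont(1) s\<psi>])
    have iG\<rho>: "integrable (lebesgue_on \<Omega>) (\<lambda>y. G y * of_real (\<rho> y))"
      by (rule integrable_mult_test[OF G sub \<Omega>(1) cont(2) s\<rho>])
    have ic\<psi>: "integrable (lebesgue_on \<Omega>) (\<lambda>y. c * of_real (\<psi> y))"
      by (rule integrable_mult_test[OF locally_integrable_const sub \<Omega>(1) cont(1) s\<psi>])
    have "(LINT y|lebesgue_on \<Omega>. G y * of_real (\<eta> y)) = (LINT y|lebesgue_on \<Omega>. G y * of_real (\<psi> y)) - of_real J * c"
    proof -
      have "(LINT y|lebesgue_on \<Omega>. G y * of_real (\<eta> y))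
        = (LINT y|lebesgue_on \<Omega>. G y * of_real (\<psi> y) - of_real J * (G y * of_real (\<rho> y)))"
        by (rule Bochner_Integration.integral_cong) (auto simp: \<eta>_def algebra_simps)
      also have "\<dots> = (LINT y|lebesgue_on \<Omega>. G y * of_real (\<psi> y)) - of_real J * c"
        unfolding c_def
        by (simp only: Bochner_Integration.integral_diff[OF iG\<psi> integrable_mult_right[OF iG\<rho>]]
            integral_mult_right_zero)
      finally show ?thesis .
    qed
    moreover have "(LINT y|lebesgue_on \<Omega>. c * of_real (\<psi> y)) = c * of_real J"
    proof -
      have "(LINT y|lebesgue_on \<Omega>. c * of_real (\<psi> y)) = (LINT y|lebesgue_on {A..B}. c * of_real (\<psi> y))"
        by (rule integral_of_real_mult_supported[OF s\<psi> sub \<Omega>(1)])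
      also have "\<dots> = c * of_real J" by (simp add: J_def)
      finally show ?thesis .
    qed
    ultimately show "(LINT y|lebesgue_on \<Omega>. (G y - c) * of_real (\<psi> y)) = 0"
      using iG\<psi> ic\<psi> by (auto simp: left_diff_distrib)
  qed
  then have "AE y in lebesgue_on \<Omega>. G y = c" by eventually_elim simp
  then show thesis by (rule that)
qed

lemma AD_imp_locally_integrable:
  assumes "AD \<Omega> h G" "open \<Omega>" "is_interval \<Omega>" "\<Omega> \<noteq> {}"
  shows "locally_integrable \<Omega> h" "locally_integrable \<Omega> G"
proof -
  have "integrable (lebesgue_on K) h \<and> integrable (lebesgue_on K) G" if K: "compact K" "K \<subseteq> \<Omega>" for K
  proof -
    obtain A B where AB: "A \<in> \<Omega>" "B \<in> \<Omega>" "A < B" "K \<subseteq> {A<..<B}" "{A..B} \<subseteq> \<Omega>"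
      using open_interval_compact_subset[OF assms(2-4) K] .
    have sub: "K \<subseteq> {A..B}" using AB(4) by force
    have Ks: "K \<in> sets lebesgue" using K(1) by (simp add: lmeasurable_compact fmeasurableD)
    have "integrable (lebesgue_on {A..B}) h" using AD_D(1)[OF assms(1) AB(1,2)] AB(3) by simp
    moreover have "integrable (lebesgue_on {A..B}) G"
      by (rule continuous_on_integrable_lebesgue_on)
         (rule continuous_on_subset[OF AD_continuous[OF assms(1,3)] AB(5)])
    ultimately show ?thesis using sub Ks by (auto intro: integrable_lebesgue_on_mono)
  qed
  then show "locally_integrable \<Omega> h" "locally_integrable \<Omega> G" by (auto simp: locally_integrable_def)
qed

lemma DERIV_imp_continuous_on:
  assumes "\<And>y. (\<phi> has_real_derivative \<phi>' y) (at y)"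
  shows "continuous_on S \<phi>"
  by (intro continuous_at_imp_continuous_on ballI DERIV_isCont[OF assms])

lemma AD_of_real_DERIV:
  assumes "\<And>y. (\<phi> has_real_derivative \<phi>' y) (at y)" "continuous_on UNIV \<phi>'" "is_interval S"
  shows "AD S (\<lambda>y. of_real (\<phi>' y)) (\<lambda>y. of_real (\<phi> y))"
proof (rule AD_C1[OF assms(3)])
  fix y
  have "(\<phi> has_vector_derivative \<phi>' y) (at y within S)"
    using assms(1) has_field_derivative_at_within has_real_derivative_iff_has_vector_derivative by blast
  then show "((\<lambda>y. complex_of_real (\<phi> y)) has_vector_derivative of_real (\<phi>' y)) (at y within S)"
    by (rule bounded_linear.has_vector_derivative[OF bounded_linear_of_real])
  show "continuous_on S (\<lambda>y. complex_of_real (\<phi>' y))"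
    by (intro continuous_intros) (rule continuous_on_subset[OF assms(2)], simp)
qed

text \<open>The product of \<open>G\<close> with a test function vanishes at both ends of an
  interval containing the support, so the product rule \<open>AD_mult\<close> leaves no boundary
  terms.\<close>

lemma AD_imp_is_weak_deriv:
  assumes AD: "AD \<Omega> h G" and \<Omega>: "open \<Omega>" "is_interval \<Omega>" "\<Omega> \<noteq> {}"
  shows "is_weak_deriv \<Omega> G h"
  unfolding is_weak_deriv_def
proof (intro conjI allI impI)
  note li = AD_imp_locally_integrable[OF assms]
  show "locally_integrable \<Omega> G" "locally_integrable \<Omega> h" using li by auto
  fix \<phi> assume "test_function \<Omega> \<phi>"
  then obtain A B where AB: "A \<in> \<Omega>" "B \<in> \<Omega>" "A < B" "{A..B} \<subseteq> \<Omega>"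
    and z: "\<And>y. y \<notin> {A<..<B} \<Longrightarrow> \<phi> y = 0" "\<And>y. y \<notin> {A<..<B} \<Longrightarrow> deriv \<phi> y = 0"
    and D: "\<And>y. (\<phi> has_real_derivative deriv \<phi> y) (at y)" "continuous_on UNIV (deriv \<phi>)"
    using test_functionD[OF _ \<Omega>] by metis
  have c: "continuous_on {A..B} (deriv \<phi>)" "continuous_on {A..B} \<phi>"
    by (rule continuous_on_subset[OF D(2)], simp) (rule DERIV_imp_continuous_on[OF D(1)])
  have "AD \<Omega> (\<lambda>y. h y * of_real (\<phi> y) + G y * of_real (deriv \<phi> y)) (\<lambda>y. G y * of_real (\<phi> y))"
    by (rule AD_mult[OF AD AD_of_real_DERIV[OF D \<Omega>(2)] \<Omega>(2)])
  from AD_D[OF this AB(1,2)] AB(3)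
  have "(LINT y|lebesgue_on {A..B}. h y * of_real (\<phi> y) + G y * of_real (deriv \<phi> y)) = 0"
    using z(1)[of A] z(1)[of B] by simp
  moreover have "integrable (lebesgue_on {A..B}) (\<lambda>y. h y * of_real (\<phi> y))"
    "integrable (lebesgue_on {A..B}) (\<lambda>y. G y * of_real (deriv \<phi> y))"
    by (intro integrable_mult_continuous locally_integrable_Icc[OF li(1) AB(4)]
        locally_integrable_Icc[OF li(2) AB(4)] continuous_intros c)+
  ultimately have "(LINT y|lebesgue_on {A..B}. G y * of_real (deriv \<phi> y))
      = - (LINT y|lebesgue_on {A..B}. h y * of_real (\<phi> y))"
    by (simp add: add_eq_0_iff)
  then show "(LINT y|lebesgue_on \<Omega>. G y * of_real (deriv \<phi> y)) = - (LINT y|lebesgue_on \<Omega>. h y * of_real (\<phi> y))"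
    using integral_of_real_mult_supported[OF z(1) AB(4) \<Omega>(1)] integral_of_real_mult_supported[OF z(2) AB(4) \<Omega>(1)]
    by simp
qed

lemma is_weak_deriv_unique:
  assumes "is_weak_deriv \<Omega> g h" "is_weak_deriv \<Omega> g h'" and \<Omega>: "open \<Omega>" "is_interval \<Omega>" "\<Omega> \<noteq> {}"
  shows "AE y in lebesgue_on \<Omega>. h y = h' y"
proof -
  have li: "locally_integrable \<Omega> h" "locally_integrable \<Omega> h'"
    using assms by (auto simp: is_weak_deriv_def)
  have "AE y in lebesgue_on \<Omega>. h y - h' y = 0"
  proof (rule fundamental_lemma_calculus_variations[OF \<Omega>(1,2)])
    show "locally_integrable \<Omega> (\<lambda>y. h y - h' y)" by (intro locally_integrable_diff li)
    fix \<phi> assume \<phi>: "test_function \<Omega> \<phi>"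
    then obtain A B where AB: "A \<in> \<Omega>" "B \<in> \<Omega>" "A < B" "{A..B} \<subseteq> \<Omega>"
      and z: "\<And>y. y \<notin> {A<..<B} \<Longrightarrow> \<phi> y = 0"
      and D: "\<And>y. (\<phi> has_real_derivative deriv \<phi> y) (at y)"
      using test_functionD[OF _ \<Omega>] by metis
    have c: "continuous_on {A..B} \<phi>"
      by (rule DERIV_imp_continuous_on[OF D])
    have "(LINT y|lebesgue_on \<Omega>. h y * of_real (\<phi> y)) = (LINT y|lebesgue_on \<Omega>. h' y * of_real (\<phi> y))"
      using assms(1,2) \<phi> by (auto simp: is_weak_deriv_def)
    then show "(LINT y|lebesgue_on \<Omega>. (h y - h' y) * of_real (\<phi> y)) = 0"
      using integrable_mult_test[OF li(1) AB(4) \<Omega>(1) c z] integrable_mult_test[OF li(2) AB(4) \<Omega>(1) c z]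
      by (simp add: left_diff_distrib)
  qed
  then show ?thesis by eventually_elim simp
qed

lemma locally_integrable_cong_AE:
  assumes "locally_integrable \<Omega> g" "AE y in lebesgue_on \<Omega>. g y = g' y" "open \<Omega>"
  shows "locally_integrable \<Omega> g'"
  unfolding locally_integrable_def
proof (intro allI impI)
  fix K assume K: "compact K \<and> K \<subseteq> \<Omega>"
  then have Ks: "K \<in> sets lebesgue" by (simp add: lmeasurable_compact fmeasurableD)
  have ae: "AE y in lebesgue_on K. g y = g' y"
    by (rule AE_lebesgue_on_mono[OF assms(2)]) (use K Ks open_sets_lebesgue[OF assms(3)] in auto)
  have g: "integrable (lebesgue_on K) g" using assms(1) K by (simp add: locally_integrable_def)
  show "integrable (lebesgue_on K) g'"
    by (rule integrable_cong_AE_imp[OF g borel_measurable_lebesgue_on_AE[OF _ ae Ks] ae]) (use g in auto)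
qed

lemma integral_cong_AE_lebesgue_on:
  fixes f g :: "real \<Rightarrow> complex"
  assumes "AE y in lebesgue_on S. f y = g y" "integrable (lebesgue_on S) f" "S \<in> sets lebesgue"
  shows "(LINT y|lebesgue_on S. f y) = (LINT y|lebesgue_on S. g y)"
proof (rule integral_cong_AE[OF _ _ assms(1)])
  show "f \<in> borel_measurable (lebesgue_on S)" using assms(2) by auto
  then show "g \<in> borel_measurable (lebesgue_on S)"
    by (rule borel_measurable_lebesgue_on_AE[OF _ assms(1,3)])
qed

lemma is_weak_deriv_cong_AE:
  assumes w: "is_weak_deriv \<Omega> g h" and g: "AE y in lebesgue_on \<Omega>. g y = g' y"
    and h: "AE y in lebesgue_on \<Omega>. h y = h' y" and \<Omega>: "open \<Omega>" "is_interval \<Omega>" "\<Omega> \<noteq> {}"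
  shows "is_weak_deriv \<Omega> g' h'"
  unfolding is_weak_deriv_def
proof (intro conjI allI impI)
  have li: "locally_integrable \<Omega> g" "locally_integrable \<Omega> h" using w by (auto simp: is_weak_deriv_def)
  show "locally_integrable \<Omega> g'" "locally_integrable \<Omega> h'"
    using locally_integrable_cong_AE[OF li(1) g \<Omega>(1)] locally_integrable_cong_AE[OF li(2) h \<Omega>(1)] .
  fix \<phi> assume \<phi>: "test_function \<Omega> \<phi>"
  then obtain A B where AB: "A \<in> \<Omega>" "B \<in> \<Omega>" "A < B" "{A..B} \<subseteq> \<Omega>"
    and z: "\<And>y. y \<notin> {A<..<B} \<Longrightarrow> \<phi> y = 0" "\<And>y. y \<notin> {A<..<B} \<Longrightarrow> deriv \<phi> y = 0"
    and D: "\<And>y. (\<phi> has_real_derivative deriv \<phi> y) (at y)" "continuous_on UNIV (deriv \<phi>)"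
    using test_functionD[OF _ \<Omega>] by metis
  have c: "continuous_on {A..B} (deriv \<phi>)" "continuous_on {A..B} \<phi>"
    by (rule continuous_on_subset[OF D(2)], simp) (rule DERIV_imp_continuous_on[OF D(1)])
  have "(LINT y|lebesgue_on \<Omega>. g y * of_real (deriv \<phi> y)) = (LINT y|lebesgue_on \<Omega>. g' y * of_real (deriv \<phi> y))"
    using g integrable_mult_test[OF li(1) AB(4) \<Omega>(1) c(1) z(2)] open_sets_lebesgue[OF \<Omega>(1)]
    by (intro integral_cong_AE_lebesgue_on) auto
  moreover have "(LINT y|lebesgue_on \<Omega>. h y * of_real (\<phi> y)) = (LINT y|lebesgue_on \<Omega>. h' y * of_real (\<phi> y))"
    using h integrable_mult_test[OF li(2) AB(4) \<Omega>(1) c(2) z(1)] open_sets_lebesgue[OF \<Omega>(1)]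
    by (intro integral_cong_AE_lebesgue_on) auto
  ultimately show "(LINT y|lebesgue_on \<Omega>. g' y * of_real (deriv \<phi> y)) = - (LINT y|lebesgue_on \<Omega>. h' y * of_real (\<phi> y))"
    using w \<phi> by (simp add: is_weak_deriv_def)
qed

lemma AD_exists:
  assumes S: "is_interval S" "S \<noteq> {}"
    and int: "\<And>a b. a \<in> S \<Longrightarrow> b \<in> S \<Longrightarrow> integrable (lebesgue_on {a..b}) h"
  obtains K where "AD S h K"
proof -
  obtain p where p: "p \<in> S" using S(2) by blast
  define K where "K y = (if p \<le> y then (LINT t|lebesgue_on {p..y}. h t) else - (LINT t|lebesgue_on {y..p}. h t))" for y
  have "AD S h K"
    unfolding AD_def
  proof (intro ballI impI)
    fix a b assume ab: "a \<in> S" "b \<in> S" "a \<le> b"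
    consider "p \<le> a" | "a < p" "p \<le> b" | "b < p" by linarith
    then have "K b - K a = (LINT y|lebesgue_on {a..b}. h y)"
    proof cases
      case 1
      then show ?thesis using integral_lebesgue_on_combine[OF int[OF p ab(2)] 1 ab(3)] ab by (simp add: K_def)
    next
      case 2
      then show ?thesis using integral_lebesgue_on_combine[OF int[OF ab(1,2)], of p] by (simp add: K_def)
    next
      case 3
      then show ?thesis using integral_lebesgue_on_combine[OF int[OF ab(1) p], of b] ab by (simp add: K_def)
    qed
    then show "integrable (lebesgue_on {a..b}) h \<and> K b - K a = (LINT y|lebesgue_on {a..b}. h y)"
      using int[OF ab(1,2)] by simp
  qed
  then show thesis by (rule that)
qed

text \<open>\<open>g\<close> and an antiderivative \<open>K\<close> of \<open>h\<close> have the
  same weak derivative, so by \<open>du_Bois_Reymond\<close> they differ by a constant almost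
  everywhere; adding it to \<open>K\<close> gives the absolutely continuous representative of
  \<open>g\<close>.\<close>

lemma is_weak_deriv_imp_AD:
  assumes w: "is_weak_deriv \<Omega> g h" and \<Omega>: "open \<Omega>" "is_interval \<Omega>" "\<Omega> \<noteq> {}"
  obtains G where "AD \<Omega> h G" "AE y in lebesgue_on \<Omega>. g y = G y"
proof -
  have li: "locally_integrable \<Omega> g" "locally_integrable \<Omega> h" using w by (auto simp: is_weak_deriv_def)
  obtain K where K: "AD \<Omega> h K"
    using AD_exists[OF \<Omega>(2,3) locally_integrable_Icc[OF li(2) is_interval_Icc_subset[OF \<Omega>(2)]]] .
  have wK: "is_weak_deriv \<Omega> K h" by (rule AD_imp_is_weak_deriv[OF K \<Omega>])
  have liK: "locally_integrable \<Omega> K" using wK by (simp add: is_weak_deriv_def)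
  obtain c where c: "AE y in lebesgue_on \<Omega>. g y - K y = c"
  proof (rule du_Bois_Reymond[OF \<Omega>])
    show "locally_integrable \<Omega> (\<lambda>y. g y - K y)" by (intro locally_integrable_diff li liK)
    fix \<phi> assume \<phi>: "test_function \<Omega> \<phi>"
    then obtain A B where AB: "A \<in> \<Omega>" "B \<in> \<Omega>" "A < B" "{A..B} \<subseteq> \<Omega>"
      and z: "\<And>y. y \<notin> {A<..<B} \<Longrightarrow> deriv \<phi> y = 0" and D: "continuous_on UNIV (deriv \<phi>)"
      using test_functionD[OF _ \<Omega>] by metis
    have c: "continuous_on {A..B} (deriv \<phi>)" using D by (rule continuous_on_subset) simp
    have "(LINT y|lebesgue_on \<Omega>. g y * of_real (deriv \<phi> y)) = (LINT y|lebesgue_on \<Omega>. K y * of_real (deriv \<phi> y))"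
      using w wK \<phi> by (simp add: is_weak_deriv_def)
    then show "(LINT y|lebesgue_on \<Omega>. (g y - K y) * of_real (deriv \<phi> y)) = 0"
      using integrable_mult_test[OF li(1) AB(4) \<Omega>(1) c z] integrable_mult_test[OF liK AB(4) \<Omega>(1) c z]
      by (simp add: left_diff_distrib)
  qed
  have "AD \<Omega> (\<lambda>y. h y + 0) (\<lambda>y. K y + c)" by (intro AD_add K AD_const)
  moreover have "AE y in lebesgue_on \<Omega>. g y = K y + c" using c by eventually_elim (simp add: algebra_simps)
  ultimately show thesis by (intro that[of "\<lambda>y. K y + c"]) simp_all
qed

section \<open>The domain of the operator\<close>

lemma L2_subset:
  assumes "f \<in> L2 S" "T \<subseteq> S" "S \<in> sets lebesgue" "T \<in> sets lebesgue"
  shows "f \<in> L2 T" "L2norm T f \<le> L2norm S f"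
proof -
  have "f \<in> borel_measurable (lebesgue_on T)"
    by (rule measurable_restrict_mono[OF L2_measurable[OF assms(1)] assms(2)])
  then show "f \<in> L2 T"
    using integrable_lebesgue_on_mono[OF L2_integrable[OF assms(1)] assms(2-4)] by (simp add: L2_def)
  have "(LINT y|lebesgue_on T. (cmod (f y))\<^sup>2) \<le> (LINT y|lebesgue_on S. (cmod (f y))\<^sup>2)"
    by (rule integral_mono_lebesgue_on_AE[OF L2_integrable[OF assms(1)]]) (use assms in auto)
  then show "L2norm T f \<le> L2norm S f" by (simp add: L2norm_def)
qed

lemma L2_extend_zero:
  assumes "f \<in> L2 T" "T \<subseteq> S" "T \<in> sets lebesgue" "S \<in> sets lebesgue"
  shows "(\<lambda>y. if y \<in> T then f y else 0) \<in> L2 S" "L2norm S (\<lambda>y. if y \<in> T then f y else 0) = L2norm T f"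
proof -
  have sq: "(cmod (if y \<in> T then f y else 0))\<^sup>2 = (if y \<in> T then (cmod (f y))\<^sup>2 else 0)" for y by simp
  have "(\<lambda>y. if y \<in> T then f y else 0) \<in> borel_measurable (lebesgue_on S)"
    using borel_measurable_if_I[OF L2_measurable[OF assms(1)] assms(3)] measurable_restrict_space1 by blast
  moreover have "integrable (lebesgue_on S) (\<lambda>y. if y \<in> T then (cmod (f y))\<^sup>2 else 0)"
    by (rule integrable_lebesgue_on_mono[of UNIV])
       (use assms L2_integrable[OF assms(1)]
        in \<open>auto simp: lebesgue_on_UNIV_eq Lebesgue_Measure.integrable_restrict_UNIV\<close>)
  ultimately show "(\<lambda>y. if y \<in> T then f y else 0) \<in> L2 S" by (simp add: L2_def sq)
  show "L2norm S (\<lambda>y. if y \<in> T then f y else 0) = L2norm T f"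
    unfolding L2norm_def sq using assms by (subst Lebesgue_Measure.integral_restrict) auto
qed

lemma L2_Icc_integrable:
  assumes "f \<in> L2 {a..b}"
  shows "integrable (lebesgue_on {a..b}) f"
proof -
  interpret finite_measure "lebesgue_on {a..b}"
    by (rule finite_measure_lebesgue_on) simp
  have m: "f \<in> borel_measurable (lebesgue_on {a..b})" by (rule L2_measurable[OF assms])
  have "integrable (lebesgue_on {a..b}) (\<lambda>y. cmod (f y))"
    by (rule square_integrable_imp_integrable) (use m L2_integrable[OF assms] in auto)
  then show ?thesis using m by (rule integrable_norm_cancel)
qed

lemma continuous_L2_Icc:
  assumes "continuous_on {a..b} f"
  shows "f \<in> L2 {a..b}"
proof -
  have "f \<in> borel_measurable (lebesgue_on {a..b})"
    by (rule continuous_imp_measurable_on_sets_lebesgue[OF assms]) simp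
  moreover have "integrable (lebesgue_on {a..b}) (\<lambda>y. (cmod (f y))\<^sup>2)"
    by (intro continuous_on_integrable_lebesgue_on continuous_intros assms)
  ultimately show ?thesis by (simp add: L2_def)
qed

lemma L2_bounded_mult:
  assumes f: "f \<in> L2 S" and m: "h \<in> borel_measurable (lebesgue_on S)"
    and b: "\<And>y. y \<in> S \<Longrightarrow> cmod (h y) \<le> B"
  shows "(\<lambda>y. h y * f y) \<in> L2 S" "L2norm S (\<lambda>y. h y * f y) \<le> \<bar>B\<bar> * L2norm S f"
proof -
  have le: "(cmod (h y * f y))\<^sup>2 \<le> (cmod (of_real B * f y))\<^sup>2" if "y \<in> S" for y
  proof -
    have "cmod (h y) \<le> \<bar>B\<bar>" using b[OF that] by simp
    then show ?thesis by (intro power_mono) (auto simp: norm_mult intro: mult_right_mono)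
  qed
  have Bf: "(\<lambda>y. of_real B * f y) \<in> L2 S" by (rule L2_cmult[OF f])
  show L2: "(\<lambda>y. h y * f y) \<in> L2 S"
  proof -
    have "integrable (lebesgue_on S) (\<lambda>y. (cmod (h y * f y))\<^sup>2)"
      by (rule Bochner_Integration.integrable_bound[OF L2_integrable[OF Bf]])
         (use L2_measurable[OF f] m le in auto)
    then show ?thesis using L2_measurable[OF f] m by (simp add: L2_def)
  qed
  have "(L2norm S (\<lambda>y. h y * f y)) \<le> L2norm S (\<lambda>y. of_real B * f y)"
    unfolding L2norm_def
    by (intro real_sqrt_le_mono integral_mono L2_integrable[OF L2] L2_integrable[OF Bf]) (use le in auto)
  then show "L2norm S (\<lambda>y. h y * f y) \<le> \<bar>B\<bar> * L2norm S f" by (simp add: L2norm_cmult)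
qed

lemma continuous_AE_zero_imp_zero:
  fixes f :: "real \<Rightarrow> complex"
  assumes "open \<Omega>" "continuous_on \<Omega> f" "AE y in lebesgue_on \<Omega>. f y = 0" "y \<in> \<Omega>"
  shows "f y = 0"
proof (rule ccontr)
  assume "f y \<noteq> 0"
  let ?U = "\<Omega> \<inter> f -` (- {0})"
  have "open ?U"
    by (rule continuous_open_preimage[OF assms(2,1)]) auto
  moreover have "?U \<noteq> {}" using \<open>f y \<noteq> 0\<close> assms(4) by auto
  ultimately have "\<not> negligible ?U" by (rule open_not_negligible)
  moreover have "AE y in lebesgue. y \<notin> ?U"
    using assms(3) by (simp add: AE_restrict_space_iff open_sets_lebesgue[OF assms(1)])
  then have "negligible ?U"
    using \<open>open ?U\<close> by (simp add: negligible_iff_null_sets AE_iff_null_sets open_sets_lebesgue)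
  ultimately show False by blast
qed

section \<open>Representatives that are regular up to the boundary\<close>

locale unbounded_interval =
  fixes \<Omega> :: "real set"
  assumes shape: "\<Omega> = UNIV \<or> (\<exists>L. \<Omega> = {..<L}) \<or> (\<exists>L. \<Omega> = {L<..})"
begin

lemma open_dom: "open \<Omega>" and interval_dom: "is_interval \<Omega>"
  using shape by (auto simp: is_interval_1)

lemma nonempty_dom: "\<Omega> \<noteq> {}"
  using shape lt_ex gt_ex by fastforce

lemmas dom = open_dom interval_dom nonempty_dom

lemma sets_dom [simp]: "\<Omega> \<in> sets lebesgue"
  by (rule open_sets_lebesgue[OF open_dom])

lemma interval_closure: "is_interval (closure \<Omega>)"
  using shape by (auto simp: is_interval_1)

lemma sets_closure [simp]: "closure \<Omega> \<in> sets lebesgue"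
  by (simp add: borel_closed sets_completionI_sets)

lemma nonempty_closure: "closure \<Omega> \<noteq> {}"
  using nonempty_dom by simp

lemma finite_frontier: "finite (frontier \<Omega>)"
proof -
  have "frontier {..<L} = {L}" "frontier {L<..} = {L}" for L :: real
    by (auto simp: frontier_def interior_open)
  then show ?thesis using shape by auto
qed

lemma AE_closure: "AE y in lebesgue. y \<in> closure \<Omega> \<longrightarrow> y \<in> \<Omega>"
proof -
  have "negligible (frontier \<Omega>)" using finite_frontier by (rule negligible_finite)
  then have "AE y in lebesgue. y \<notin> frontier \<Omega>"
    by (simp add: AE_not_in negligible_iff_null_sets)
  then show ?thesis
    by eventually_elim (use open_dom in \<open>simp add: frontier_def interior_open\<close>)
qed

lemma AE_lebesgue_on_closure:
  assumes "AE y in lebesgue_on \<Omega>. P y"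
  shows "AE y in lebesgue_on (closure \<Omega>). P y"
proof -
  have "AE y in lebesgue. y \<in> \<Omega> \<longrightarrow> P y" using assms by (simp add: AE_restrict_space_iff)
  with AE_closure have "AE y in lebesgue. y \<in> closure \<Omega> \<longrightarrow> P y"
    by eventually_elim simp
  then show ?thesis by (simp add: AE_restrict_space_iff)
qed

lemma L2_closure:
  assumes "f \<in> L2 \<Omega>"
  shows "f \<in> L2 (closure \<Omega>)"
proof (rule L2_cong_AE[OF L2_extend_zero(1)[OF assms closure_subset]])
  show "AE y in lebesgue_on (closure \<Omega>). (if y \<in> \<Omega> then f y else 0) = f y"
    by (rule AE_lebesgue_on_closure) (auto intro!: AE_I2)
qed auto

lemma L2_Icc:
  assumes "f \<in> L2 \<Omega>" "{a..b} \<subseteq> closure \<Omega>"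
  shows "f \<in> L2 {a..b}"
  by (rule L2_subset(1)[OF L2_closure[OF assms(1)] assms(2)]) auto

lemma L2norm_closure: "f \<in> L2 \<Omega> \<Longrightarrow> L2norm (closure \<Omega>) f = L2norm \<Omega> f"
proof -
  assume f: "f \<in> L2 \<Omega>"
  have "L2norm (closure \<Omega>) f = L2norm (closure \<Omega>) (\<lambda>y. if y \<in> \<Omega> then f y else 0)"
    by (rule L2norm_cong_AE[OF AE_lebesgue_on_closure L2_closure[OF f]]) (auto intro!: AE_I2)
  also have "\<dots> = L2norm \<Omega> f"
    by (rule L2_extend_zero(2)[OF f closure_subset]) auto
  finally show ?thesis .
qed

lemma L2norm_Icc_le:
  assumes "f \<in> L2 \<Omega>" "{a..b} \<subseteq> closure \<Omega>"
  shows "L2norm {a..b} f \<le> L2norm \<Omega> f"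
  using L2_subset(2)[OF L2_closure[OF assms(1)] assms(2)] L2norm_closure[OF assms(1)] by simp

text \<open>The boundary condition lives on the closure, while weak derivatives see only the open
  set. A square integrable derivative is integrable up to a finite end point, so the antiderivative
  extends continuously to it.\<close>

lemma AD_extend_closure:
  assumes F: "AD \<Omega> f F" and f: "f \<in> L2 \<Omega>"
  obtains F' where "AD (closure \<Omega>) f F'" "\<And>y. y \<in> \<Omega> \<Longrightarrow> F' y = F y"
proof -
  have "integrable (lebesgue_on {a..b}) f" if "a \<in> closure \<Omega>" "b \<in> closure \<Omega>" for a b
    by (rule L2_Icc_integrable[OF L2_Icc[OF f is_interval_Icc_subset[OF interval_closure that]]])
  then obtain K where K: "AD (closure \<Omega>) f K"
    using AD_exists[OF interval_closure nonempty_closure] by blast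
  obtain p where p: "p \<in> \<Omega>" using nonempty_dom by blast
  define F' where "F' y = K y + (F p - K p)" for y
  have "AD (closure \<Omega>) (\<lambda>y. f y + 0) F'" unfolding F'_def by (intro AD_add K AD_const)
  moreover have "F' y = F y" if y: "y \<in> \<Omega>" for y
  proof -
    have cl: "y \<in> closure \<Omega>" "p \<in> closure \<Omega>" using y p closure_subset by blast+
    have "F y - F p = K y - K p"
    proof (cases "p \<le> y")
      case True
      show ?thesis using AD_D(2)[OF F p y True] AD_D(2)[OF K cl(2,1) True] by simp
    next
      case False
      then have "y \<le> p" by simp
      from AD_D(2)[OF F y p this] AD_D(2)[OF K cl this] have "F p - F y = K p - K y" by simp
      then show ?thesis by (metis minus_diff_eq)
    qed
    then show ?thesis by (simp add: F'_def algebra_simps)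
  qed
  ultimately show thesis by (intro that[of F']) simp_all
qed

lemma AE_weak_deriv:
  assumes "is_weak_deriv \<Omega> g h"
  shows "AE y in lebesgue_on \<Omega>. weak_deriv \<Omega> g y = h y" "is_weak_deriv \<Omega> g (weak_deriv \<Omega> g)"
proof -
  show w: "is_weak_deriv \<Omega> g (weak_deriv \<Omega> g)"
    unfolding weak_deriv_def using someI[of "is_weak_deriv \<Omega> g" h] assms by simp
  show "AE y in lebesgue_on \<Omega>. weak_deriv \<Omega> g y = h y"
    by (rule is_weak_deriv_unique[OF w assms dom])
qed

text \<open>\<open>weak_deriv\<close> is a choice, so its outer occurrence is applied to a
  representative that agrees with \<open>g1\<close> only almost everywhere; the lemma removes the
  dependence on that choice.\<close>

lemma AE_weak_deriv2:
  assumes "is_weak_deriv \<Omega> g g1" "is_weak_deriv \<Omega> g1 g2"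
  shows "AE y in lebesgue_on \<Omega>. weak_deriv \<Omega> (weak_deriv \<Omega> g) y = g2 y"
proof -
  have "AE y in lebesgue_on \<Omega>. g1 y = weak_deriv \<Omega> g y"
    using AE_weak_deriv(1)[OF assms(1)] by eventually_elim simp
  then have "is_weak_deriv \<Omega> (weak_deriv \<Omega> g) g2"
    by (rule is_weak_deriv_cong_AE[OF assms(2) _ _ dom]) simp
  then show ?thesis by (rule AE_weak_deriv(1))
qed

text \<open>\<open>G\<close> is the continuously differentiable representative of \<open>g\<close>, and \<open>G1\<close>, \<open>G2\<close> are its derivatives.\<close>

definition H_rep where
  "H_rep v \<nu> k g G G1 G2 \<longleftrightarrow> AD (closure \<Omega>) G1 G \<and> AD (closure \<Omega>) G2 G1
    \<and> G \<in> L2 \<Omega> \<and> G1 \<in> L2 \<Omega> \<and> G2 \<in> L2 \<Omega> \<and> (\<forall>y\<in>frontier \<Omega>. G1 y = 0)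
    \<and> (AE y in lebesgue_on \<Omega>. g y = G y)
    \<and> (\<lambda>y. - of_real \<nu> * G2 y + \<i> * of_real k * of_real (v y) * G y) \<in> L2 \<Omega>"

lemma H_op_AE:
  assumes "is_weak_deriv \<Omega> g g1" "is_weak_deriv \<Omega> g1 G2" "AE y in lebesgue_on \<Omega>. g y = G y"
  shows "AE y in lebesgue_on \<Omega>. H_op \<Omega> v \<nu> k g y
    = - of_real \<nu> * G2 y + \<i> * of_real k * of_real (v y) * G y"
  using AE_weak_deriv2[OF assms(1,2)] assms(3)
  by eventually_elim (simp add: H_op_def)

lemma H_rep_imp_H_dom:
  assumes rep: "H_rep v \<nu> k g G G1 G2"
  shows "g \<in> H_dom \<Omega> v \<nu> k"
    "AE y in lebesgue_on \<Omega>. H_op \<Omega> v \<nu> k g y = - of_real \<nu> * G2 y + \<i> * of_real k * of_real (v y) * G y"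
proof -
  have AD: "AD (closure \<Omega>) G1 G" "AD (closure \<Omega>) G2 G1"
    and L2: "G \<in> L2 \<Omega>" "G1 \<in> L2 \<Omega>" "G2 \<in> L2 \<Omega>" and fr: "\<forall>y\<in>frontier \<Omega>. G1 y = 0"
    and ae: "AE y in lebesgue_on \<Omega>. g y = G y"
    and H: "(\<lambda>y. - of_real \<nu> * G2 y + \<i> * of_real k * of_real (v y) * G y) \<in> L2 \<Omega>"
    using rep by (auto simp: H_rep_def)
  have ae': "AE y in lebesgue_on \<Omega>. G y = g y" using ae by eventually_elim simp
  have w0: "is_weak_deriv \<Omega> G G1"
    by (rule AD_imp_is_weak_deriv[OF AD_subset[OF AD(1) closure_subset] dom])
  have w2: "is_weak_deriv \<Omega> G1 G2"
    by (rule AD_imp_is_weak_deriv[OF AD_subset[OF AD(2) closure_subset] dom])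
  have w1: "is_weak_deriv \<Omega> g G1"
    by (rule is_weak_deriv_cong_AE[OF w0 ae' _ dom]) simp
  show op: "AE y in lebesgue_on \<Omega>. H_op \<Omega> v \<nu> k g y = - of_real \<nu> * G2 y + \<i> * of_real k * of_real (v y) * G y"
    by (rule H_op_AE[OF w1 w2 ae])
  have gL2: "g \<in> L2 \<Omega>" by (rule L2_cong_AE[OF L2(1) ae']) simp
  have "g \<in> H2 \<Omega>" unfolding H2_def using gL2 L2 w1 w2 by blast
  moreover have "neumann \<Omega> g"
    unfolding neumann_def using w1 AD_continuous[OF AD(2) interval_closure] fr by blast
  moreover have "H_op \<Omega> v \<nu> k g \<in> L2 \<Omega>"
  proof (rule L2_cong_AE[OF H])
    show "AE y in lebesgue_on \<Omega>. - of_real \<nu> * G2 y + \<i> * of_real k * of_real (v y) * G y = H_op \<Omega> v \<nu> k g y"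
      using op by eventually_elim simp
  qed simp
  ultimately show "g \<in> H_dom \<Omega> v \<nu> k" by (simp add: H_dom_def)
qed

text \<open>Antiderivatives of the weak derivatives, extended to the closure, are the regular
  representatives. The function \<open>h\<close> from \<open>neumann\<close> is another continuous
  representative of the first derivative, so it agrees with \<open>G1\<close> on \<Omega> and, by
  continuity, at the boundary; this is how \<open>G1\<close> inherits the condition there.\<close>

lemma H_dom_imp_H_rep:
  assumes g: "g \<in> H_dom \<Omega> v \<nu> k"
  obtains G G1 G2 where "H_rep v \<nu> k g G G1 G2"
proof -
  have gL2: "g \<in> L2 \<Omega>" and neu: "neumann \<Omega> g" and H: "H_op \<Omega> v \<nu> k g \<in> L2 \<Omega>"
    using g by (auto simp: H_dom_def H2_def)
  obtain g1 g2 where L2: "g1 \<in> L2 \<Omega>" "g2 \<in> L2 \<Omega>" and w: "is_weak_deriv \<Omega> g g1" "is_weak_deriv \<Omega> g1 g2"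
    using g by (auto simp: H_dom_def H2_def)
  obtain h where h: "is_weak_deriv \<Omega> g h" "continuous_on (closure \<Omega>) h" "\<forall>y\<in>frontier \<Omega>. h y = 0"
    using neu by (auto simp: neumann_def)
  obtain G1' where G1': "AD \<Omega> g2 G1'" "AE y in lebesgue_on \<Omega>. g1 y = G1' y"
    using is_weak_deriv_imp_AD[OF w(2) dom] .
  obtain G' where G': "AD \<Omega> g1 G'" "AE y in lebesgue_on \<Omega>. g y = G' y"
    using is_weak_deriv_imp_AD[OF w(1) dom] .
  obtain G1 where G1: "AD (closure \<Omega>) g2 G1" "\<And>y. y \<in> \<Omega> \<Longrightarrow> G1 y = G1' y"
    using AD_extend_closure[OF G1'(1) L2(2)] by blast
  obtain G where G: "AD (closure \<Omega>) g1 G" "\<And>y. y \<in> \<Omega> \<Longrightarrow> G y = G' y"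
    using AD_extend_closure[OF G'(1) L2(1)] by blast
  have ae1: "AE y in lebesgue_on \<Omega>. g1 y = G1 y"
    using G1'(2) AE_space by eventually_elim (simp add: G1(2))
  have ae: "AE y in lebesgue_on \<Omega>. g y = G y"
    using G'(2) AE_space by eventually_elim (simp add: G(2))
  have AD: "AD (closure \<Omega>) G1 G"
    by (rule AD_cong_AE[OF G(1) AE_lebesgue_on_closure[OF ae1] interval_closure]) simp
  have cG1: "continuous_on (closure \<Omega>) G1" by (rule AD_continuous[OF G1(1) interval_closure])
  have "AE y in lebesgue_on \<Omega>. h y - G1 y = 0"
    using is_weak_deriv_unique[OF h(1) w(1) dom] ae1 by eventually_elim simp
  moreover have "continuous_on \<Omega> (\<lambda>y. h y - G1 y)"
    by (intro continuous_intros continuous_on_subset[OF h(2)] continuous_on_subset[OF cG1] closure_subset)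
  ultimately have z: "h y - G1 y = 0" if "y \<in> \<Omega>" for y
    using continuous_AE_zero_imp_zero[OF open_dom] that by blast
  have "continuous_on (closure \<Omega>) (\<lambda>y. h y - G1 y)"
    by (intro continuous_intros h(2) cG1)
  then have "h y - G1 y = 0" if "y \<in> closure \<Omega>" for y
    by (rule continuous_constant_on_closure) (use z that in auto)
  then have fr: "\<forall>y\<in>frontier \<Omega>. G1 y = 0"
    using h(3) by (force simp: frontier_def)
  have "H_rep v \<nu> k g G G1 g2"
    unfolding H_rep_def
  proof (intro conjI AD G1(1) L2(2) fr ae)
    show "G \<in> L2 \<Omega>" by (rule L2_cong_AE[OF gL2 ae]) simp
    show "G1 \<in> L2 \<Omega>" by (rule L2_cong_AE[OF L2(1) ae1]) simp
    show "(\<lambda>y. - of_real \<nu> * g2 y + \<i> * of_real k * of_real (v y) * G y) \<in> L2 \<Omega>"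
      by (rule L2_cong_AE[OF H H_op_AE[OF w ae]]) simp
  qed
  then show thesis by (rule that)
qed

end

section \<open>Uniform nondegeneracy of the profile\<close>

lemma mvt_lower_bound:
  fixes f :: "real \<Rightarrow> real"
  assumes d: "\<And>y. y \<in> I \<Longrightarrow> (f has_real_derivative f' y) (at y within I)"
    and sub: "{a..b} \<subseteq> I" and ab: "a < b" and lb: "\<And>y. y \<in> {a..b} \<Longrightarrow> \<kappa> \<le> \<bar>f' y\<bar>"
  shows "\<kappa> * (b - a) \<le> \<bar>f b - f a\<bar>"
proof -
  have "(f has_derivative (\<lambda>h. f' y * h)) (at y within {a..b})" if "a \<le> y" "y \<le> b" for y
  proof -
    have "y \<in> I" using that sub by auto
    from has_field_derivative_subset[OF d[OF this] sub] show ?thesis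
      by (simp add: has_field_derivative_def)
  qed
  from mvt_simple[OF ab, of f "\<lambda>y h. f' y * h", OF this]
  obtain x where x: "x \<in> {a<..<b}" "f b - f a = f' x * (b - a)" by auto
  have "\<kappa> * (b - a) \<le> \<bar>f' x\<bar> * (b - a)"
    using lb[of x] x(1) ab by (intro mult_right_mono) auto
  then show ?thesis using x(2) ab by (simp add: abs_mult)
qed

text \<open>Gaps between n points are labelled by arbitrary subsets of these points, hence 2^n new
  points instead of n + 1. The crude count suffices, as it depends on the order of differentiation
  alone.\<close>

primrec excluded_points :: "nat \<Rightarrow> nat" where
  "excluded_points 0 = 0"
| "excluded_points (Suc j) = excluded_points j + 2 ^ excluded_points j"

text \<open>On the complement of the \<open>\<delta>\<close>-neighbourhood of the points excluded for \<open>f'\<close>, the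
  function \<open>f\<close> moves with speed bounded below inside each gap between consecutive points, so one
  more point per gap suffices for \<open>f\<close>.  A gap is identified by the set of points to its left.\<close>

lemma finite_exclusion_set:
  fixes f :: "nat \<Rightarrow> real \<Rightarrow> real"
  assumes "\<And>i y. i < j \<Longrightarrow> y \<in> I \<Longrightarrow> (f i has_real_derivative f (Suc i) y) (at y within I)"
    and "\<And>y. y \<in> I \<Longrightarrow> c \<le> \<bar>f j y\<bar>" and "is_interval I" "c > 0" "\<delta> > 0"
  shows "\<exists>P. finite P \<and> card P \<le> excluded_points j
    \<and> (\<forall>y\<in>I. (\<forall>p\<in>P. \<delta> \<le> \<bar>y - p\<bar>) \<longrightarrow> (\<delta> / 2) ^ j * c \<le> \<bar>f 0 y\<bar>)"
  using assms(1,2)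
proof (induction j arbitrary: f)
  case 0
  then show ?case by (intro exI[of _ "{}"]) auto
next
  case (Suc j)
  have "\<exists>P. finite P \<and> card P \<le> excluded_points j
    \<and> (\<forall>y\<in>I. (\<forall>p\<in>P. \<delta> \<le> \<bar>y - p\<bar>) \<longrightarrow> (\<delta> / 2) ^ j * c \<le> \<bar>f (Suc 0) y\<bar>)"
    by (rule Suc.IH[of "\<lambda>i. f (Suc i)"]) (use Suc.prems in auto)
  then obtain P where P: "finite P" "card P \<le> excluded_points j"
    and lb: "\<And>y. y \<in> I \<Longrightarrow> (\<forall>p\<in>P. \<delta> \<le> \<bar>y - p\<bar>) \<Longrightarrow> (\<delta> / 2) ^ j * c \<le> \<bar>f (Suc 0) y\<bar>"
    by blast
  define \<kappa> where "\<kappa> = (\<delta> / 2) ^ j * c"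
  have \<kappa>: "\<kappa> > 0" using assms(4,5) by (simp add: \<kappa>_def)
  \<comment> \<open>\<open>C Q y\<close>: \<open>y\<close> is an admissible point of the gap
    \<open>Q\<close> at which the function is small. One such point per gap is excluded next. For a
    gap without such a point \<open>q Q\<close> is an arbitrary number, and excluding it does no
    harm.\<close>
  define C where "C Q y \<longleftrightarrow> y \<in> I \<and> (\<forall>p\<in>P. \<delta> \<le> \<bar>y - p\<bar>) \<and> {p \<in> P. p < y} = Q \<and> \<bar>f 0 y\<bar> < \<delta> / 2 * \<kappa>" for Q y
  define q where "q Q = (SOME y. C Q y)" for Q
  have sep: "\<kappa> * (z - y) \<le> \<bar>f 0 z - f 0 y\<bar>"
    if y: "y \<in> I" "\<forall>p\<in>P. \<delta> \<le> \<bar>y - p\<bar>" and z: "z \<in> I" "\<forall>p\<in>P. \<delta> \<le> \<bar>z - p\<bar>"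
      and gap: "{p \<in> P. p < y} = {p \<in> P. p < z}" and yz: "y < z" for y z
  proof (rule mvt_lower_bound[of I])
    show "(f 0 has_real_derivative f (Suc 0) x) (at x within I)" if "x \<in> I" for x
      using Suc.prems(1)[of 0] that by simp
    show sub: "{y..z} \<subseteq> I" by (rule is_interval_Icc_subset[OF assms(3) y(1) z(1)])
    show "\<kappa> \<le> \<bar>f (Suc 0) x\<bar>" if x: "x \<in> {y..z}" for x
      unfolding \<kappa>_def
    proof (rule lb)
      show "x \<in> I" using x sub by blast
      show "\<forall>p\<in>P. \<delta> \<le> \<bar>x - p\<bar>"
      proof
        fix p assume p: "p \<in> P"
        have d: "\<delta> \<le> \<bar>y - p\<bar>" "\<delta> \<le> \<bar>z - p\<bar>" using y(2) z(2) p by auto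
        \<comment> \<open>No excluded point lies between \<open>y\<close> and \<open>z\<close>, so
          an intermediate point is at least as far from each \<open>p\<close> as the nearer of the
          two ends.\<close>
        have "p < y \<longleftrightarrow> p < z" using gap p by blast
        then consider "p < y" | "p \<ge> z" by linarith
        then show "\<delta> \<le> \<bar>x - p\<bar>"
          by cases (use d x in \<open>simp_all add: abs_if split: if_splits\<close>)
      qed
    qed
  qed (rule yz)
  show ?case
  proof (intro exI[of _ "P \<union> q ` Pow P"] conjI ballI impI)
    show "finite (P \<union> q ` Pow P)" using P(1) by simp
    have "card (P \<union> q ` Pow P) \<le> card P + card (q ` Pow P)" by (rule card_Un_le)
    also have "card (q ` Pow P) \<le> card (Pow P)" using P(1) by (intro card_image_le) simp
    also have "card (Pow P) = 2 ^ card P" using P(1) by (rule card_Pow)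
    also have "card P + 2 ^ card P \<le> excluded_points (Suc j)"
      using P(2) by (simp add: add_mono power_increasing)
    finally show "card (P \<union> q ` Pow P) \<le> excluded_points (Suc j)" by simp
    fix y assume y: "y \<in> I" and far: "\<forall>p\<in>P \<union> q ` Pow P. \<delta> \<le> \<bar>y - p\<bar>"
    have "\<delta> / 2 * \<kappa> \<le> \<bar>f 0 y\<bar>"
    proof (rule ccontr)
      assume "\<not> \<delta> / 2 * \<kappa> \<le> \<bar>f 0 y\<bar>"
      define Q where "Q = {p \<in> P. p < y}"
      have "C Q y" unfolding C_def Q_def using y far \<open>\<not> \<delta> / 2 * \<kappa> \<le> \<bar>f 0 y\<bar>\<close> by auto
      then have Cq: "C Q (q Q)" unfolding q_def by (rule someI)
      have "Q \<in> Pow P" by (auto simp: Q_def)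
      then have d: "\<delta> \<le> \<bar>y - q Q\<bar>" using far by blast
      \<comment> \<open>Two small values in one gap differ by less than
        \<open>\<delta> * \<kappa>\<close>, whereas speed at least \<open>\<kappa>\<close> over a
        distance at least \<open>\<delta>\<close> forces a difference of at least that much.\<close>
      have "\<kappa> * \<bar>y - q Q\<bar> \<le> \<bar>f 0 y - f 0 (q Q)\<bar>"
      proof (cases "y < q Q")
        case True
        then show ?thesis
          using sep[of y "q Q"] Cq \<open>C Q y\<close> by (simp add: C_def abs_minus_commute)
      next
        case False
        then have "q Q < y" using d assms(5) by (cases "q Q = y") auto
        then show ?thesis
          using sep[of "q Q" y] Cq \<open>C Q y\<close> by (simp add: C_def)
      qed
      moreover have "\<kappa> * \<delta> \<le> \<kappa> * \<bar>y - q Q\<bar>" using d \<kappa> by (intro mult_left_mono) auto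
      moreover have "\<bar>f 0 (q Q)\<bar> < \<delta> / 2 * \<kappa>" "\<bar>f 0 y\<bar> < \<delta> / 2 * \<kappa>"
        using Cq \<open>C Q y\<close> by (auto simp: C_def)
      ultimately show False
        by (simp add: field_simps abs_if split: if_splits)
    qed
    then show "(\<delta> / 2) ^ Suc j * c \<le> \<bar>f 0 y\<bar>" by (simp add: \<kappa>_def)
  qed
qed

text \<open>A sublevel set estimate that is uniform in the level: the centres \<open>P\<close> may
  vary with \<open>l\<close> and \<delta>, but \<open>c\<close> and \<open>N\<close> may not. The
  restriction to \<delta> \<le> 1 lets zeros of lower order be absorbed into the exponent
  \<open>m\<close>.\<close>

definition uniformly_nondegenerate :: "nat \<Rightarrow> (real \<Rightarrow> real) \<Rightarrow> real set \<Rightarrow> bool" where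
  "uniformly_nondegenerate m v S \<longleftrightarrow> (\<exists>c>0. \<exists>N. \<forall>l \<delta>. 0 < \<delta> \<and> \<delta> \<le> 1 \<longrightarrow>
     (\<exists>P. finite P \<and> card P \<le> N \<and> (\<forall>y\<in>S. (\<forall>p\<in>P. \<delta> \<le> \<bar>y - p\<bar>) \<longrightarrow> c * \<delta> ^ m \<le> \<bar>v y - l\<bar>)))"

lemma uniformly_nondegenerate_empty: "uniformly_nondegenerate m v {}"
  unfolding uniformly_nondegenerate_def
  by (intro exI[of _ 1] conjI exI[of _ 0] allI impI exI[of _ "{}"]) auto

lemma uniformly_nondegenerate_Un:
  assumes "uniformly_nondegenerate m v S" "uniformly_nondegenerate m v T"
  shows "uniformly_nondegenerate m v (S \<union> T)"
proof -
  obtain c N where c: "c > 0" and S: "\<And>l \<delta>. 0 < \<delta> \<Longrightarrow> \<delta> \<le> 1 \<Longrightarrow>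
     \<exists>P. finite P \<and> card P \<le> N \<and> (\<forall>y\<in>S. (\<forall>p\<in>P. \<delta> \<le> \<bar>y - p\<bar>) \<longrightarrow> c * \<delta> ^ m \<le> \<bar>v y - l\<bar>)"
    using assms(1) unfolding uniformly_nondegenerate_def by blast
  obtain c' N' where c': "c' > 0" and T: "\<And>l \<delta>. 0 < \<delta> \<Longrightarrow> \<delta> \<le> 1 \<Longrightarrow>
     \<exists>P. finite P \<and> card P \<le> N' \<and> (\<forall>y\<in>T. (\<forall>p\<in>P. \<delta> \<le> \<bar>y - p\<bar>) \<longrightarrow> c' * \<delta> ^ m \<le> \<bar>v y - l\<bar>)"
    using assms(2) unfolding uniformly_nondegenerate_def by blast
  show ?thesis
    unfolding uniformly_nondegenerate_def
  proof (intro exI[of _ "min c c'"] conjI exI[of _ "N + N'"] allI impI)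
    show "min c c' > 0" using c c' by simp
    fix l \<delta> :: real assume \<delta>: "0 < \<delta> \<and> \<delta> \<le> 1"
    obtain P where P: "finite P" "card P \<le> N" "\<And>y. y \<in> S \<Longrightarrow> (\<forall>p\<in>P. \<delta> \<le> \<bar>y - p\<bar>) \<Longrightarrow> c * \<delta> ^ m \<le> \<bar>v y - l\<bar>"
      using S[of \<delta> l] \<delta> by blast
    obtain P' where P': "finite P'" "card P' \<le> N'" "\<And>y. y \<in> T \<Longrightarrow> (\<forall>p\<in>P'. \<delta> \<le> \<bar>y - p\<bar>) \<Longrightarrow> c' * \<delta> ^ m \<le> \<bar>v y - l\<bar>"
      using T[of \<delta> l] \<delta> by blast
    have le: "min c c' * \<delta> ^ m \<le> c * \<delta> ^ m" "min c c' * \<delta> ^ m \<le> c' * \<delta> ^ m"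
      using \<delta> by (auto intro!: mult_right_mono)
    show "\<exists>P. finite P \<and> card P \<le> N + N' \<and>
        (\<forall>y\<in>S \<union> T. (\<forall>p\<in>P. \<delta> \<le> \<bar>y - p\<bar>) \<longrightarrow> min c c' * \<delta> ^ m \<le> \<bar>v y - l\<bar>)"
    proof (intro exI[of _ "P \<union> P'"] conjI ballI impI)
      show "finite (P \<union> P')" using P P' by simp
      show "card (P \<union> P') \<le> N + N'" using card_Un_le[of P P'] P(2) P'(2) by linarith
      fix y assume y: "y \<in> S \<union> T" and far: "\<forall>p\<in>P \<union> P'. \<delta> \<le> \<bar>y - p\<bar>"
      then have "c * \<delta> ^ m \<le> \<bar>v y - l\<bar> \<or> c' * \<delta> ^ m \<le> \<bar>v y - l\<bar>"
        using P(3)[of y] P'(3)[of y] by blast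
      then show "min c c' * \<delta> ^ m \<le> \<bar>v y - l\<bar>" using le by linarith
    qed
  qed
qed

lemma uniformly_nondegenerate_Union:
  assumes "finite F" "\<And>S. S \<in> F \<Longrightarrow> uniformly_nondegenerate m v S"
  shows "uniformly_nondegenerate m v (\<Union>F)"
  using assms
  by (induction F rule: finite_induct)
     (auto intro: uniformly_nondegenerate_empty uniformly_nondegenerate_Un)

lemma uniformly_nondegenerate_subset:
  assumes "uniformly_nondegenerate m v S" "T \<subseteq> S"
  shows "uniformly_nondegenerate m v T"
proof -
  obtain c N where c: "c > 0" and S: "\<And>l \<delta>. 0 < \<delta> \<Longrightarrow> \<delta> \<le> 1 \<Longrightarrow>
     \<exists>P. finite P \<and> card P \<le> N \<and> (\<forall>y\<in>S. (\<forall>p\<in>P. \<delta> \<le> \<bar>y - p\<bar>) \<longrightarrow> c * \<delta> ^ m \<le> \<bar>v y - l\<bar>)"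
    using assms(1) unfolding uniformly_nondegenerate_def by blast
  show ?thesis
    unfolding uniformly_nondegenerate_def
  proof (intro exI[of _ c] conjI exI[of _ N] allI impI)
    fix l \<delta> :: real assume "0 < \<delta> \<and> \<delta> \<le> 1"
    then obtain P where "finite P" "card P \<le> N" "\<And>y. y \<in> S \<Longrightarrow> (\<forall>p\<in>P. \<delta> \<le> \<bar>y - p\<bar>) \<Longrightarrow> c * \<delta> ^ m \<le> \<bar>v y - l\<bar>"
      using S[of \<delta> l] by blast
    then show "\<exists>P. finite P \<and> card P \<le> N \<and> (\<forall>y\<in>T. (\<forall>p\<in>P. \<delta> \<le> \<bar>y - p\<bar>) \<longrightarrow> c * \<delta> ^ m \<le> \<bar>v y - l\<bar>)"
      using assms(2) by (intro exI[of _ P]) blast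
  qed (rule c)
qed

section \<open>From the conditions on the derivatives of the profile to uniform
  nondegeneracy\<close>

lemma nderiv_on_has_real_derivative:
  assumes "Cm_on m S v" "i < m" "y \<in> S"
  shows "(nderiv_on S i v has_real_derivative nderiv_on S (Suc i) v y) (at y within S)"
proof -
  have "nderiv_on S i v differentiable (at y within S)"
    using assms by (simp add: Cm_on_def differentiable_on_def)
  then show ?thesis
    by (simp add: has_real_derivative_iff_has_vector_derivative vector_derivative_works[symmetric])
qed

lemma nderiv_on_continuous:
  assumes "Cm_on m S v" "i \<le> m"
  shows "continuous_on S (nderiv_on S i v)"
proof (cases "i < m")
  case True
  then show ?thesis using assms by (intro differentiable_imp_continuous_on) (simp add: Cm_on_def)
next
  case False
  then show ?thesis using assms by (simp add: Cm_on_def)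
qed

text \<open>Subtracting \<open>l\<close> changes only the zeroth member of the chain of derivatives,
  so \<open>finite_exclusion_set\<close> gives the same count and constant for every level. Its
  bound has a factor \<delta>/2 per derivative, whence c / 2^j, and \<delta>^m \<le> \<delta>^j for
  \<delta> \<le> 1.\<close>

lemma uniformly_nondegenerate_interval:
  assumes Cm: "Cm_on m S v" and j: "1 \<le> j" "j \<le> m" and I: "I \<subseteq> S" "is_interval I"
    and c: "c > 0" "\<And>y. y \<in> I \<Longrightarrow> c \<le> \<bar>nderiv_on S j v y\<bar>"
  shows "uniformly_nondegenerate m v I"
  unfolding uniformly_nondegenerate_def
proof (intro exI[of _ "c / 2 ^ j"] conjI exI[of _ "excluded_points j"] allI impI)
  show "c / 2 ^ j > 0" using c(1) by simp
  fix l \<delta> :: real assume \<delta>: "0 < \<delta> \<and> \<delta> \<le> 1"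
  define f where "f i y = (if i = 0 then v y - l else nderiv_on S i v y)" for i y
  have der: "(f i has_real_derivative f (Suc i) y) (at y within I)" if "i < j" "y \<in> I" for i y
  proof -
    have "(nderiv_on S i v has_real_derivative nderiv_on S (Suc i) v y) (at y within S)"
      using nderiv_on_has_real_derivative[OF Cm] that j I(1) by auto
    then have *: "(nderiv_on S i v has_real_derivative nderiv_on S (Suc i) v y) (at y within I)"
      using I(1) by (rule has_field_derivative_subset)
    show ?thesis
    proof (cases "i = 0")
      case True
      then have "((\<lambda>y. v y - l) has_real_derivative nderiv_on S (Suc 0) v y - 0) (at y within I)"
        using * by (intro DERIV_diff) auto
      then show ?thesis using True by (simp add: f_def[abs_def])
    next
      case False
      then show ?thesis using * by (simp add: f_def[abs_def])
    qed
  qed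
  have lb: "c \<le> \<bar>f j y\<bar>" if "y \<in> I" for y using c(2)[OF that] j(1) by (simp add: f_def)
  have "0 < \<delta>" using \<delta> by simp
  from finite_exclusion_set[OF der lb I(2) c(1) this]
  obtain P where P: "finite P" "card P \<le> excluded_points j"
    "\<And>y. y \<in> I \<Longrightarrow> (\<forall>p\<in>P. \<delta> \<le> \<bar>y - p\<bar>) \<Longrightarrow> (\<delta> / 2) ^ j * c \<le> \<bar>f 0 y\<bar>" by blast
  have "c / 2 ^ j * \<delta> ^ m \<le> c / 2 ^ j * \<delta> ^ j"
    using \<delta> c(1) j(2) by (intro mult_left_mono power_decreasing) auto
  also have "\<dots> = (\<delta> / 2) ^ j * c" by (simp add: power_divide)
  finally show "\<exists>P. finite P \<and> card P \<le> excluded_points j \<and>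
      (\<forall>y\<in>I. (\<forall>p\<in>P. \<delta> \<le> \<bar>y - p\<bar>) \<longrightarrow> c / 2 ^ j * \<delta> ^ m \<le> \<bar>v y - l\<bar>)"
    using P by (intro exI[of _ P]) (force simp: f_def)
qed

text \<open>Far out the first derivative is bounded below on each side. The rest is compact: around
  each of its points some derivative of order at most \<open>m\<close> keeps half its modulus on a
  ball, and finitely many balls suffice, so the count stays finite and the constant
  positive.\<close>

lemma uniformly_nondegenerate_profile:
  assumes m: "m \<ge> 1" and S: "closed S" "is_interval S" and Cm: "Cm_on m S v"
    and pos: "\<forall>y\<in>S. (\<Sum>j=1..m. \<bar>nderiv_on S j v y\<bar>) > 0"
    and inf: "c0 > 0" "Liminf (inf at_infinity (principal S)) (\<lambda>y. ereal \<bar>nderiv_on S 1 v y\<bar>) \<ge> ereal c0"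
  shows "uniformly_nondegenerate m v S"
proof -
  \<comment> \<open>A bound on the lower limit passes to the function itself only eventually and
    with some loss, here half of \<open>c0\<close>.\<close>
  have "ereal (c0 / 2) < ereal c0" using inf(1) by simp
  then have "\<forall>\<^sub>F y in inf at_infinity (principal S). ereal (c0 / 2) < ereal \<bar>nderiv_on S 1 v y\<bar>"
    using inf(2) unfolding le_Liminf_iff by blast
  then obtain A where A: "\<And>y. norm y \<ge> A \<Longrightarrow> y \<in> S \<Longrightarrow> c0 / 2 < \<bar>nderiv_on S 1 v y\<bar>"
    unfolding eventually_inf_principal eventually_at_infinity by auto
  have far: "uniformly_nondegenerate m v (S \<inter> {A..})" "uniformly_nondegenerate m v (S \<inter> {..-A})"
    by (rule uniformly_nondegenerate_interval[OF Cm _ m, of _ "c0 / 2"];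
        use inf(1) A S(2) in \<open>force simp: is_interval_Int is_interval_ci is_interval_ic intro: less_imp_le\<close>)+
  let ?K = "S \<inter> {-A..A}"
  have K: "compact ?K" using S(1) by (simp add: closed_Int_compact)
  have "\<exists>e>0. uniformly_nondegenerate m v (S \<inter> ball y e)" if y: "y \<in> ?K" for y
  proof -
    have "\<exists>j\<in>{1..m}. \<bar>nderiv_on S j v y\<bar> \<noteq> 0"
    proof (rule ccontr)
      assume "\<not> ?thesis"
      then have "(\<Sum>j=1..m. \<bar>nderiv_on S j v y\<bar>) = 0" by (intro sum.neutral) auto
      then show False using pos y by force
    qed
    then obtain j where j: "1 \<le> j" "j \<le> m" and nz: "nderiv_on S j v y \<noteq> 0" by auto
    let ?c = "\<bar>nderiv_on S j v y\<bar> / 2"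
    have "?c > 0" using nz by simp
    moreover have "continuous_on S (nderiv_on S j v)" by (rule nderiv_on_continuous[OF Cm j(2)])
    ultimately obtain e where e: "e > 0"
      "\<And>x. x \<in> S \<Longrightarrow> dist x y < e \<Longrightarrow> dist (nderiv_on S j v x) (nderiv_on S j v y) < ?c"
      using y unfolding continuous_on_iff by (metis IntD1)
    have "uniformly_nondegenerate m v (S \<inter> ball y e)"
    proof (rule uniformly_nondegenerate_interval[OF Cm j _ _ \<open>?c > 0\<close>])
      show "is_interval (S \<inter> ball y e)" using S(2) by (simp add: is_interval_Int is_interval_ball_real)
      fix x assume "x \<in> S \<inter> ball y e"
      then have "dist (nderiv_on S j v x) (nderiv_on S j v y) < ?c" using e(2) by (simp add: dist_commute)
      then show "?c \<le> \<bar>nderiv_on S j v x\<bar>" unfolding dist_real_def by linarith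
    qed simp
    then show ?thesis using e(1) by blast
  qed
  then obtain e where e: "\<And>y. y \<in> ?K \<Longrightarrow> e y > 0"
    "\<And>y. y \<in> ?K \<Longrightarrow> uniformly_nondegenerate m v (S \<inter> ball y (e y))" by metis
  have "?K \<subseteq> (\<Union>y\<in>?K. ball y (e y))" using e(1) by force
  then obtain D where D: "D \<subseteq> ?K" "finite D" "?K \<subseteq> (\<Union>y\<in>D. ball y (e y))"
    using compactE_image[OF K, of ?K "\<lambda>y. ball y (e y)"] by blast
  have "uniformly_nondegenerate m v (\<Union>((\<lambda>y. S \<inter> ball y (e y)) ` D))"
  proof (rule uniformly_nondegenerate_Union)
    show "finite ((\<lambda>y. S \<inter> ball y (e y)) ` D)" using D(2) by simp
    show "uniformly_nondegenerate m v T" if "T \<in> (\<lambda>y. S \<inter> ball y (e y)) ` D" for T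
      using that D(1) e(2) by blast
  qed
  then have "uniformly_nondegenerate m v (\<Union>((\<lambda>y. S \<inter> ball y (e y)) ` D) \<union> (S \<inter> {A..} \<union> S \<inter> {..-A}))"
    using far by (intro uniformly_nondegenerate_Un)
  moreover have "S \<subseteq> \<Union>((\<lambda>y. S \<inter> ball y (e y)) ` D) \<union> (S \<inter> {A..} \<union> S \<inter> {..-A})"
  proof
    fix y assume y: "y \<in> S"
    consider "y \<in> ?K" | "y \<ge> A" | "y \<le> -A" using y by force
    then show "y \<in> \<Union>((\<lambda>y. S \<inter> ball y (e y)) ` D) \<union> (S \<inter> {A..} \<union> S \<inter> {..-A})"
      by cases (use D(3) y in auto)
  qed
  ultimately show ?thesis by (rule uniformly_nondegenerate_subset)
qed

section \<open>Sign-adapted cutoffs\<close>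

text \<open>The squared positive part is a truncation with continuous derivative. All cutoffs below
  are built from it and polynomials, so one derivative computation serves them all.\<close>

definition sqpos :: "real \<Rightarrow> real" where "sqpos x = (max 0 x)\<^sup>2"

lemma sqpos_DERIV: "(sqpos has_real_derivative 2 * max 0 x) (at x)"
proof -
  consider "x > 0" | "x < 0" | "x = 0" by linarith
  then show ?thesis
  proof cases
    case 1
    have "((\<lambda>x. x\<^sup>2) has_real_derivative 2 * max 0 x) (at x)"
      using 1 by (auto intro!: derivative_eq_intros)
    moreover have "open {0::real<..}" "x \<in> {0<..}" using 1 by auto
    ultimately show ?thesis
      by (rule has_field_derivative_transform_within_open) (simp add: sqpos_def)
  next
    case 2
    have "((\<lambda>x. 0) has_real_derivative 2 * max 0 x) (at x)"
      using 2 by (auto intro!: derivative_eq_intros)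
    moreover have "open {..<0::real}" "x \<in> {..<0}" using 2 by auto
    ultimately show ?thesis
      by (rule has_field_derivative_transform_within_open) (simp add: sqpos_def)
  next
    case 3
    have "((\<lambda>h. sqpos h / h) \<longlongrightarrow> 0) (at 0)"
    proof (rule Lim_null_comparison)
      show "\<forall>\<^sub>F h in at 0. norm (sqpos h / h) \<le> \<bar>h\<bar>"
        by (rule always_eventually) (auto simp: sqpos_def max_def power2_eq_square)
      show "((\<lambda>h. \<bar>h\<bar>) \<longlongrightarrow> 0) (at (0::real))"
        by (rule tendsto_rabs_zero) (rule tendsto_ident_at)
    qed
    then show ?thesis using 3 by (simp add: has_field_derivative_iff sqpos_def)
  qed
qed

text \<open>An even C^1 function equal to 0 for |t| \<le> 1 and to 1 for |t| \<ge> 2. The inner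
  \<open>sqpos\<close> switches on at |t| = 1 and reaches 1 already at t^2 = 2; the outer one
  truncates from there on.\<close>

definition gate :: "real \<Rightarrow> real" where "gate t = 1 - sqpos (1 - sqpos (t\<^sup>2 - 1))"

definition gate' :: "real \<Rightarrow> real" where
  "gate' t = 2 * max 0 (1 - sqpos (t\<^sup>2 - 1)) * (2 * max 0 (t\<^sup>2 - 1) * (2 * t))"

lemma gate_DERIV: "(gate has_real_derivative gate' t) (at t)"
proof -
  have "((\<lambda>t. sqpos (t\<^sup>2 - 1)) has_real_derivative 2 * max 0 (t\<^sup>2 - 1) * (2 * t)) (at t)"
    by (rule DERIV_chain2[OF sqpos_DERIV]) (auto intro!: derivative_eq_intros)
  then have "((\<lambda>t. 1 - sqpos (t\<^sup>2 - 1)) has_real_derivative - (2 * max 0 (t\<^sup>2 - 1) * (2 * t))) (at t)"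
    by (auto intro!: derivative_eq_intros)
  from DERIV_chain2[OF sqpos_DERIV this]
  have "((\<lambda>t. sqpos (1 - sqpos (t\<^sup>2 - 1))) has_real_derivative
     2 * max 0 (1 - sqpos (t\<^sup>2 - 1)) * - (2 * max 0 (t\<^sup>2 - 1) * (2 * t))) (at t)" .
  then show ?thesis
    unfolding gate_def[abs_def] gate'_def by (auto intro!: derivative_eq_intros)
qed

lemma gate_continuous: "continuous_on UNIV gate'"
  unfolding gate'_def sqpos_def by (intro continuous_intros)

lemma gate_bounds: "0 \<le> gate t" "gate t \<le> 1"
proof -
  have "0 \<le> sqpos x" for x by (simp add: sqpos_def)
  then have "max 0 (1 - sqpos (t\<^sup>2 - 1)) \<le> 1" by simp
  then have "sqpos (1 - sqpos (t\<^sup>2 - 1)) \<le> 1"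
    unfolding sqpos_def by (intro power_le_one) auto
  then show "0 \<le> gate t" by (simp add: gate_def)
  show "gate t \<le> 1" by (simp add: gate_def sqpos_def)
qed

lemma gate_eq_0: "\<bar>t\<bar> \<le> 1 \<Longrightarrow> gate t = 0"
  by (simp add: gate_def sqpos_def abs_square_le_1)

lemma gate_eq_1:
  assumes "2 \<le> \<bar>t\<bar>"
  shows "gate t = 1"
proof -
  have "2\<^sup>2 \<le> \<bar>t\<bar>\<^sup>2" using assms by (intro power_mono) auto
  then have "1 \<le> max 0 (t\<^sup>2 - 1)" by simp
  then have "1 \<le> sqpos (t\<^sup>2 - 1)" unfolding sqpos_def by (rule one_le_power)
  then show ?thesis by (simp add: gate_def sqpos_def[of "1 - _"])
qed

text \<open>The derivative lives on 1 < t^2 < 2, where |t| \<le> 3/2; its three factors are there at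
  most 2, 2 and 3.\<close>

lemma gate'_bound: "\<bar>gate' t\<bar> \<le> 12"
proof (cases "0 < t\<^sup>2 - 1 \<and> t\<^sup>2 - 1 < 1")
  case True
  have "\<bar>t\<bar>\<^sup>2 \<le> (3/2)\<^sup>2" using True by (simp add: power2_eq_square)
  then have t: "\<bar>t\<bar> \<le> 3/2" by (rule power2_le_imp_le) simp
  have a: "\<bar>2 * max 0 (1 - sqpos (t\<^sup>2 - 1))\<bar> \<le> 2" by (simp add: sqpos_def)
  have b: "\<bar>2 * max 0 (t\<^sup>2 - 1)\<bar> \<le> 2" using True by simp
  have "\<bar>gate' t\<bar> = \<bar>2 * max 0 (1 - sqpos (t\<^sup>2 - 1))\<bar> * (\<bar>2 * max 0 (t\<^sup>2 - 1)\<bar> * \<bar>2 * t\<bar>)"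
    by (simp add: gate'_def abs_mult)
  also have "\<dots> \<le> 2 * (2 * 3)"
    using a b t by (intro mult_mono) auto
  finally show ?thesis by simp
next
  case False
  then consider "t\<^sup>2 - 1 \<le> 0" | "1 \<le> t\<^sup>2 - 1" by linarith
  then have "gate' t = 0"
  proof cases
    case 1
    then show ?thesis by (simp add: gate'_def)
  next
    case 2
    then have "1 \<le> sqpos (t\<^sup>2 - 1)" unfolding sqpos_def by (intro one_le_power) simp
    then show ?thesis by (simp add: gate'_def)
  qed
  then show ?thesis by simp
qed

text \<open>A product of rescaled gates, one for each point of \<open>P\<close>. All factors lie in
  [0,1], so their derivatives, each at most 12/\<delta>, simply add up.\<close>

lemma avoiding_cutoff:
  assumes "finite P" "\<delta> > 0"
  obtains w w' where "\<And>y. (w has_real_derivative w' y) (at y)" "continuous_on UNIV w'"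
    "\<And>y. 0 \<le> w y" "\<And>y. w y \<le> 1" "\<And>y. \<bar>w' y\<bar> \<le> 12 * real (card P) / \<delta>"
    "\<And>y p. p \<in> P \<Longrightarrow> \<bar>y - p\<bar> \<le> \<delta> \<Longrightarrow> w y = 0"
    "\<And>y. (\<forall>p\<in>P. 2 * \<delta> \<le> \<bar>y - p\<bar>) \<Longrightarrow> w y = 1"
proof -
  have "\<exists>w w'. (\<forall>y. (w has_real_derivative w' y) (at y)) \<and> continuous_on UNIV w'
    \<and> (\<forall>y. 0 \<le> w y \<and> w y \<le> 1) \<and> (\<forall>y. \<bar>w' y\<bar> \<le> 12 * real (card P) / \<delta>)
    \<and> (\<forall>y. \<forall>p\<in>P. \<bar>y - p\<bar> \<le> \<delta> \<longrightarrow> w y = 0)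
    \<and> (\<forall>y. (\<forall>p\<in>P. 2 * \<delta> \<le> \<bar>y - p\<bar>) \<longrightarrow> w y = 1)"
    using assms(1)
  proof (induction P rule: finite_induct)
    case empty
    show ?case by (rule exI[of _ "\<lambda>_. 1"], rule exI[of _ "\<lambda>_. 0"]) auto
  next
    case (insert q P)
    then obtain w w' where D: "\<And>y. (w has_real_derivative w' y) (at y)" and c: "continuous_on UNIV w'"
      and b: "\<And>y. 0 \<le> w y" "\<And>y. w y \<le> 1" "\<And>y. \<bar>w' y\<bar> \<le> 12 * real (card P) / \<delta>"
      and z: "\<And>y p. p \<in> P \<Longrightarrow> \<bar>y - p\<bar> \<le> \<delta> \<Longrightarrow> w y = 0"
      and o: "\<And>y. (\<forall>p\<in>P. 2 * \<delta> \<le> \<bar>y - p\<bar>) \<Longrightarrow> w y = 1" by blast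
    define g where "g y = gate ((y - q) / \<delta>)" for y
    define g' where "g' y = gate' ((y - q) / \<delta>) * (1 / \<delta>)" for y
    have gD: "(g has_real_derivative g' y) (at y)" for y
      unfolding g_def g'_def
      by (rule DERIV_chain2[OF gate_DERIV]) (use assms(2) in \<open>auto intro!: derivative_eq_intros\<close>)
    have gc: "continuous_on UNIV g'"
      unfolding g'_def
      by (intro continuous_intros continuous_on_compose2[OF gate_continuous]) (use assms(2) in auto)
    have wc: "continuous_on UNIV w" by (rule DERIV_imp_continuous_on[OF D])
    have gc0: "continuous_on UNIV g" by (rule DERIV_imp_continuous_on[OF gD])
    have gb: "0 \<le> g y" "g y \<le> 1" for y using gate_bounds by (auto simp: g_def)
    have gb': "\<bar>g' y\<bar> \<le> 12 / \<delta>" for y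
      using gate'_bound[of "(y - q) / \<delta>"] assms(2) by (simp add: g'_def abs_mult divide_right_mono)
    show ?case
    proof (rule exI[of _ "\<lambda>y. w y * g y"], rule exI[of _ "\<lambda>y. w' y * g y + g' y * w y"],
        intro conjI allI ballI impI)
      show "((\<lambda>y. w y * g y) has_real_derivative w' y * g y + g' y * w y) (at y)" for y
        by (rule DERIV_mult[OF D gD])
      show "continuous_on UNIV (\<lambda>y. w' y * g y + g' y * w y)"
        by (intro continuous_intros c gc wc gc0)
      show "0 \<le> w y * g y" for y using b(1) gb(1) by simp
      show "w y * g y \<le> 1" for y using b gb by (intro mult_le_one) auto
      show "\<bar>w' y * g y + g' y * w y\<bar> \<le> 12 * real (card (insert q P)) / \<delta>" for y
      proof -
        have "\<bar>w' y * g y + g' y * w y\<bar> \<le> \<bar>w' y\<bar> * g y + \<bar>g' y\<bar> * w y"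
          using abs_triangle_ineq[of "w' y * g y" "g' y * w y"] b(1)[of y] gb(1)[of y] by (simp add: abs_mult)
        also have "\<dots> \<le> \<bar>w' y\<bar> + \<bar>g' y\<bar>"
          using b(1,2)[of y] gb[of y] by (intro add_mono mult_left_le) auto
        also have "\<dots> \<le> 12 * real (card P) / \<delta> + 12 / \<delta>"
          using b(3)[of y] gb'[of y] by linarith
        also have "\<dots> = 12 * real (card (insert q P)) / \<delta>"
          using insert.hyps by (simp add: algebra_simps add_divide_distrib)
        finally show ?thesis .
      qed
      show "w y * g y = 0" if "p \<in> insert q P" "\<bar>y - p\<bar> \<le> \<delta>" for y p
      proof (cases "p = q")
        case True
        then have "\<bar>(y - q) / \<delta>\<bar> \<le> 1" using that(2) assms(2) by (simp add: abs_divide)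
        then show ?thesis using gate_eq_0 by (simp add: g_def)
      next
        case False
        then show ?thesis using z that by auto
      qed
      show "w y * g y = 1" if far: "\<forall>p\<in>insert q P. 2 * \<delta> \<le> \<bar>y - p\<bar>" for y
      proof -
        have "2 \<le> \<bar>(y - q) / \<delta>\<bar>" using far assms(2) by (simp add: abs_divide field_simps)
        then have "g y = 1" by (simp add: g_def gate_eq_1)
        then show ?thesis using o far by simp
      qed
    qed
  qed
  then show thesis using that by blast
qed

text \<open>The multiplier is X = w sgn(v - l) with \<open>w\<close> from
  \<open>avoiding_cutoff\<close>. Near any point either \<open>w\<close> vanishes, or |v - l| \<ge>
  \<kappa> at that point and, \<open>v\<close> being continuous, the sign is locally constant. Hence
  X is as smooth as \<open>w\<close>, and its derivative does not involve that of
  \<open>v\<close>.\<close>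

lemma signed_cutoff:
  fixes v :: "real \<Rightarrow> real"
  assumes P: "finite P" "\<delta> > 0" and v: "continuous_on S v"
    and far: "\<And>y. y \<in> S \<Longrightarrow> (\<forall>p\<in>P. \<delta> \<le> \<bar>y - p\<bar>) \<Longrightarrow> \<kappa> \<le> \<bar>v y - l\<bar>" and \<kappa>: "\<kappa> > 0"
  obtains X X' where "\<And>y. y \<in> S \<Longrightarrow> (X has_real_derivative X' y) (at y within S)"
    "continuous_on S X'" "continuous_on S X" "\<And>y. \<bar>X y\<bar> \<le> 1"
    "\<And>y. \<bar>X' y\<bar> \<le> 12 * real (card P) / \<delta>" "\<And>y. 0 \<le> X y * (v y - l)"
    "\<And>y. y \<in> S \<Longrightarrow> (\<forall>p\<in>P. 2 * \<delta> \<le> \<bar>y - p\<bar>) \<Longrightarrow> \<kappa> \<le> X y * (v y - l)"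
proof -
  obtain w w' where D: "\<And>y. (w has_real_derivative w' y) (at y)" and c: "continuous_on UNIV w'"
    and b: "\<And>y. 0 \<le> w y" "\<And>y. w y \<le> 1" "\<And>y. \<bar>w' y\<bar> \<le> 12 * real (card P) / \<delta>"
    and z: "\<And>y p. p \<in> P \<Longrightarrow> \<bar>y - p\<bar> \<le> \<delta> \<Longrightarrow> w y = 0"
    and o: "\<And>y. (\<forall>p\<in>P. 2 * \<delta> \<le> \<bar>y - p\<bar>) \<Longrightarrow> w y = 1"
    using avoiding_cutoff[OF P] by blast
  have z': "w' y = 0" if p: "p \<in> P" and yp: "\<bar>y - p\<bar> < \<delta>" for y p
  proof -
    have "((\<lambda>y. 0) has_real_derivative 0) (at y)" by simp
    moreover have "open (ball p \<delta>)" "y \<in> ball p \<delta>" using yp by (auto simp: dist_real_def abs_minus_commute)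
    ultimately have "(w has_real_derivative 0) (at y)"
      by (rule has_field_derivative_transform_within_open)
         (use z[OF p] in \<open>auto simp: dist_real_def abs_minus_commute\<close>)
    then show ?thesis using D DERIV_unique by blast
  qed
  define s where "s y = sgn (v y - l)" for y
  \<comment> \<open>Near every point the sign can be frozen: either it is constant there, or both
    \<open>w\<close> and \<open>w'\<close> vanish.\<close>
  have loc: "\<exists>d>0. (\<forall>x\<in>S. dist x y < d \<longrightarrow> w x * s x = w x * s y \<and> w' x * s x = w' x * s y)" if y: "y \<in> S" for y
  proof (cases "\<forall>p\<in>P. \<delta> \<le> \<bar>y - p\<bar>")
    case True
    then have k: "\<kappa> \<le> \<bar>v y - l\<bar>" using far y by blast
    obtain d where d: "d > 0" "\<And>x. x \<in> S \<Longrightarrow> dist x y < d \<Longrightarrow> dist (v x) (v y) < \<kappa>"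
      using v y \<kappa> unfolding continuous_on_iff by blast
    have "s x = s y" if "x \<in> S" "dist x y < d" for x
      using d(2)[OF that] k unfolding s_def dist_real_def by (auto simp: sgn_if abs_if split: if_splits)
    then show ?thesis using d(1) by (intro exI[of _ d]) auto
  next
    case False
    then obtain p where p: "p \<in> P" "\<bar>y - p\<bar> < \<delta>" by auto
    have "w x = 0 \<and> w' x = 0" if "dist x y < \<delta> - \<bar>y - p\<bar>" for x
    proof -
      have "\<bar>x - p\<bar> < \<delta>" using that unfolding dist_real_def by linarith
      then show ?thesis using z[OF p(1), of x] z'[OF p(1), of x] by simp
    qed
    then show ?thesis using p(2) by (intro exI[of _ "\<delta> - \<bar>y - p\<bar>"]) auto
  qed
  have wc: "continuous_on UNIV w" by (rule DERIV_imp_continuous_on[OF D])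
  have cont: "continuous_on S (\<lambda>x. u x * s x)"
    if u: "continuous_on UNIV u" and l: "\<And>y. y \<in> S \<Longrightarrow> \<exists>d>0. \<forall>x\<in>S. dist x y < d \<longrightarrow> u x * s x = u x * s y" for u
    unfolding continuous_on_eq_continuous_within
  proof
    fix y assume y: "y \<in> S"
    obtain d where d: "d > 0" "\<forall>x\<in>S. dist x y < d \<longrightarrow> u x * s x = u x * s y" using l[OF y] by blast
    have "continuous (at y within S) (\<lambda>x. u x * s y)"
      using u y by (intro continuous_intros) (auto simp: continuous_on_eq_continuous_within intro: continuous_at_imp_continuous_at_within)
    then show "continuous (at y within S) (\<lambda>x. u x * s x)"
      by (rule continuous_transform_within[OF _ d(1) y]) (use d(2) in auto)
  qed
  show thesis
  proof (rule that[of "\<lambda>y. w y * s y" "\<lambda>y. w' y * s y"])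
    fix y
    show "((\<lambda>y. w y * s y) has_real_derivative w' y * s y) (at y within S)" if y: "y \<in> S"
    proof -
      obtain d where d: "d > 0" "\<forall>x\<in>S. dist x y < d \<longrightarrow> w x * s x = w x * s y" using loc[OF y] by blast
      have "((\<lambda>x. w x * s y) has_real_derivative w' y * s y) (at y within S)"
        by (rule DERIV_cmult_right[OF has_field_derivative_at_within[OF D]])
      then show ?thesis
        by (rule has_field_derivative_transform_within[OF _ d(1) y]) (use d(2) in auto)
    qed
    show "\<bar>w y * s y\<bar> \<le> 1"
    proof -
      have "\<bar>w y\<bar> * \<bar>s y\<bar> \<le> 1 * 1" using b(1,2)[of y] by (intro mult_mono) (auto simp: s_def sgn_if)
      then show ?thesis by (simp add: abs_mult)
    qed
    show "\<bar>w' y * s y\<bar> \<le> 12 * real (card P) / \<delta>"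
    proof -
      have "\<bar>w' y\<bar> * \<bar>s y\<bar> \<le> \<bar>w' y\<bar> * 1" by (intro mult_left_mono) (auto simp: s_def sgn_if)
      then show ?thesis using b(3)[of y] by (simp add: abs_mult)
    qed
    have sv: "w y * s y * (v y - l) = w y * \<bar>v y - l\<bar>" by (simp add: s_def sgn_if abs_if)
    show "0 \<le> w y * s y * (v y - l)" unfolding sv using b(1)[of y] by simp
    show "\<kappa> \<le> w y * s y * (v y - l)" if "y \<in> S" "\<forall>p\<in>P. 2 * \<delta> \<le> \<bar>y - p\<bar>"
    proof -
      have "\<forall>p\<in>P. \<delta> \<le> \<bar>y - p\<bar>" using that(2) P(2) by force
      then show ?thesis unfolding sv using far[OF that(1)] o[OF that(2)] by simp
    qed
  next
    show "continuous_on S (\<lambda>y. w' y * s y)" by (rule cont[OF c]) (use loc in blast)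
    show "continuous_on S (\<lambda>y. w y * s y)" by (rule cont[OF wc]) (use loc in blast)
  qed
qed

section \<open>Energy estimates on a bounded interval\<close>

lemma continuous_mult_L2_Icc:
  fixes h :: "real \<Rightarrow> complex"
  assumes "f \<in> L2 {a..b}" "continuous_on {a..b} h"
  shows "(\<lambda>y. h y * f y) \<in> L2 {a..b}"
proof -
  obtain B where B: "\<And>y. y \<in> {a..b} \<Longrightarrow> norm (h y) \<le> B"
    using continuous_on_Icc_norm_bounded[OF assms(2)] by blast
  have m: "h \<in> borel_measurable (lebesgue_on {a..b})"
    by (rule continuous_imp_measurable_on_sets_lebesgue[OF assms(2)]) simp
  show ?thesis by (rule L2_bounded_mult(1)[OF assms(1) m B])
qed

lemma borel_measurable_cnj [measurable]:
  "f \<in> borel_measurable M \<Longrightarrow> (\<lambda>x. cnj (f x)) \<in> borel_measurable M"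
  by (rule borel_measurable_continuous_on[OF continuous_on_cnj[OF continuous_on_id]])

lemma L2_integral_bound:
  assumes f: "f \<in> L2 S" and g: "g \<in> L2 S" and h: "h \<in> borel_measurable (lebesgue_on S)"
    and b: "\<And>y. y \<in> S \<Longrightarrow> cmod (h y) \<le> B * (cmod (f y) * cmod (g y))" and B: "B \<ge> 0"
  shows "integrable (lebesgue_on S) h" "cmod (LINT y|lebesgue_on S. h y) \<le> B * (L2norm S f * L2norm S g)"
proof -
  have i: "integrable (lebesgue_on S) (\<lambda>y. B * (cmod (f y) * cmod (g y)))"
    using L2_product_integrable[OF f g] by auto
  show ih: "integrable (lebesgue_on S) h"
  proof (rule Bochner_Integration.integrable_bound[OF i h])
    show "AE y in lebesgue_on S. norm (h y) \<le> norm (B * (cmod (f y) * cmod (g y)))"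
    proof (rule AE_I2)
      fix y assume "y \<in> space (lebesgue_on S)"
      then show "norm (h y) \<le> norm (B * (cmod (f y) * cmod (g y)))"
        using b[of y] by simp
    qed
  qed
  have "cmod (LINT y|lebesgue_on S. h y) \<le> (LINT y|lebesgue_on S. cmod (h y))"
    by (rule integral_norm_bound)
  also have "\<dots> \<le> (LINT y|lebesgue_on S. B * (cmod (f y) * cmod (g y)))"
    using ih i b by (intro integral_mono) auto
  also have "\<dots> \<le> B * (L2norm S f * L2norm S g)"
    using L2_Cauchy_Schwarz[OF f g] B by (simp add: mult_left_mono)
  finally show "cmod (LINT y|lebesgue_on S. h y) \<le> B * (L2norm S f * L2norm S g)" .
qed

lemma AD_DERIV_within:
  assumes "\<And>y. y \<in> S \<Longrightarrow> (X has_real_derivative X' y) (at y within S)" "continuous_on S X'" "is_interval S"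
  shows "AD S (\<lambda>y. of_real (X' y)) (\<lambda>y. of_real (X y))"
proof (rule AD_C1[OF assms(3)])
  fix y assume "y \<in> S"
  then have "(X has_vector_derivative X' y) (at y within S)"
    using assms(1) has_real_derivative_iff_has_vector_derivative by blast
  then show "((\<lambda>y. complex_of_real (X y)) has_vector_derivative of_real (X' y)) (at y within S)"
    by (rule bounded_linear.has_vector_derivative[OF bounded_linear_of_real])
next
  show "continuous_on S (\<lambda>y. complex_of_real (X' y))"
    by (intro continuous_intros assms(2))
qed

lemma indicator_Icc_integrable: "integrable lebesgue (indicat_real {c..d::real})"
  using lmeasurable_iff_integrable[of "{c..d}"] by simp

text \<open>The model problem on a bounded interval. The assumption \<open>dirichlet\<close>
  excludes Neumann conditions at both ends, on which \<open>sup_bound\<close> relies.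
  \<open>G2\<close> is only square integrable, the almost everywhere derivative of
  \<open>G1\<close>.\<close>

locale interval_solution =
  fixes a b \<nu> k l :: real and v :: "real \<Rightarrow> real" and G G1 G2 :: "real \<Rightarrow> complex"
  assumes ab: "a < b" and v: "continuous_on {a..b} v"
    and \<nu>: "\<nu> > 0" and k: "k \<noteq> 0"
    and AD1: "AD {a..b} G1 G" and AD2: "AD {a..b} G2 G1" and G2: "G2 \<in> L2 {a..b}"
    and bc_a: "G a = 0 \<or> G1 a = 0" and bc_b: "G b = 0 \<or> G1 b = 0"
    and dirichlet: "G a = 0 \<or> G b = 0"
begin

definition F :: "real \<Rightarrow> complex" where
  "F y = - of_real \<nu> * G2 y + \<i> * of_real (k * (v y - l)) * G y"

lemma cont_G: "continuous_on {a..b} G" and cont_G1: "continuous_on {a..b} G1"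
  using AD_continuous[OF AD1] AD_continuous[OF AD2] by (simp_all add: is_interval_cc)

lemma G_L2: "G \<in> L2 {a..b}" and G1_L2: "G1 \<in> L2 {a..b}"
  by (rule continuous_L2_Icc[OF cont_G], rule continuous_L2_Icc[OF cont_G1])

lemma F_L2: "F \<in> L2 {a..b}"
proof -
  have "(\<lambda>y. (- of_real \<nu>) * G2 y + (\<i> * of_real (k * (v y - l))) * G y) \<in> L2 {a..b}"
    by (intro L2_add L2_cmult G2 continuous_mult_L2_Icc G_L2 continuous_intros v)
  then show ?thesis by (simp add: F_def[abs_def])
qed

abbreviation "nG \<equiv> L2norm {a..b} G"
abbreviation "nG1 \<equiv> L2norm {a..b} G1"
abbreviation "nF \<equiv> L2norm {a..b} F"

text \<open>\<open>F\<close> is paired with X times the conjugate of \<open>G\<close> and one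
  integration by parts is made; at each end \<open>G\<close> or \<open>G1\<close> vanishes, so there
  are no boundary terms. As X and \<open>v\<close> are real, real and imaginary parts separate
  diffusion from transport, up to the term with \<open>X'\<close>.\<close>

lemma energy_identity:
  assumes X: "\<And>y. y \<in> {a..b} \<Longrightarrow> (X has_real_derivative X' y) (at y within {a..b})"
    and X': "continuous_on {a..b} X'"
  shows "(LINT y|lebesgue_on {a..b}. F y * (of_real (X y) * cnj (G y)))
    = of_real \<nu> * (LINT y|lebesgue_on {a..b}. of_real (X y * (cmod (G1 y))\<^sup>2))
    + of_real \<nu> * (LINT y|lebesgue_on {a..b}. of_real (X' y) * (G1 y * cnj (G y)))
    + \<i> * (LINT y|lebesgue_on {a..b}. of_real (k * (X y * (v y - l) * (cmod (G y))\<^sup>2)))"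
proof -
  let ?M = "lebesgue_on {a..b}"
  have I: "is_interval {a..b}" by (rule is_interval_cc)
  have Xc: "continuous_on {a..b} X"
    using X DERIV_continuous_on by blast
  have ADX: "AD {a..b} (\<lambda>y. of_real (X' y)) (\<lambda>y. of_real (X y))"
    by (rule AD_DERIV_within[OF X X' I])
  have "AD {a..b} (\<lambda>y. G2 y * (of_real (X y) * cnj (G y))
        + G1 y * (of_real (X' y) * cnj (G y) + of_real (X y) * cnj (G1 y)))
      (\<lambda>y. G1 y * (of_real (X y) * cnj (G y)))"
    by (intro AD_mult[OF AD2 _ I] AD_mult[OF ADX _ I] AD_cnj AD1)
  from AD_D(2)[OF this, of a b] ab bc_a bc_b
  have z: "(LINT y|?M. G2 y * (of_real (X y) * cnj (G y))
        + G1 y * (of_real (X' y) * cnj (G y) + of_real (X y) * cnj (G1 y))) = 0"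
    by auto
  have i1: "integrable ?M (\<lambda>y. G2 y * (of_real (X y) * cnj (G y)))"
    by (intro integrable_mult_continuous L2_Icc_integrable G2 continuous_intros Xc cont_G)
  have i2: "integrable ?M (\<lambda>y. complex_of_real (X y * (cmod (G1 y))\<^sup>2))"
    by (intro continuous_on_integrable_lebesgue_on continuous_intros Xc cont_G1)
  have i3: "integrable ?M (\<lambda>y. of_real (X' y) * (G1 y * cnj (G y)))"
    by (intro continuous_on_integrable_lebesgue_on continuous_intros X' cont_G1 cont_G)
  have i4: "integrable ?M (\<lambda>y. complex_of_real (k * (X y * (v y - l) * (cmod (G y))\<^sup>2)))"
    by (intro continuous_on_integrable_lebesgue_on continuous_intros Xc v cont_G)
  have "(LINT y|?M. G2 y * (of_real (X y) * cnj (G y))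
        + G1 y * (of_real (X' y) * cnj (G y) + of_real (X y) * cnj (G1 y)))
     = (LINT y|?M. G2 y * (of_real (X y) * cnj (G y)) + (of_real (X' y) * (G1 y * cnj (G y)) + of_real (X y * (cmod (G1 y))\<^sup>2)))"
    by (rule Bochner_Integration.integral_cong[OF refl])
       (simp add: algebra_simps complex_norm_square del: of_real_power)
  also have "\<dots> = (LINT y|?M. G2 y * (of_real (X y) * cnj (G y)))
     + ((LINT y|?M. of_real (X' y) * (G1 y * cnj (G y))) + (LINT y|?M. complex_of_real (X y * (cmod (G1 y))\<^sup>2)))"
    by (simp only: Bochner_Integration.integral_add[OF i1 Bochner_Integration.integrable_add[OF i3 i2]]
        Bochner_Integration.integral_add[OF i3 i2])
  finally have "(LINT y|?M. G2 y * (of_real (X y) * cnj (G y)))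
     + ((LINT y|?M. of_real (X' y) * (G1 y * cnj (G y))) + (LINT y|?M. complex_of_real (X y * (cmod (G1 y))\<^sup>2))) = 0"
    using z by simp
  then have e: "(LINT y|?M. G2 y * (of_real (X y) * cnj (G y)))
     = - ((LINT y|?M. of_real (X' y) * (G1 y * cnj (G y))) + (LINT y|?M. complex_of_real (X y * (cmod (G1 y))\<^sup>2)))"
    by (simp only: eq_neg_iff_add_eq_0)
  have "(LINT y|?M. F y * (of_real (X y) * cnj (G y)))
    = (LINT y|?M. - of_real \<nu> * (G2 y * (of_real (X y) * cnj (G y)))
        + \<i> * of_real (k * (X y * (v y - l) * (cmod (G y))\<^sup>2)))"
  proof (rule Bochner_Integration.integral_cong[OF refl])
    fix y
    show "F y * (of_real (X y) * cnj (G y)) = - of_real \<nu> * (G2 y * (of_real (X y) * cnj (G y)))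
        + \<i> * of_real (k * (X y * (v y - l) * (cmod (G y))\<^sup>2))"
      unfolding F_def of_real_mult complex_norm_square
      by (simp add: algebra_simps)
  qed
  also have "\<dots> = - of_real \<nu> * (LINT y|?M. G2 y * (of_real (X y) * cnj (G y)))
        + \<i> * (LINT y|?M. complex_of_real (k * (X y * (v y - l) * (cmod (G y))\<^sup>2)))"
    by (simp only: Bochner_Integration.integral_add[OF integrable_mult_right[OF i1] integrable_mult_right[OF i4]]
        integral_mult_right_zero)
  finally show ?thesis
    unfolding e by (simp only: distrib_left minus_mult_minus add.assoc add.commute add.left_commute)
qed

text \<open>Real part of \<open>energy_identity\<close> with X = 1: the transport term is imaginary
  and the term with \<open>X'\<close> is zero.\<close>

lemma gradient_bound: "\<nu> * nG1\<^sup>2 \<le> nF * nG"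
proof -
  let ?M = "lebesgue_on {a..b}"
  have e: "(LINT y|?M. F y * (of_real 1 * cnj (G y)))
    = of_real \<nu> * (LINT y|?M. of_real (1 * (cmod (G1 y))\<^sup>2))
    + of_real \<nu> * (LINT y|?M. of_real 0 * (G1 y * cnj (G y)))
    + \<i> * (LINT y|?M. of_real (k * (1 * (v y - l) * (cmod (G y))\<^sup>2)))"
    by (rule energy_identity) auto
  have "Re (LINT y|?M. F y * cnj (G y)) = \<nu> * nG1\<^sup>2"
    using arg_cong[OF e, of Re] by (simp add: L2norm_sq del: of_real_mult of_real_power of_real_diff)
  moreover have "cmod (LINT y|?M. F y * cnj (G y)) \<le> 1 * (nF * nG)"
    by (rule L2_integral_bound[OF F_L2 G_L2])
       (use L2_measurable[OF F_L2] L2_measurable[OF G_L2] in \<open>auto simp: norm_mult\<close>)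
  ultimately show ?thesis using complex_Re_le_cmod[of "LINT y|?M. F y * cnj (G y)"] by simp
qed

text \<open>The imaginary part of \<open>energy_identity\<close> removes the term with |G1|^2.
  Besides the weighted integral only the term with \<open>X'\<close> remains; its cost \<nu> K is
  the reason to bound the slope of the multiplier.\<close>

lemma weighted_bound:
  assumes X: "\<And>y. y \<in> {a..b} \<Longrightarrow> (X has_real_derivative X' y) (at y within {a..b})"
    and X': "continuous_on {a..b} X'" and b: "\<And>y. \<bar>X y\<bar> \<le> 1" "\<And>y. \<bar>X' y\<bar> \<le> K"
  shows "\<bar>k\<bar> * \<bar>LINT y|lebesgue_on {a..b}. X y * (v y - l) * (cmod (G y))\<^sup>2\<bar> \<le> nF * nG + \<nu> * K * (nG1 * nG)"
proof -
  let ?M = "lebesgue_on {a..b}"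
  have Xc: "continuous_on {a..b} X" using X DERIV_continuous_on by blast
  have Xm: "X \<in> borel_measurable ?M"
    by (rule continuous_imp_measurable_on_sets_lebesgue[OF Xc]) simp
  have X'm: "X' \<in> borel_measurable ?M"
    by (rule continuous_imp_measurable_on_sets_lebesgue[OF X']) simp
  have K: "K \<ge> 0" using b(2)[of a] by linarith
  have "Im (LINT y|?M. F y * (of_real (X y) * cnj (G y)))
     = \<nu> * Im (LINT y|?M. of_real (X' y) * (G1 y * cnj (G y))) + (LINT y|?M. k * (X y * (v y - l) * (cmod (G y))\<^sup>2))"
    using arg_cong[OF energy_identity[OF X X'], of Im] by (simp del: of_real_mult of_real_power of_real_diff)
  moreover have "cmod (LINT y|?M. F y * (of_real (X y) * cnj (G y))) \<le> 1 * (nF * nG)"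
  proof (rule L2_integral_bound[OF F_L2 G_L2])
    show "(\<lambda>y. F y * (of_real (X y) * cnj (G y))) \<in> borel_measurable ?M"
      using L2_measurable[OF F_L2] L2_measurable[OF G_L2] Xm by auto
    show "cmod (F y * (of_real (X y) * cnj (G y))) \<le> 1 * (cmod (F y) * cmod (G y))" for y
      using mult_right_mono[OF b(1)[of y], of "cmod (F y) * cmod (G y)"] by (simp add: norm_mult mult_ac)
  qed simp
  moreover have "cmod (LINT y|?M. of_real (X' y) * (G1 y * cnj (G y))) \<le> K * (nG1 * nG)"
  proof (rule L2_integral_bound[OF G1_L2 G_L2])
    show "(\<lambda>y. of_real (X' y) * (G1 y * cnj (G y))) \<in> borel_measurable ?M"
      using L2_measurable[OF G1_L2] L2_measurable[OF G_L2] X'm by auto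
    show "cmod (of_real (X' y) * (G1 y * cnj (G y))) \<le> K * (cmod (G1 y) * cmod (G y))" for y
      using mult_right_mono[OF b(2)[of y], of "cmod (G1 y) * cmod (G y)"] by (simp add: norm_mult mult_ac)
  qed (rule K)
  moreover have "\<bar>\<nu> * Im (LINT y|?M. of_real (X' y) * (G1 y * cnj (G y)))\<bar> \<le> \<nu> * (K * (nG1 * nG))"
    using calculation(3) abs_Im_le_cmod[of "LINT y|?M. of_real (X' y) * (G1 y * cnj (G y))"] \<nu>
    by (simp add: abs_mult)
  moreover have "(LINT y|?M. k * (X y * (v y - l) * (cmod (G y))\<^sup>2)) = k * (LINT y|?M. X y * (v y - l) * (cmod (G y))\<^sup>2)"
    by simp
  moreover have "\<bar>Im (LINT y|?M. F y * (of_real (X y) * cnj (G y)))\<bar> \<le> cmod (LINT y|?M. F y * (of_real (X y) * cnj (G y)))"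
    by (rule abs_Im_le_cmod)
  ultimately have "\<bar>k * (LINT y|?M. X y * (v y - l) * (cmod (G y))\<^sup>2)\<bar> \<le> nF * nG + \<nu> * (K * (nG1 * nG))"
    by linarith
  then show ?thesis by (simp add: abs_mult mult.assoc)
qed

text \<open>The derivative of |G|^2 is integrated from a Dirichlet end, where |G|^2 is 0. Therefore
  neither a term in \<open>nG\<close> alone nor the length of the interval enters.\<close>

lemma sup_bound:
  assumes y: "y \<in> {a..b}"
  shows "(cmod (G y))\<^sup>2 \<le> 2 * (nG * nG1)"
proof -
  have AD: "AD {a..b} (\<lambda>y. G1 y * cnj (G y) + G y * cnj (G1 y)) (\<lambda>y. G y * cnj (G y))"
    by (intro AD_mult AD_cnj AD1) (rule is_interval_cc)
  have part: "cmod (LINT y|lebesgue_on {c..d}. G1 y * cnj (G y) + G y * cnj (G1 y)) \<le> 2 * (nG * nG1)"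
    if sub: "{c..d} \<subseteq> {a..b}" for c d
  proof -
    have L: "G \<in> L2 {c..d}" "L2norm {c..d} G \<le> nG" using L2_subset[OF G_L2 sub] by auto
    have L1: "G1 \<in> L2 {c..d}" "L2norm {c..d} G1 \<le> nG1" using L2_subset[OF G1_L2 sub] by auto
    have "cmod (LINT y|lebesgue_on {c..d}. G1 y * cnj (G y) + G y * cnj (G1 y)) \<le> 2 * (L2norm {c..d} G * L2norm {c..d} G1)"
    proof (rule L2_integral_bound[OF L(1) L1(1)])
      show "(\<lambda>y. G1 y * cnj (G y) + G y * cnj (G1 y)) \<in> borel_measurable (lebesgue_on {c..d})"
        using L2_measurable[OF L(1)] L2_measurable[OF L1(1)] by auto
      show "cmod (G1 y * cnj (G y) + G y * cnj (G1 y)) \<le> 2 * (cmod (G y) * cmod (G1 y))" for y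
        using norm_triangle_ineq[of "G1 y * cnj (G y)" "G y * cnj (G1 y)"] by (simp add: norm_mult mult_ac)
    qed simp
    also have "\<dots> \<le> 2 * (nG * nG1)"
      using L(2) L1(2) by (intro mult_left_mono mult_mono) auto
    finally show ?thesis .
  qed
  have sq: "cmod (G x * cnj (G x)) = (cmod (G x))\<^sup>2" for x
    by (simp add: norm_mult power2_eq_square)
  show ?thesis
    using dirichlet
  proof
    assume "G a = 0"
    then show ?thesis
      using AD_D(2)[OF AD, of a y] y part[of a y] sq[of y] by simp
  next
    assume "G b = 0"
    then have "- (G y * cnj (G y)) = (LINT y|lebesgue_on {y..b}. G1 y * cnj (G y) + G y * cnj (G1 y))"
      using AD_D(2)[OF AD, of y b] y by simp
    then have "cmod (G y * cnj (G y)) = cmod (LINT y|lebesgue_on {y..b}. G1 y * cnj (G y) + G y * cnj (G1 y))"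
      by (metis norm_minus_cancel)
    then show ?thesis using part[of y b] y sq[of y] by simp
  qed
qed

lemma integral_indicator_le:
  "(LINT y|lebesgue_on {a..b}. indicat_real {p - d..p + d} y) \<le> 2 * d" if "d \<ge> 0"
proof -
  have "(LINT y|lebesgue_on {a..b}. indicat_real {p - d..p + d} y)
      \<le> (LINT y|lebesgue_on UNIV. indicat_real {p - d..p + d} y)"
    by (rule integral_mono_lebesgue_on_AE)
       (use indicator_Icc_integrable in \<open>auto simp: lebesgue_on_UNIV_eq\<close>)
  also have "\<dots> = 2 * d" using that by (simp add: lebesgue_on_UNIV_eq)
  finally show ?thesis .
qed

text \<open>Near the excluded points |G|^2 is estimated by its supremum on at most N intervals of
  length 4 \<delta>; with the factor 2 of \<open>sup_bound\<close> this gives 8 N \<delta>.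
  Elsewhere X (v - l) \<ge> \<kappa>, and the integral is controlled by
  \<open>weighted_bound\<close> with K = 12 N / \<delta>.\<close>

lemma mass_bound:
  assumes P: "finite P" "card P \<le> N" and \<delta>: "\<delta> > 0" and \<kappa>: "\<kappa> > 0"
    and far: "\<And>y. y \<in> {a..b} \<Longrightarrow> (\<forall>p\<in>P. \<delta> \<le> \<bar>y - p\<bar>) \<Longrightarrow> \<kappa> \<le> \<bar>v y - l\<bar>"
  shows "nG\<^sup>2 \<le> 8 * real N * \<delta> * (nG * nG1) + (nF * nG + \<nu> * (12 * real N / \<delta>) * (nG1 * nG)) / (\<bar>k\<bar> * \<kappa>)"
proof -
  let ?M = "lebesgue_on {a..b}"
  obtain X X' where X: "\<And>y. y \<in> {a..b} \<Longrightarrow> (X has_real_derivative X' y) (at y within {a..b})"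
    and X': "continuous_on {a..b} X'" and Xc: "continuous_on {a..b} X" and b: "\<And>y. \<bar>X y\<bar> \<le> 1"
    and b': "\<And>y. \<bar>X' y\<bar> \<le> 12 * real (card P) / \<delta>" and pos: "\<And>y. 0 \<le> X y * (v y - l)"
    and big: "\<And>y. y \<in> {a..b} \<Longrightarrow> (\<forall>p\<in>P. 2 * \<delta> \<le> \<bar>y - p\<bar>) \<Longrightarrow> \<kappa> \<le> X y * (v y - l)"
    using signed_cutoff[OF P(1) \<delta> v far \<kappa>] by blast
  have b'': "\<bar>X' y\<bar> \<le> 12 * real N / \<delta>" for y
    using b'[of y] P(2) \<delta> by (smt (verit) divide_right_mono mult_left_mono of_nat_le_iff)
  let ?I = "LINT y|?M. X y * (v y - l) * (cmod (G y))\<^sup>2"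
  let ?s = "\<lambda>y. \<Sum>p\<in>P. indicat_real {p - 2 * \<delta>..p + 2 * \<delta>} y"
  have i1: "integrable ?M (\<lambda>y. X y * (v y - l) * (cmod (G y))\<^sup>2)"
    by (intro continuous_on_integrable_lebesgue_on continuous_intros Xc v cont_G)
  have i2: "integrable ?M (indicat_real {p - d..p + d})" for p d
    by (rule integrable_lebesgue_on_mono[of UNIV])
       (use indicator_Icc_integrable in \<open>auto simp: lebesgue_on_UNIV_eq\<close>)
  have "nG\<^sup>2 = (LINT y|?M. (cmod (G y))\<^sup>2)" by (rule L2norm_sq)
  \<comment> \<open>Both summands are nonnegative everywhere, so at each point one of them alone may
    carry the estimate: the first near \<open>P\<close>, the second away from it.\<close>
  also have "\<dots> \<le> (LINT y|?M. 2 * (nG * nG1) * ?s y + X y * (v y - l) * (cmod (G y))\<^sup>2 / \<kappa>)"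
  proof (rule integral_mono[OF L2_integrable[OF G_L2]])
    show "integrable ?M (\<lambda>y. 2 * (nG * nG1) * ?s y + X y * (v y - l) * (cmod (G y))\<^sup>2 / \<kappa>)"
      using i1 i2 by (intro Bochner_Integration.integrable_add integrable_mult_right Bochner_Integration.integrable_sum integrable_divide)
    fix y assume "y \<in> space ?M"
    then have y: "y \<in> {a..b}" by simp
    have s0: "0 \<le> ?s y" by (intro sum_nonneg) simp
    have t0: "0 \<le> X y * (v y - l) * (cmod (G y))\<^sup>2 / \<kappa>" using pos[of y] \<kappa> by simp
    show "(cmod (G y))\<^sup>2 \<le> 2 * (nG * nG1) * ?s y + X y * (v y - l) * (cmod (G y))\<^sup>2 / \<kappa>"
    proof (cases "\<forall>p\<in>P. 2 * \<delta> \<le> \<bar>y - p\<bar>")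
      case True
      have "\<kappa> * (cmod (G y))\<^sup>2 \<le> X y * (v y - l) * (cmod (G y))\<^sup>2"
        by (rule mult_right_mono[OF big[OF y True]]) simp
      then have "(cmod (G y))\<^sup>2 \<le> X y * (v y - l) * (cmod (G y))\<^sup>2 / \<kappa>"
        using \<kappa> by (simp add: field_simps)
      moreover have "0 \<le> 2 * (nG * nG1) * ?s y" using s0 by simp
      ultimately show ?thesis by linarith
    next
      case False
      then obtain p where p: "p \<in> P" "\<bar>y - p\<bar> < 2 * \<delta>" by auto
      have "1 = indicat_real {p - 2 * \<delta>..p + 2 * \<delta>} y" using p(2) by (auto simp: indicator_def abs_if split: if_splits)
      also have "\<dots> \<le> ?s y" using P(1) p(1) by (intro member_le_sum) auto
      finally have "2 * (nG * nG1) * 1 \<le> 2 * (nG * nG1) * ?s y" by (intro mult_left_mono) auto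
      then show ?thesis using sup_bound[OF y] t0 by linarith
    qed
  qed
  also have "\<dots> = 2 * (nG * nG1) * (\<Sum>p\<in>P. LINT y|?M. indicat_real {p - 2 * \<delta>..p + 2 * \<delta>} y) + ?I / \<kappa>"
    using i1 i2 by (simp add: Bochner_Integration.integral_sum)
  also have "\<dots> \<le> 2 * (nG * nG1) * (real N * (4 * \<delta>)) + ?I / \<kappa>"
  proof -
    have "(\<Sum>p\<in>P. LINT y|?M. indicat_real {p - 2 * \<delta>..p + 2 * \<delta>} y) \<le> (\<Sum>p\<in>P. 2 * (2 * \<delta>))"
      using \<delta> by (intro sum_mono integral_indicator_le) simp
    also have "\<dots> = real (card P) * (4 * \<delta>)" by simp
    also have "\<dots> \<le> real N * (4 * \<delta>)" using P(2) \<delta> by (intro mult_right_mono) auto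
    finally show ?thesis by (intro add_right_mono mult_left_mono) auto
  qed
  also have "?I / \<kappa> \<le> (nF * nG + \<nu> * (12 * real N / \<delta>) * (nG1 * nG)) / (\<bar>k\<bar> * \<kappa>)"
  proof -
    have "\<bar>k\<bar> * ?I \<le> \<bar>k\<bar> * \<bar>?I\<bar>" by (intro mult_left_mono) auto
    also have "\<dots> \<le> nF * nG + \<nu> * (12 * real N / \<delta>) * (nG1 * nG)"
      by (rule weighted_bound[OF X X' b b''])
    finally have "?I \<le> (nF * nG + \<nu> * (12 * real N / \<delta>) * (nG1 * nG)) / \<bar>k\<bar>"
      using k by (simp add: field_simps)
    then have "?I / \<kappa> \<le> (nF * nG + \<nu> * (12 * real N / \<delta>) * (nG1 * nG)) / \<bar>k\<bar> / \<kappa>"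
      using \<kappa> by (intro divide_right_mono) auto
    then show ?thesis by simp
  qed
  finally show ?thesis by (simp add: mult_ac)
qed

end

section \<open>Scaling of the rate, and a linear initial value problem\<close>

text \<open>The algebra of the energy estimates; n, e, f stand for the norms of G, G1 and F. With f
  = t^2 \<mu> n, the gradient bound and the scaling hypotheses give \<delta> e \<le> t n and \<nu> e
  \<le> \<delta> D t n for D = k \<delta>^m, so every term on the right of \<open>mass\<close>
  carries a factor t. If f were smaller than claimed, then B t < 1 and \<open>mass\<close> would
  yield n^2 < n^2.\<close>

lemma resolvent_inequality:
  fixes n e f \<nu> k \<mu> \<delta> c :: real and N m :: nat
  assumes nn: "n \<ge> 0" "e \<ge> 0" "f \<ge> 0"
    and pos: "\<nu> > 0" "k > 0" "\<mu> > 0" "\<delta> > 0" "c > 0"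
    and sc: "\<delta>\<^sup>2 * \<mu> \<le> \<nu>" "\<mu> \<le> k * \<delta> ^ m" "\<nu> * \<mu> \<le> (\<delta> * (k * \<delta> ^ m))\<^sup>2"
    and grad: "\<nu> * e\<^sup>2 \<le> f * n"
    and mass: "n\<^sup>2 \<le> 8 * real N * \<delta> * (n * e) + (f * n + \<nu> * (12 * real N / \<delta>) * (e * n)) / (k * (c * \<delta> ^ m))"
  shows "min 1 (1 / (8 * real N + 1 / c + 12 * real N / c)\<^sup>2) * \<mu> * n \<le> f"
proof (rule ccontr)
  define B where "B = 8 * real N + 1 / c + 12 * real N / c"
  define D where "D = k * \<delta> ^ m"
  have B: "B > 0" unfolding B_def using pos(5) by (simp add: add_nonneg_pos add_pos_nonneg)
  have D: "D > 0" using pos by (simp add: D_def)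
  assume "\<not> ?thesis"
  then have lt: "f < min 1 (1 / B\<^sup>2) * \<mu> * n" by (simp add: B_def)
  have n: "n > 0"
  proof (rule ccontr)
    assume "\<not> n > 0"
    then have "n = 0" using nn by simp
    then show False using lt nn by simp
  qed
  \<comment> \<open>\<open>t\<close> measures f in units of \<mu> n; the square root is taken
    because the bound on \<open>e\<close> scales like the square root of \<open>f\<close>.\<close>
  define t where "t = sqrt (f / (\<mu> * n))"
  have ft: "f = t\<^sup>2 * \<mu> * n" using n pos nn by (simp add: t_def)
  have t0: "t \<ge> 0" using nn n pos by (simp add: t_def)
  have t2: "t\<^sup>2 < min 1 (1 / B\<^sup>2)"
    using lt n pos unfolding ft by (simp add: mult.assoc)
  \<comment> \<open>This lets t^2 be replaced by t later, so that all error terms are linear in t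
    and B collects their coefficients.\<close>
  have t1: "t < 1" using t2 power_less_imp_less_base[of t 2 1] by simp
  have tB: "B * t < 1"
  proof (rule power_less_imp_less_base[of _ 2])
    show "(B * t)\<^sup>2 < 1\<^sup>2" using t2 B by (simp add: power_mult_distrib field_simps)
  qed simp
  have e1: "\<delta> * e \<le> t * n"
  proof (rule power2_le_imp_le)
    have "\<nu> * (\<delta> * e)\<^sup>2 = \<delta>\<^sup>2 * (\<nu> * e\<^sup>2)" by (simp add: power_mult_distrib)
    also have "\<dots> \<le> \<delta>\<^sup>2 * (f * n)" by (intro mult_left_mono grad) simp
    also have "\<dots> = (\<delta>\<^sup>2 * \<mu>) * (t * n)\<^sup>2" unfolding ft by (simp add: power2_eq_square)
    also have "\<dots> \<le> \<nu> * (t * n)\<^sup>2" by (intro mult_right_mono sc) simp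
    finally show "(\<delta> * e)\<^sup>2 \<le> (t * n)\<^sup>2" using pos(1) by simp
  qed (use t0 n in simp)
  have e2: "\<nu> * e \<le> \<delta> * D * (t * n)"
  proof (rule power2_le_imp_le)
    have "(\<nu> * e)\<^sup>2 = \<nu> * (\<nu> * e\<^sup>2)" by (simp add: power2_eq_square)
    also have "\<dots> \<le> \<nu> * (f * n)" using pos(1) by (intro mult_left_mono grad) simp
    also have "\<dots> = (\<nu> * \<mu>) * (t * n)\<^sup>2" unfolding ft by (simp add: power2_eq_square)
    also have "\<dots> \<le> (\<delta> * D)\<^sup>2 * (t * n)\<^sup>2" unfolding D_def by (intro mult_right_mono sc) simp
    finally show "(\<nu> * e)\<^sup>2 \<le> (\<delta> * D * (t * n))\<^sup>2" by (simp add: power_mult_distrib)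
  qed (use t0 n D pos in simp)
  have "f * n \<le> t\<^sup>2 * D * n\<^sup>2"
  proof -
    have "t\<^sup>2 * \<mu> * n\<^sup>2 \<le> t\<^sup>2 * D * n\<^sup>2"
      unfolding D_def using sc(2) by (intro mult_right_mono mult_left_mono) auto
    then show ?thesis unfolding ft by (simp add: power2_eq_square)
  qed
  moreover have "\<nu> * (12 * real N / \<delta>) * (e * n) \<le> 12 * real N * D * t * n\<^sup>2"
  proof -
    have "(12 * real N / \<delta> * n) * (\<nu> * e) \<le> (12 * real N / \<delta> * n) * (\<delta> * D * (t * n))"
      using n pos by (intro mult_left_mono e2) auto
    then show ?thesis using pos(4) by (simp add: power2_eq_square mult_ac)
  qed
  ultimately have "f * n + \<nu> * (12 * real N / \<delta>) * (e * n) \<le> (t\<^sup>2 + 12 * real N * t) * D * n\<^sup>2"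
    by (simp add: algebra_simps)
  then have "(f * n + \<nu> * (12 * real N / \<delta>) * (e * n)) / (c * D) \<le> (t\<^sup>2 + 12 * real N * t) * D * n\<^sup>2 / (c * D)"
    using pos(5) D by (intro divide_right_mono) auto
  also have "\<dots> = (t\<^sup>2 + 12 * real N * t) / c * n\<^sup>2" using D by simp
  finally have m2: "(f * n + \<nu> * (12 * real N / \<delta>) * (e * n)) / (k * (c * \<delta> ^ m)) \<le> (t\<^sup>2 + 12 * real N * t) / c * n\<^sup>2"
    by (simp add: D_def mult_ac)
  have "8 * real N * n * (\<delta> * e) \<le> 8 * real N * n * (t * n)" using n by (intro mult_left_mono e1) auto
  then have m1: "8 * real N * \<delta> * (n * e) \<le> 8 * real N * t * n\<^sup>2" by (simp add: power2_eq_square mult_ac)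
  have "t\<^sup>2 \<le> t" using t0 t1 by (simp add: power2_eq_square mult_left_le)
  then have "(t\<^sup>2 + 12 * real N * t) / c \<le> (t + 12 * real N * t) / c" using pos(5) by (intro divide_right_mono) auto
  then have "(t\<^sup>2 + 12 * real N * t) / c * n\<^sup>2 \<le> (t + 12 * real N * t) / c * n\<^sup>2" by (intro mult_right_mono) auto
  with m1 m2 mass have "n\<^sup>2 \<le> 8 * real N * t * n\<^sup>2 + (t + 12 * real N * t) / c * n\<^sup>2" by linarith
  also have "\<dots> = (B * t) * n\<^sup>2" by (simp add: B_def field_simps add_divide_distrib)
  also have "\<dots> < 1 * n\<^sup>2" using tB n by (intro mult_strict_right_mono) auto
  finally show False by simp
qed

text \<open>The three scaling hypotheses of \<open>resolvent_inequality\<close>. For \<nu> \<le> |k|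
  the choice \<delta>^(m+2) = \<nu>/|k| turns all of them into equalities. Otherwise that \<delta>
  would exceed 1; with \<delta> = 1 the third is an equality and the other two follow from |k| <
  \<nu>.\<close>

lemma rate_scale:
  assumes "\<nu> > 0" "k \<noteq> 0" "m \<ge> 1"
  obtains \<delta> where "0 < \<delta>" "\<delta> \<le> 1" "rate m \<nu> k > 0" "\<delta>\<^sup>2 * rate m \<nu> k \<le> \<nu>"
    "rate m \<nu> k \<le> \<bar>k\<bar> * \<delta> ^ m" "\<nu> * rate m \<nu> k \<le> (\<delta> * (\<bar>k\<bar> * \<delta> ^ m))\<^sup>2"
proof (cases "\<nu> \<le> \<bar>k\<bar>")
  case True
  let ?K = "\<bar>k\<bar>"
  have K: "?K > 0" using assms(2) by simp
  define \<delta> where "\<delta> = (\<nu> / ?K) powr (1 / (real m + 2))"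
  have \<delta>: "\<delta> > 0" using assms K by (simp add: \<delta>_def)
  have \<delta>1: "\<delta> \<le> 1" unfolding \<delta>_def using True assms K by (intro powr_le1) auto
  have p: "\<delta> ^ j = (\<nu> / ?K) powr (real j / (real m + 2))" for j
    using \<delta> by (simp add: powr_realpow[symmetric] \<delta>_def powr_powr)
  have "\<delta> ^ (m + 2) = \<nu> / ?K" unfolding p using assms K by (simp add: add_ac)
  then have d2: "?K * \<delta> ^ m * \<delta>\<^sup>2 = \<nu>" using K by (simp add: power_add power2_eq_square field_simps)
  have r: "rate m \<nu> k = ?K * \<delta> ^ m"
  proof -
    have "?K * \<delta> ^ m = \<nu> powr (real m / (real m + 2)) * (?K powr 1 / ?K powr (real m / (real m + 2)))"
      unfolding p using assms K by (simp add: powr_divide)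
    also have "?K powr 1 / ?K powr (real m / (real m + 2)) = ?K powr (1 - real m / (real m + 2))"
      by (rule powr_diff[symmetric])
    also have "1 - real m / (real m + 2) = 2 / (real m + 2)" by (simp add: field_simps)
    finally show ?thesis using True by (simp add: rate_def)
  qed
  show thesis
  proof (rule that[OF \<delta> \<delta>1])
    show "rate m \<nu> k > 0" using r \<delta> K by simp
    show "\<delta>\<^sup>2 * rate m \<nu> k \<le> \<nu>" using d2 r by (simp add: mult_ac)
    show "rate m \<nu> k \<le> ?K * \<delta> ^ m" using r by simp
    have "\<nu> * rate m \<nu> k = (?K * \<delta> ^ m * \<delta>\<^sup>2) * (?K * \<delta> ^ m)" using d2 r by simp
    also have "\<dots> = (\<delta> * (?K * \<delta> ^ m))\<^sup>2" by (simp add: power2_eq_square)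
    finally show "\<nu> * rate m \<nu> k \<le> (\<delta> * (?K * \<delta> ^ m))\<^sup>2" by simp
  qed
next
  case False
  then have r: "rate m \<nu> k = k\<^sup>2 / \<nu>" by (simp add: rate_def)
  have k2: "k\<^sup>2 = \<bar>k\<bar> * \<bar>k\<bar>" by (simp add: power2_eq_square)
  show thesis
  proof (rule that[of 1])
    show "rate m \<nu> k > 0" using r assms by simp
    have "\<bar>k\<bar> * \<bar>k\<bar> \<le> \<nu> * \<nu>" using False by (intro mult_mono) auto
    then show "1\<^sup>2 * rate m \<nu> k \<le> \<nu>" using assms unfolding r k2 by (simp add: field_simps)
    have "\<bar>k\<bar> * \<bar>k\<bar> \<le> \<bar>k\<bar> * \<nu>" using False by (intro mult_left_mono) auto
    then show "rate m \<nu> k \<le> \<bar>k\<bar> * 1 ^ m" using assms unfolding r k2 by (simp add: field_simps)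
    show "\<nu> * rate m \<nu> k \<le> (1 * (\<bar>k\<bar> * 1 ^ m))\<^sup>2" using assms unfolding r by simp
  qed auto
qed

section \<open>Second-order linear initial value problems by a Volterra series\<close>

lemma integral_lebesgue_on_norm_le:
  fixes f :: "real \<Rightarrow> complex"
  assumes "continuous_on {a..y} f" "continuous_on {a..y} g" "\<And>t. t \<in> {a..y} \<Longrightarrow> cmod (f t) \<le> g t"
  shows "cmod (LINT t|lebesgue_on {a..y}. f t) \<le> (LINT t|lebesgue_on {a..y}. g t)"
proof -
  have "cmod (LINT t|lebesgue_on {a..y}. f t) \<le> (LINT t|lebesgue_on {a..y}. cmod (f t))"
    by (rule integral_norm_bound)
  also have "\<dots> \<le> (LINT t|lebesgue_on {a..y}. g t)"
    using assms by (intro integral_mono continuous_on_integrable_lebesgue_on continuous_intros) auto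
  finally show ?thesis .
qed

lemma integral_shifted_power:
  fixes a y :: real
  assumes "a \<le> y"
  shows "(LINT t|lebesgue_on {a..y}. (t - a) ^ n / fact n) = (y - a) ^ Suc n / fact (Suc n)"
proof -
  have "((\<lambda>t. (t - a) ^ n / fact n) has_integral (y - a) ^ Suc n / fact (Suc n) - (a - a) ^ Suc n / fact (Suc n)) {a..y}"
  proof (rule fundamental_theorem_of_calculus[OF assms])
    fix t assume "t \<in> {a..y}"
    have "((\<lambda>t. t - a) has_real_derivative 1) (at t within {a..y})"
      by (auto intro!: derivative_eq_intros)
    from DERIV_cdivide[OF DERIV_power[OF this, of "Suc n"], of "fact (Suc n)"]
    have "((\<lambda>t. (t - a) ^ Suc n / fact (Suc n)) has_real_derivative (real (Suc n) * (t - a) ^ n) / fact (Suc n)) (at t within {a..y})"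
      by (simp del: fact_Suc power_Suc of_nat_Suc)
    also have "(real (Suc n) * (t - a) ^ n) / fact (Suc n) = (t - a) ^ n / fact n"
      by (simp add: field_simps del: of_nat_Suc)
    finally show "((\<lambda>t. (t - a) ^ Suc n / fact (Suc n)) has_vector_derivative (t - a) ^ n / fact n) (at t within {a..y})"
      by (simp only: has_real_derivative_iff_has_vector_derivative)
  qed
  then have h: "((\<lambda>t. (t - a) ^ n / fact n) has_integral (y - a) ^ Suc n / fact (Suc n)) {a..y}"
    by simp
  have i: "integrable (lebesgue_on {a..y}) (\<lambda>t. (t - a) ^ n / fact n)"
    by (intro continuous_on_integrable_lebesgue_on continuous_intros) simp
  have "(LINT t|lebesgue_on {a..y}. (t - a) ^ n / fact n) = integral {a..y} (\<lambda>t. (t - a) ^ n / fact n)"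
    by (rule lebesgue_integral_eq_integral[OF i]) simp
  also have "\<dots> = (y - a) ^ Suc n / fact (Suc n)"
    by (rule integral_unique[OF h])
  finally show ?thesis .
qed

lemma continuous_on_indefinite:
  fixes f :: "real \<Rightarrow> complex"
  assumes "integrable (lebesgue_on {a..b}) f"
  shows "continuous_on {a..b} (\<lambda>y. LINT t|lebesgue_on {a..y}. f t)"
  using AD_continuous[OF AD_indefinite[OF assms, of 0]] by (simp add: is_interval_cc)

text \<open>Twofold integration from \<open>a\<close>: the problem u'' = q u + h with initial data
  becomes u = F + \<open>volterra a q u\<close>, where F gathers the data and h, and no derivative
  of u appears.\<close>

definition volterra :: "real \<Rightarrow> (real \<Rightarrow> complex) \<Rightarrow> (real \<Rightarrow> complex) \<Rightarrow> real \<Rightarrow> complex" where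
  "volterra a q u y = (LINT t|lebesgue_on {a..y}. LINT s|lebesgue_on {a..t}. q s * u s)"

lemma volterra_continuous:
  assumes "continuous_on {a..b} q" "continuous_on {a..b} u"
  shows "continuous_on {a..b} (\<lambda>t. LINT s|lebesgue_on {a..t}. q s * u s)" "continuous_on {a..b} (volterra a q u)"
proof -
  show c: "continuous_on {a..b} (\<lambda>t. LINT s|lebesgue_on {a..t}. q s * u s)"
    by (intro continuous_on_indefinite continuous_on_integrable_lebesgue_on continuous_intros assms)
  show "continuous_on {a..b} (volterra a q u)"
    unfolding volterra_def[abs_def]
    by (intro continuous_on_indefinite continuous_on_integrable_lebesgue_on c)
qed

text \<open>Each application raises the factorial power by one, as in the exponential series. The
  inner integral is estimated crudely by its length times the largest bound on the integrand, which
  trades a second power for a factor b - a.\<close>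

lemma volterra_bound:
  assumes q: "continuous_on {a..b} q" "\<And>s. s \<in> {a..b} \<Longrightarrow> cmod (q s) \<le> Q"
    and u: "continuous_on {a..b} u" "\<And>s. s \<in> {a..b} \<Longrightarrow> cmod (u s) \<le> A * ((s - a) ^ n / fact n)"
    and y: "y \<in> {a..b}" and A: "A \<ge> 0"
  shows "cmod (volterra a q u y) \<le> (Q * (b - a) * A) * ((y - a) ^ Suc n / fact (Suc n))"
proof -
  have ay: "a \<le> y" "y \<le> b" using y by auto
  have Q: "Q \<ge> 0" using q(2)[OF y] norm_ge_zero order_trans by blast
  have inner: "cmod (LINT s|lebesgue_on {a..t}. q s * u s) \<le> (Q * (b - a) * A) * ((t - a) ^ n / fact n)"
    if t: "t \<in> {a..y}" for t
  proof -
    have sub: "{a..t} \<subseteq> {a..b}" using t ay by auto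
    have "cmod (LINT s|lebesgue_on {a..t}. q s * u s) \<le> (LINT s|lebesgue_on {a..t}. Q * (A * ((t - a) ^ n / fact n)))"
    proof (rule integral_lebesgue_on_norm_le)
      show "continuous_on {a..t} (\<lambda>s. q s * u s)"
        by (intro continuous_intros continuous_on_subset[OF q(1) sub] continuous_on_subset[OF u(1) sub])
      fix s assume s: "s \<in> {a..t}"
      have "cmod (u s) \<le> A * ((s - a) ^ n / fact n)" using u(2) s sub by blast
      also have "\<dots> \<le> A * ((t - a) ^ n / fact n)"
        using s A by (intro mult_left_mono divide_right_mono power_mono) auto
      finally show "cmod (q s * u s) \<le> Q * (A * ((t - a) ^ n / fact n))"
        unfolding norm_mult using q(2)[of s] s sub Q by (intro mult_mono) auto
    qed auto
    also have "\<dots> = (t - a) * (Q * (A * ((t - a) ^ n / fact n)))"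
      using t by (simp add: measure_restrict_space)
    also have "\<dots> \<le> (b - a) * (Q * (A * ((t - a) ^ n / fact n)))"
      using t ay A Q by (intro mult_right_mono) auto
    finally show ?thesis by (simp add: mult_ac)
  qed
  have sub: "{a..y} \<subseteq> {a..b}" using ay by auto
  have "cmod (volterra a q u y) \<le> (LINT t|lebesgue_on {a..y}. (Q * (b - a) * A) * ((t - a) ^ n / fact n))"
    unfolding volterra_def
    by (rule integral_lebesgue_on_norm_le[OF continuous_on_subset[OF volterra_continuous(1)[OF q(1) u(1)] sub] _ inner])
       (auto intro!: continuous_intros)
  also have "\<dots> = (Q * (b - a) * A) * ((y - a) ^ Suc n / fact (Suc n))"
    using integral_shifted_power[OF ay(1), of n] by (simp only: integral_mult_right_zero)
  finally show ?thesis .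
qed

lemma volterra_add:
  assumes "continuous_on {a..b} q" "continuous_on {a..b} u" "continuous_on {a..b} w" "y \<in> {a..b}"
  shows "volterra a q (\<lambda>s. u s + w s) y = volterra a q u y + volterra a q w y"
proof -
  have sub: "{a..t} \<subseteq> {a..b}" if "t \<in> {a..y}" for t using that assms(4) by auto
  have i: "integrable (lebesgue_on {a..t}) (\<lambda>s. q s * x s)" if "t \<in> {a..y}" "continuous_on {a..b} x" for t x
    by (intro continuous_on_integrable_lebesgue_on continuous_intros
        continuous_on_subset[OF assms(1) sub[OF that(1)]] continuous_on_subset[OF that(2) sub[OF that(1)]])
  have o: "integrable (lebesgue_on {a..y}) (\<lambda>t. LINT s|lebesgue_on {a..t}. q s * x s)" if "continuous_on {a..b} x" for x
    by (intro continuous_on_integrable_lebesgue_on continuous_on_subset[OF volterra_continuous(1)[OF assms(1) that]])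
       (use assms(4) in auto)
  have "volterra a q (\<lambda>s. u s + w s) y
     = (LINT t|lebesgue_on {a..y}. (LINT s|lebesgue_on {a..t}. q s * u s) + (LINT s|lebesgue_on {a..t}. q s * w s))"
    unfolding volterra_def
    by (rule Bochner_Integration.integral_cong[OF refl])
       (simp add: distrib_left i assms)
  also have "\<dots> = volterra a q u y + volterra a q w y"
    unfolding volterra_def by (rule Bochner_Integration.integral_add[OF o[OF assms(2)] o[OF assms(3)]])
  finally show ?thesis .
qed

text \<open>The Neumann series of the Volterra operator; the factorial bounds make it converge
  uniformly on the whole interval, however large \<open>q\<close> and the interval are.\<close>

lemma volterra_equation:
  assumes ab: "a \<le> b" and q: "continuous_on {a..b} q" and F: "continuous_on {a..b} F"
  obtains G where "continuous_on {a..b} G" "\<And>y. y \<in> {a..b} \<Longrightarrow> G y = F y + volterra a q G y"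
proof -
  obtain Q where Q: "Q \<ge> 0" "\<And>s. s \<in> {a..b} \<Longrightarrow> cmod (q s) \<le> Q"
    using continuous_on_Icc_norm_bounded[OF q] by blast
  obtain A where A: "A \<ge> 0" "\<And>s. s \<in> {a..b} \<Longrightarrow> cmod (F s) \<le> A"
    using continuous_on_Icc_norm_bounded[OF F] by blast
  define u where "u n = (volterra a q ^^ n) F" for n
  have u0: "u 0 = F" and uS: "u (Suc n) = volterra a q (u n)" for n by (simp_all add: u_def)
  define R where "R = Q * (b - a)"
  have R: "R \<ge> 0" using Q(1) ab by (simp add: R_def)
  have u: "continuous_on {a..b} (u n) \<and> (\<forall>y\<in>{a..b}. cmod (u n y) \<le> (R ^ n * A) * ((y - a) ^ n / fact n))" for n
  proof (induction n)
    case 0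
    then show ?case using F A by (simp add: u0)
  next
    case (Suc n)
    then have c: "continuous_on {a..b} (u n)"
      and b: "\<And>y. y \<in> {a..b} \<Longrightarrow> cmod (u n y) \<le> (R ^ n * A) * ((y - a) ^ n / fact n)" by auto
    show ?case
      unfolding uS
      using volterra_continuous(2)[OF q c] volterra_bound[OF q Q(2) c b] R A(1)
      by (simp add: R_def mult_ac del: fact_Suc)
  qed
  define M where "M n = A * ((R * (b - a)) ^ n / fact n)" for n
  have uM: "norm (u n y) \<le> M n" if y: "y \<in> {a..b}" for n y
  proof -
    have "cmod (u n y) \<le> (R ^ n * A) * ((y - a) ^ n / fact n)" using u y by blast
    also have "\<dots> \<le> (R ^ n * A) * ((b - a) ^ n / fact n)"
      using y R A(1) by (intro mult_left_mono divide_right_mono power_mono) auto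
    finally show ?thesis by (simp add: M_def power_mult_distrib mult_ac)
  qed
  have "summable (\<lambda>n. (R * (b - a)) ^ n / fact n)"
    using summable_exp[of "R * (b - a)"] by (simp add: divide_inverse mult.commute)
  then have sM: "summable M" unfolding M_def by (rule summable_mult)
  define G where "G y = (\<Sum>n. u n y)" for y
  define S where "S n y = (\<Sum>i<n. u i y)" for n y
  have ul: "uniform_limit {a..b} S G sequentially"
    unfolding S_def[abs_def] G_def[abs_def] by (rule Weierstrass_m_test[OF uM sM])
  have Sc: "continuous_on {a..b} (S n)" for n
    unfolding S_def[abs_def] by (intro continuous_on_sum) (use u in auto)
  have Gc: "continuous_on {a..b} G"
    by (rule uniform_limit_theorem[OF _ ul]) (auto intro: always_eventually Sc)
  have rec: "S (Suc n) y = F y + volterra a q (S n) y" if y: "y \<in> {a..b}" for n y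
  proof (induction n)
    case 0
    then show ?case by (simp add: S_def u0 volterra_def)
  next
    case (Suc n)
    have "S (Suc n) = (\<lambda>s. S n s + u n s)" by (simp add: S_def fun_eq_iff)
    then have "volterra a q (S (Suc n)) y = volterra a q (\<lambda>s. S n s + u n s) y" by (simp only:)
    also have "\<dots> = volterra a q (S n) y + u (Suc n) y"
      unfolding uS by (rule volterra_add[OF q Sc _ y]) (use u in auto)
    finally have "volterra a q (S (Suc n)) y = volterra a q (S n) y + u (Suc n) y" .
    moreover have "S (Suc (Suc n)) y = S (Suc n) y + u (Suc n) y" by (simp add: S_def)
    ultimately show ?case using Suc by simp
  qed
  have "G y = F y + volterra a q G y" if y: "y \<in> {a..b}" for y
  proof (rule LIMSEQ_unique)
    have "(\<lambda>n. S n y) \<longlonglongrightarrow> G y" using tendsto_uniform_limitI[OF ul y] .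
    then show "(\<lambda>n. S (Suc n) y) \<longlonglongrightarrow> G y" by (rule LIMSEQ_Suc)
    have "(\<lambda>n. volterra a q (S n) y) \<longlonglongrightarrow> volterra a q G y"
    proof (rule LIMSEQ_I)
      fix \<epsilon> :: real assume \<epsilon>: "\<epsilon> > 0"
      \<comment> \<open>In the supremum norm the operator is bounded by Q (b - a)^2, the case n = 0
        of \<open>volterra_bound\<close>; the summand 1 makes \<open>W\<close> positive and the
        final inequality strict.\<close>
      define W where "W = Q * (b - a) * (b - a) + 1"
      have W: "W > 0" unfolding W_def using Q(1) ab by (simp add: add_nonneg_pos)
      have "\<forall>\<^sub>F n in sequentially. \<forall>s\<in>{a..b}. dist (S n s) (G s) < \<epsilon> / W"
        using ul \<epsilon> W by (auto simp: uniform_limit_iff)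
      then obtain N where N: "\<And>n s. n \<ge> N \<Longrightarrow> s \<in> {a..b} \<Longrightarrow> cmod (S n s - G s) < \<epsilon> / W"
        unfolding eventually_sequentially dist_norm by blast
      have "norm (volterra a q (S n) y - volterra a q G y) < \<epsilon>" if n: "n \<ge> N" for n
      proof -
        have c: "continuous_on {a..b} (\<lambda>s. S n s - G s)" by (intro continuous_intros Sc Gc)
        have "volterra a q (\<lambda>s. (S n s - G s) + G s) y = volterra a q (\<lambda>s. S n s - G s) y + volterra a q G y"
          by (rule volterra_add[OF q c Gc y])
        then have eq: "volterra a q (S n) y - volterra a q G y = volterra a q (\<lambda>s. S n s - G s) y" by simp
        have "cmod (volterra a q (\<lambda>s. S n s - G s) y) \<le> (Q * (b - a) * (\<epsilon> / W)) * ((y - a) ^ Suc 0 / fact (Suc 0))"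
          by (rule volterra_bound[OF q Q(2) c _ y]) (use N[OF n] \<epsilon> W in \<open>auto intro: less_imp_le\<close>)
        also have "\<dots> \<le> (Q * (b - a) * (\<epsilon> / W)) * (b - a)"
          using y Q(1) \<epsilon> W by (intro mult_left_mono) auto
        also have "\<dots> = (W - 1) * (\<epsilon> / W)" by (simp add: W_def)
        also have "\<dots> < W * (\<epsilon> / W)" using \<epsilon> W by (intro mult_strict_right_mono) auto
        also have "\<dots> = \<epsilon>" using W by simp
        finally show ?thesis unfolding eq .
      qed
      then show "\<exists>no. \<forall>n\<ge>no. norm (volterra a q (S n) y - volterra a q G y) < \<epsilon>" by blast
    qed
    then have "(\<lambda>n. F y + volterra a q (S n) y) \<longlonglongrightarrow> F y + volterra a q G y"
      by (intro tendsto_intros)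
    then show "(\<lambda>n. S (Suc n) y) \<longlonglongrightarrow> F y + volterra a q G y" by (simp add: rec[OF y])
  qed
  with Gc show thesis by (rule that)
qed

text \<open>The inhomogeneity and the initial data go into the free term of a Volterra equation.
  Since \<open>h\<close> is merely integrable, the equation is solved in the sense of
  \<open>AD\<close>, with \<open>G1\<close> absolutely continuous.\<close>

lemma linear_ivp:
  assumes ab: "a \<le> b" and q: "continuous_on {a..b} q" and h: "integrable (lebesgue_on {a..b}) h"
  obtains G G1 where "AD {a..b} G1 G" "AD {a..b} (\<lambda>y. q y * G y + h y) G1" "G a = \<alpha>" "G1 a = \<beta>"
proof -
  have null: "(LINT t|lebesgue_on {a..a}. f t) = 0" for f :: "real \<Rightarrow> complex"
    by (rule integral_eq_zero_null_sets) simp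
  define H where "H t = \<beta> + (LINT s|lebesgue_on {a..t}. h s)" for t
  have Hc: "continuous_on {a..b} H"
    unfolding H_def by (intro continuous_intros continuous_on_indefinite h)
  define F where "F y = \<alpha> + (LINT t|lebesgue_on {a..y}. H t)" for y
  have Fc: "continuous_on {a..b} F"
    unfolding F_def by (intro continuous_intros continuous_on_indefinite continuous_on_integrable_lebesgue_on Hc)
  obtain G where Gc: "continuous_on {a..b} G" and G: "\<And>y. y \<in> {a..b} \<Longrightarrow> G y = F y + volterra a q G y"
    using volterra_equation[OF ab q Fc] by blast
  have qG: "integrable (lebesgue_on {a..b}) (\<lambda>s. q s * G s)"
    by (intro continuous_on_integrable_lebesgue_on continuous_intros q Gc)
  \<comment> \<open>\<open>G1\<close> is defined from the differential equation; that it is the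
    derivative of \<open>G\<close> is then read off from the Volterra equation.\<close>
  define G1 where "G1 t = \<beta> + (LINT s|lebesgue_on {a..t}. q s * G s + h s)" for t
  have AD1: "AD {a..b} (\<lambda>y. q y * G y + h y) G1"
    unfolding G1_def by (rule AD_indefinite) (use qG h in simp)
  have G1c: "continuous_on {a..b} G1" by (rule AD_continuous[OF AD1 is_interval_cc])
  have "AD {a..b} G1 (\<lambda>y. \<alpha> + (LINT t|lebesgue_on {a..y}. G1 t))"
    by (intro AD_indefinite continuous_on_integrable_lebesgue_on G1c)
  then have AD0: "AD {a..b} G1 G"
  proof (rule AD_cong)
    fix y assume y: "y \<in> {a..b}"
    have sub: "{a..y} \<subseteq> {a..b}" using y by auto
    have "(LINT t|lebesgue_on {a..y}. G1 t) = (LINT t|lebesgue_on {a..y}. H t + (LINT s|lebesgue_on {a..t}. q s * G s))"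
    proof (rule Bochner_Integration.integral_cong[OF refl])
      fix t assume "t \<in> space (lebesgue_on {a..y})"
      then have "{a..t} \<subseteq> {a..b}" using y by auto
      then have "integrable (lebesgue_on {a..t}) (\<lambda>s. q s * G s)" "integrable (lebesgue_on {a..t}) h"
        using qG h by (auto intro: integrable_lebesgue_on_mono)
      then show "G1 t = H t + (LINT s|lebesgue_on {a..t}. q s * G s)" by (simp add: G1_def H_def)
    qed
    also have "\<dots> = (LINT t|lebesgue_on {a..y}. H t) + volterra a q G y"
      unfolding volterra_def
      by (intro Bochner_Integration.integral_add continuous_on_integrable_lebesgue_on
          continuous_on_subset[OF Hc sub] continuous_on_subset[OF volterra_continuous(1)[OF q Gc] sub])
    finally show "\<alpha> + (LINT t|lebesgue_on {a..y}. G1 t) = G y" using G[OF y] by (simp add: F_def)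
  qed (auto simp: is_interval_cc)
  have "G a = \<alpha>" using G[of a] ab null by (simp add: F_def volterra_def)
  moreover have "G1 a = \<beta>" using null by (simp add: G1_def)
  ultimately show thesis using that AD0 AD1 by blast
qed

section \<open>Boundary value problem and cutoffs at infinity\<close>

text \<open>The constant is built from \<open>c\<close> and \<open>N\<close> of the nondegeneracy of
  \<open>S\<close> alone. Neither the interval nor the level \<open>l\<close> enters, which is what
  makes the passage to \<Omega> possible.\<close>

lemma interval_solution_resolvent_bound:
  assumes und: "uniformly_nondegenerate m v S" and m: "m \<ge> 1"
  obtains C where "C > 0"
    "\<And>\<nu> k l a b G G1 G2. {a..b} \<subseteq> S \<Longrightarrow> interval_solution a b \<nu> k v G G1 G2 \<Longrightarrow>
      C * rate m \<nu> k * L2norm {a..b} G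
        \<le> L2norm {a..b} (\<lambda>y. - of_real \<nu> * G2 y + \<i> * of_real (k * (v y - l)) * G y)"
proof -
  obtain c N where c: "c > 0" and S: "\<And>l \<delta>. 0 < \<delta> \<Longrightarrow> \<delta> \<le> 1 \<Longrightarrow>
     \<exists>P. finite P \<and> card P \<le> N \<and> (\<forall>y\<in>S. (\<forall>p\<in>P. \<delta> \<le> \<bar>y - p\<bar>) \<longrightarrow> c * \<delta> ^ m \<le> \<bar>v y - l\<bar>)"
    using und unfolding uniformly_nondegenerate_def by blast
  let ?B = "8 * real N + 1 / c + 12 * real N / c"
  have B: "?B > 0" using c by (simp add: add_nonneg_pos add_pos_nonneg)
  show thesis
  proof (rule that[of "min 1 (1 / ?B\<^sup>2)"])
    show "min 1 (1 / ?B\<^sup>2) > 0" using B by simp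
    fix \<nu> k l a b G G1 G2
    assume sub: "{a..b} \<subseteq> S" and sol: "interval_solution a b \<nu> k v G G1 G2"
    interpret interval_solution a b \<nu> k l v G G1 G2 by (rule sol)
    obtain \<delta> where \<delta>: "0 < \<delta>" "\<delta> \<le> 1" and r: "rate m \<nu> k > 0" "\<delta>\<^sup>2 * rate m \<nu> k \<le> \<nu>"
      "rate m \<nu> k \<le> \<bar>k\<bar> * \<delta> ^ m" "\<nu> * rate m \<nu> k \<le> (\<delta> * (\<bar>k\<bar> * \<delta> ^ m))\<^sup>2"
      using rate_scale[OF \<nu> k m] by blast
    obtain P where P: "finite P" "card P \<le> N"
      and far: "\<And>y. y \<in> S \<Longrightarrow> (\<forall>p\<in>P. \<delta> \<le> \<bar>y - p\<bar>) \<Longrightarrow> c * \<delta> ^ m \<le> \<bar>v y - l\<bar>"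
      using S[OF \<delta>, of l] by blast
    have k': "\<bar>k\<bar> > 0" and \<kappa>: "c * \<delta> ^ m > 0" using k c \<delta> by auto
    have mass: "nG\<^sup>2 \<le> 8 * real N * \<delta> * (nG * nG1) + (nF * nG + \<nu> * (12 * real N / \<delta>) * (nG1 * nG)) / (\<bar>k\<bar> * (c * \<delta> ^ m))"
      by (rule mass_bound[OF P \<delta>(1) \<kappa>]) (use far sub in auto)
    have "min 1 (1 / ?B\<^sup>2) * rate m \<nu> k * nG \<le> nF"
      using resolvent_inequality[OF L2norm_nonneg L2norm_nonneg L2norm_nonneg \<nu> k' r(1) \<delta>(1) c r(2,3,4) gradient_bound mass]
      by simp
    then show "min 1 (1 / ?B\<^sup>2) * rate m \<nu> k * L2norm {a..b} G
        \<le> L2norm {a..b} (\<lambda>y. - of_real \<nu> * G2 y + \<i> * of_real (k * (v y - l)) * G y)"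
      by (simp add: F_def[abs_def])
  qed
qed

text \<open>Shooting: \<open>w\<close> solves the inhomogeneous equation with zero data at
  \<open>a\<close>, \<open>u\<close> the homogeneous one with nonzero data that satisfy the
  condition at \<open>a\<close>. A multiple of \<open>u\<close> corrects the condition at
  \<open>b\<close> unless \<open>u\<close> satisfies that one too; but then \<open>u\<close> would
  be an \<open>interval_solution\<close> with F = 0, which the energy estimates rule out.
  \<open>DA\<close> and \<open>DB\<close> select Dirichlet conditions.\<close>

lemma boundary_value_problem:
  fixes f :: "real \<Rightarrow> complex"
  assumes ab: "a < b" and v: "continuous_on {a..b} v" and \<nu>: "\<nu> > 0" and k: "k \<noteq> 0"
    and f: "f \<in> L2 {a..b}" and D: "DA \<or> DB"
  obtains G G1 G2 where "interval_solution a b \<nu> k v G G1 G2"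
    "if DA then G a = 0 else G1 a = 0" "if DB then G b = 0 else G1 b = 0"
    "\<And>y. - of_real \<nu> * G2 y + \<i> * of_real (k * (v y - l)) * G y = f y"
proof -
  define q where "q y = \<i> * of_real (k * (v y - l)) / of_real \<nu>" for y
  have q: "continuous_on {a..b} q" unfolding q_def by (intro continuous_intros v) (use \<nu> in simp)
  define h where "h y = (- 1 / of_real \<nu>) * f y" for y
  have hL2: "h \<in> L2 {a..b}" unfolding h_def by (rule L2_cmult[OF f])
  have h: "integrable (lebesgue_on {a..b}) h" by (rule L2_Icc_integrable[OF hL2])
  have ab': "a \<le> b" using ab by simp
  have I: "is_interval {a..b}" by (rule is_interval_cc)
  obtain w w1 where w: "AD {a..b} w1 w" "AD {a..b} (\<lambda>y. q y * w y + h y) w1" "w a = 0" "w1 a = 0"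
    using linear_ivp[OF ab' q h] .
  obtain u u1 where u: "AD {a..b} u1 u" "AD {a..b} (\<lambda>y. q y * u y + 0) u1"
    "u a = (if DA then 0 else 1)" "u1 a = (if DA then 1 else 0)"
    by (rule linear_ivp[OF ab' q, where h="\<lambda>_. 0" and \<alpha>="if DA then 0 else 1" and \<beta>="if DA then 1 else 0"])
       auto
  define B where "B U U1 = (if DB then U b else U1 b)" for U U1 :: "real \<Rightarrow> complex"
  have cu: "continuous_on {a..b} u" "continuous_on {a..b} u1"
    using AD_continuous[OF u(1) I] AD_continuous[OF u(2) I] .
  have "B u u1 \<noteq> 0"
  proof
    assume B0: "B u u1 = 0"
    interpret U: interval_solution a b \<nu> k l v u u1 "\<lambda>y. q y * u y"
    proof
      show "AD {a..b} (\<lambda>y. q y * u y) u1" using u(2) by simp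
      show "(\<lambda>y. q y * u y) \<in> L2 {a..b}" by (intro continuous_L2_Icc continuous_intros q cu)
      show "u a = 0 \<or> u1 a = 0" using u(3,4) by simp
      show "u b = 0 \<or> u1 b = 0" "u a = 0 \<or> u b = 0" using B0 D u(3) by (auto simp: B_def split: if_splits)
    qed (use ab v \<nu> k u in auto)
    have "U.F y = 0" for y using \<nu> by (subst U.F_def) (simp add: q_def)
    then have "U.nF = 0" by (simp add: L2norm_def)
    then have "U.nG1\<^sup>2 \<le> 0" using U.gradient_bound \<nu> by (simp add: mult_le_0_iff)
    then have n1: "U.nG1 = 0" by simp
    show False
    \<comment> \<open>With a Neumann condition at \<open>a\<close>, \<open>sup_bound\<close>
      contradicts u a = 1; with a Dirichlet condition, the vanishing of \<open>u1\<close>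
      contradicts u1 a = 1.\<close>
    proof (cases DA)
      case False
      have "(cmod (u a))\<^sup>2 \<le> 0" using U.sup_bound[of a] ab n1 by simp
      then show False using u(3) False by simp
    next
      case True
      have "AE y in lebesgue_on {a..b}. u1 y = 0" using n1 L2norm_0_iff[OF U.G1_L2] by simp
      then have ae: "AE y in lebesgue_on {a<..<b}. u1 y = 0"
        by (rule AE_lebesgue_on_mono) (auto intro: open_sets_lebesgue)
      have z: "u1 y = 0" if "y \<in> {a<..<b}" for y
        by (rule continuous_AE_zero_imp_zero[OF _ continuous_on_subset[OF cu(2)] ae that]) auto
      have cl: "closure {a<..<b} = {a..b}" using ab by simp
      have "u1 a = 0"
        by (rule continuous_constant_on_closure[of "{a<..<b}" u1 0]) (use z cu(2) cl ab in auto)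
      then show False using u(4) True by simp
    qed
  qed
  define c where "c = - B w w1 / B u u1"
  define G where "G y = w y + c * u y" for y
  define G1 where "G1 y = w1 y + c * u1 y" for y
  define G2 where "G2 y = q y * G y + h y" for y
  have AD1: "AD {a..b} G1 G" unfolding G_def G1_def by (intro AD_add AD_cmult w u)
  have "AD {a..b} (\<lambda>y. (q y * w y + h y) + c * (q y * u y + 0)) G1"
    unfolding G1_def by (intro AD_add AD_cmult w u)
  then have AD2: "AD {a..b} G2 G1"
    by (rule AD_cong[OF _ _ refl I]) (simp add: G2_def G_def algebra_simps)
  have Gc: "continuous_on {a..b} G" by (rule AD_continuous[OF AD1 I])
  have G2L: "G2 \<in> L2 {a..b}"
    unfolding G2_def by (intro L2_add hL2 continuous_L2_Icc continuous_intros q Gc)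
  have bca: "if DA then G a = 0 else G1 a = 0" using w u by (simp add: G_def G1_def)
  have "B w w1 + c * B u u1 = 0" using \<open>B u u1 \<noteq> 0\<close> by (simp add: c_def)
  then have bcb: "if DB then G b = 0 else G1 b = 0" by (simp add: B_def G_def G1_def split: if_splits)
  show thesis
  proof (rule that[OF _ bca bcb])
    show "interval_solution a b \<nu> k v G G1 G2"
      by unfold_locales (use ab v \<nu> k AD1 AD2 G2L bca bcb D in \<open>auto split: if_splits\<close>)
    show "- of_real \<nu> * G2 y + \<i> * of_real (k * (v y - l)) * G y = f y" for y
      using \<nu> by (simp add: G2_def q_def h_def field_simps)
  qed
qed

text \<open>The cube of the positive part of 1 - t^2. The third power gives a continuous second
  derivative, as needed for multiplying functions that have two derivatives. The value at 0 is 1,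
  and the slope there is 0.\<close>

definition hat :: "real \<Rightarrow> real" where "hat t = (1 - t\<^sup>2) * sqpos (1 - t\<^sup>2)"
definition hat' :: "real \<Rightarrow> real" where "hat' t = - 6 * t * sqpos (1 - t\<^sup>2)"
definition hat'' :: "real \<Rightarrow> real" where "hat'' t = 24 * t\<^sup>2 * max 0 (1 - t\<^sup>2) - 6 * sqpos (1 - t\<^sup>2)"

lemma sqpos_one_minus_DERIV:
  "((\<lambda>t. sqpos (1 - t\<^sup>2)) has_real_derivative 2 * max 0 (1 - t\<^sup>2) * (- (2 * t))) (at t)"
  by (rule DERIV_chain2[OF sqpos_DERIV]) (auto intro!: derivative_eq_intros)

lemma mult_max_0: "x * max 0 x = sqpos (x::real)"
  by (auto simp: sqpos_def max_def power2_eq_square)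

lemma hat_DERIV: "(hat has_real_derivative hat' t) (at t)"
proof -
  have "((\<lambda>t. (1 - t\<^sup>2) * sqpos (1 - t\<^sup>2)) has_real_derivative
     (- (2 * t)) * sqpos (1 - t\<^sup>2) + (2 * max 0 (1 - t\<^sup>2) * (- (2 * t))) * (1 - t\<^sup>2)) (at t)"
    by (rule DERIV_mult[OF _ sqpos_one_minus_DERIV]) (auto intro!: derivative_eq_intros)
  moreover have "(- (2 * t)) * sqpos (1 - t\<^sup>2) + (2 * max 0 (1 - t\<^sup>2) * (- (2 * t))) * (1 - t\<^sup>2) = hat' t"
  proof -
    have "(- (2 * t)) * s + (2 * m * (- (2 * t))) * u = - 2 * t * s - 4 * t * (u * m)" for s m u :: real
      by (simp add: algebra_simps)
    then show ?thesis by (simp only: mult_max_0) (simp add: hat'_def)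
  qed
  ultimately show ?thesis by (simp add: hat_def[abs_def])
qed

lemma hat'_DERIV: "(hat' has_real_derivative hat'' t) (at t)"
proof -
  have "((\<lambda>t. (- 6 * t) * sqpos (1 - t\<^sup>2)) has_real_derivative
     (- 6) * sqpos (1 - t\<^sup>2) + (2 * max 0 (1 - t\<^sup>2) * (- (2 * t))) * (- 6 * t)) (at t)"
    by (rule DERIV_mult[OF _ sqpos_one_minus_DERIV]) (auto intro!: derivative_eq_intros)
  moreover have "(- 6) * sqpos (1 - t\<^sup>2) + (2 * max 0 (1 - t\<^sup>2) * (- (2 * t))) * (- 6 * t) = hat'' t"
    by (simp add: hat''_def algebra_simps power2_eq_square)
  ultimately show ?thesis by (simp add: hat'_def[abs_def])
qed

lemma hat_continuous: "continuous_on UNIV hat'" "continuous_on UNIV hat''"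
  unfolding hat'_def[abs_def] hat''_def[abs_def] sqpos_def by (intro continuous_intros)+

lemma hat_outside: "1 \<le> \<bar>t\<bar> \<Longrightarrow> hat t = 0 \<and> hat' t = 0 \<and> hat'' t = 0"
  using one_le_power[of "\<bar>t\<bar>" 2] by (simp add: hat_def hat'_def hat''_def sqpos_def)

lemma hat_bounds: "0 \<le> hat t" "hat t \<le> 1" "\<bar>hat' t\<bar> \<le> 6" "\<bar>hat'' t\<bar> \<le> 30"
proof -
  have "0 \<le> hat t \<and> hat t \<le> 1 \<and> \<bar>hat' t\<bar> \<le> 6 \<and> \<bar>hat'' t\<bar> \<le> 30"
  proof (cases "1 \<le> \<bar>t\<bar>")
    case True
    then show ?thesis using hat_outside by simp
  next
    case False
    then have t: "\<bar>t\<bar> \<le> 1" by simp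
    then have t2: "0 \<le> 1 - t\<^sup>2" "1 - t\<^sup>2 \<le> 1" "t\<^sup>2 \<le> 1" by (simp_all add: abs_square_le_1)
    have s: "0 \<le> sqpos (1 - t\<^sup>2)" "sqpos (1 - t\<^sup>2) \<le> 1"
      using t2 by (auto simp: sqpos_def max_def intro: power_le_one)
    have m: "0 \<le> max 0 (1 - t\<^sup>2)" "max 0 (1 - t\<^sup>2) \<le> 1" using t2 by auto
    have "\<bar>t\<bar> * sqpos (1 - t\<^sup>2) \<le> 1" by (rule mult_le_one[OF t s])
    moreover have "t\<^sup>2 * max 0 (1 - t\<^sup>2) \<le> 1" by (rule mult_le_one[OF t2(3) m])
    moreover have "0 \<le> t\<^sup>2 * max 0 (1 - t\<^sup>2)" using m(1) by (rule mult_nonneg_nonneg[rotated]) simp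
    moreover have "hat'' t = 24 * (t\<^sup>2 * max 0 (1 - t\<^sup>2)) - 6 * sqpos (1 - t\<^sup>2)"
      by (simp only: hat''_def mult.assoc)
    ultimately have "\<bar>hat'' t\<bar> \<le> 30" "\<bar>t\<bar> * sqpos (1 - t\<^sup>2) \<le> 1" using s by linarith+
    then show ?thesis
      using s(1) t2 mult_le_one[OF t2(2) s] by (simp add: hat_def hat'_def abs_mult)
  qed
  then show "0 \<le> hat t" "hat t \<le> 1" "\<bar>hat' t\<bar> \<le> 6" "\<bar>hat'' t\<bar> \<le> 30" by auto
qed

section \<open>Cutoffs at scale R and their commutator with the second derivative\<close>

locale cutoff =
  fixes p R :: real
  assumes R: "R > 0"
begin

definition \<eta> where "\<eta> y = hat ((y - p) / R)"
definition \<eta>1 where "\<eta>1 y = hat' ((y - p) / R) / R"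
definition \<eta>2 where "\<eta>2 y = hat'' ((y - p) / R) / R\<^sup>2"

lemma \<eta>_DERIV: "(\<eta> has_real_derivative \<eta>1 y) (at y)"
proof -
  have "((\<lambda>y. hat ((y - p) / R)) has_real_derivative hat' ((y - p) / R) * (1 / R)) (at y)"
    by (rule DERIV_chain2[OF hat_DERIV]) (use R in \<open>auto intro!: derivative_eq_intros\<close>)
  then show ?thesis by (simp add: \<eta>_def[abs_def] \<eta>1_def)
qed

lemma \<eta>1_DERIV: "(\<eta>1 has_real_derivative \<eta>2 y) (at y)"
proof -
  have "((\<lambda>y. hat' ((y - p) / R)) has_real_derivative hat'' ((y - p) / R) * (1 / R)) (at y)"
    by (rule DERIV_chain2[OF hat'_DERIV]) (use R in \<open>auto intro!: derivative_eq_intros\<close>)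
  from DERIV_cdivide[OF this, of R] show ?thesis
    by (simp add: \<eta>1_def[abs_def] \<eta>2_def power2_eq_square)
qed

lemma \<eta>_continuous: "continuous_on S \<eta>" "continuous_on S \<eta>1" "continuous_on S \<eta>2"
proof -
  show "continuous_on S \<eta>" by (rule DERIV_imp_continuous_on[OF \<eta>_DERIV])
  show "continuous_on S \<eta>1" by (rule DERIV_imp_continuous_on[OF \<eta>1_DERIV])
  show "continuous_on S \<eta>2"
    unfolding \<eta>2_def[abs_def]
    by (intro continuous_intros continuous_on_compose2[OF hat_continuous(2)]) (use R in auto)
qed

lemma \<eta>_outside:
  assumes "R \<le> \<bar>y - p\<bar>"
  shows "\<eta> y = 0" "\<eta>1 y = 0" "\<eta>2 y = 0"
proof -
  have "1 \<le> \<bar>(y - p) / R\<bar>" using assms R by (simp add: abs_divide)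
  from hat_outside[OF this] show "\<eta> y = 0" "\<eta>1 y = 0" "\<eta>2 y = 0"
    by (simp_all add: \<eta>_def \<eta>1_def \<eta>2_def)
qed

lemma \<eta>_center: "\<eta>1 p = 0"
  by (simp add: \<eta>1_def hat'_def)

lemma \<eta>_bounds: "\<bar>\<eta> y\<bar> \<le> 1" "\<bar>\<eta> y - 1\<bar> \<le> 1" "\<bar>\<eta>1 y\<bar> \<le> 6 / R" "\<bar>\<eta>2 y\<bar> \<le> 30 / R\<^sup>2"
proof -
  show "\<bar>\<eta> y\<bar> \<le> 1" "\<bar>\<eta> y - 1\<bar> \<le> 1" using hat_bounds(1,2)[of "(y - p) / R"] by (auto simp: \<eta>_def)
  show "\<bar>\<eta>1 y\<bar> \<le> 6 / R" using hat_bounds(3)[of "(y - p) / R"] R by (simp add: \<eta>1_def abs_divide divide_right_mono)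
  show "\<bar>\<eta>2 y\<bar> \<le> 30 / R\<^sup>2" using hat_bounds(4)[of "(y - p) / R"] R by (simp add: \<eta>2_def abs_divide divide_right_mono)
qed

lemma \<eta>_measurable:
  assumes "S \<in> sets lebesgue"
  shows "(\<lambda>y. complex_of_real (\<eta> y)) \<in> borel_measurable (lebesgue_on S)"
    "(\<lambda>y. complex_of_real (\<eta>1 y)) \<in> borel_measurable (lebesgue_on S)"
    "(\<lambda>y. complex_of_real (\<eta>2 y)) \<in> borel_measurable (lebesgue_on S)"
  by (intro continuous_imp_measurable_on_sets_lebesgue[OF _ assms] continuous_intros \<eta>_continuous)+

context
  fixes G G1 G2 :: "real \<Rightarrow> complex"
begin

definition \<eta>G where "\<eta>G y = of_real (\<eta> y) * G y"
definition \<eta>G1 where "\<eta>G1 y = of_real (\<eta>1 y) * G y + of_real (\<eta> y) * G1 y"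
text \<open>Kept in the unexpanded form that \<open>AD_add\<close> and \<open>AD_mult\<close>
  produce; \<open>\<eta>G2_eq\<close> regroups it.\<close>

definition \<eta>G2 where "\<eta>G2 y = (of_real (\<eta>2 y) * G y + of_real (\<eta>1 y) * G1 y)
  + (of_real (\<eta>1 y) * G1 y + of_real (\<eta> y) * G2 y)"
text \<open>The commutator of the second derivative with multiplication by \<eta>, applied to
  \<open>G\<close>. It contains neither \<open>G2\<close> nor the potential and is O(1/R).\<close>

definition commutator where "commutator y = of_real (\<eta>2 y) * G y + 2 * (of_real (\<eta>1 y) * G1 y)"

lemma \<eta>_AD:
  assumes "AD S G1 G" "AD S G2 G1" "is_interval S"
  shows "AD S \<eta>G1 \<eta>G" "AD S \<eta>G2 \<eta>G1"
proof -
  have A: "AD S (\<lambda>y. of_real (\<eta>1 y)) (\<lambda>y. of_real (\<eta> y))"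
    by (rule AD_of_real_DERIV[OF \<eta>_DERIV \<eta>_continuous(2) assms(3)])
  have A1: "AD S (\<lambda>y. of_real (\<eta>2 y)) (\<lambda>y. of_real (\<eta>1 y))"
    by (rule AD_of_real_DERIV[OF \<eta>1_DERIV \<eta>_continuous(3) assms(3)])
  show "AD S \<eta>G1 \<eta>G"
    unfolding \<eta>G1_def[abs_def] \<eta>G_def[abs_def] by (rule AD_mult[OF A assms(1,3)])
  show "AD S \<eta>G2 \<eta>G1"
    unfolding \<eta>G1_def[abs_def] \<eta>G2_def[abs_def]
    by (intro AD_add AD_mult[OF A1 assms(1,3)] AD_mult[OF A assms(2,3)])
qed

lemma commutator_L2:
  assumes "G \<in> L2 S" "G1 \<in> L2 S" "S \<in> sets lebesgue"
  shows "commutator \<in> L2 S" "L2norm S commutator \<le> 30 / R\<^sup>2 * L2norm S G + 12 / R * L2norm S G1"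
proof -
  note m = \<eta>_measurable[OF assms(3)]
  have b2: "cmod (of_real (\<eta>2 y)) \<le> 30 / R\<^sup>2" and b1: "cmod (of_real (\<eta>1 y)) \<le> 6 / R" for y
    using \<eta>_bounds by simp_all
  have L: "(\<lambda>y. of_real (\<eta>2 y) * G y) \<in> L2 S" "(\<lambda>y. of_real (\<eta>1 y) * G1 y) \<in> L2 S"
    using L2_bounded_mult(1)[OF assms(1) m(3) b2] L2_bounded_mult(1)[OF assms(2) m(2) b1] .
  have L': "(\<lambda>y. 2 * (of_real (\<eta>1 y) * G1 y)) \<in> L2 S" by (rule L2_cmult[OF L(2)])
  show "commutator \<in> L2 S" unfolding commutator_def[abs_def] by (rule L2_add[OF L(1) L'])
  have "L2norm S commutator \<le> L2norm S (\<lambda>y. of_real (\<eta>2 y) * G y) + L2norm S (\<lambda>y. 2 * (of_real (\<eta>1 y) * G1 y))"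
    unfolding commutator_def[abs_def] by (rule L2norm_triangle[OF L(1) L'])
  also have "L2norm S (\<lambda>y. 2 * (of_real (\<eta>1 y) * G1 y)) = 2 * L2norm S (\<lambda>y. of_real (\<eta>1 y) * G1 y)"
    using L2norm_cmult[of S 2] by simp
  finally show "L2norm S commutator \<le> 30 / R\<^sup>2 * L2norm S G + 12 / R * L2norm S G1"
    using L2_bounded_mult(2)[OF assms(1) m(3) b2] L2_bounded_mult(2)[OF assms(2) m(2) b1] R by simp
qed

lemma \<eta>_L2:
  assumes "f \<in> L2 S" "S \<in> sets lebesgue"
  shows "(\<lambda>y. of_real (\<eta> y) * f y) \<in> L2 S" "L2norm S (\<lambda>y. of_real (\<eta> y) * f y) \<le> L2norm S f"
  using L2_bounded_mult[OF assms(1) \<eta>_measurable(1)[OF assms(2)], of 1] \<eta>_bounds(1) by auto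

lemma \<eta>G2_eq: "\<eta>G2 y = of_real (\<eta> y) * G2 y + commutator y"
  by (simp add: \<eta>G2_def commutator_def algebra_simps)

end

end

lemma cutoff_tendsto:
  assumes f: "f \<in> L2 S" and S: "S \<in> sets lebesgue"
  shows "(\<lambda>n. L2norm S (\<lambda>y. (of_real (cutoff.\<eta> p (real (Suc n)) y) - 1) * f y)) \<longlonglongrightarrow> 0"
proof -
  let ?e = "\<lambda>n. cutoff.\<eta> p (real (Suc n))"
  have c: "cutoff (real (Suc n))" for n by unfold_locales simp
  have "(\<lambda>n. LINT y|lebesgue_on S. (cmod ((of_real (?e n y) - 1) * f y))\<^sup>2) \<longlonglongrightarrow> (LINT y|lebesgue_on S. 0)"
  proof (rule integral_dominated_convergence[where w="\<lambda>y. (cmod (f y))\<^sup>2"])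
    show "integrable (lebesgue_on S) (\<lambda>y. (cmod (f y))\<^sup>2)" by (rule L2_integrable[OF f])
    show "(\<lambda>y. (cmod ((of_real (?e n y) - 1) * f y))\<^sup>2) \<in> borel_measurable (lebesgue_on S)" for n
      using cutoff.\<eta>_measurable(1)[OF c[of n] S, of p] L2_measurable[OF f] by measurable
    show "AE y in lebesgue_on S. norm ((cmod ((of_real (?e n y) - 1) * f y))\<^sup>2) \<le> (cmod (f y))\<^sup>2" for n
    proof (rule AE_I2)
      fix y
      have "cmod (of_real (?e n y) - 1) \<le> 1"
        using cutoff.\<eta>_bounds(2)[OF c[of n], of p y] by (metis norm_of_real of_real_1 of_real_diff)
      then have "cmod ((of_real (?e n y) - 1) * f y) \<le> 1 * cmod (f y)"
        unfolding norm_mult by (intro mult_right_mono) auto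
      then show "norm ((cmod ((of_real (?e n y) - 1) * f y))\<^sup>2) \<le> (cmod (f y))\<^sup>2"
        using power_mono[of "cmod ((of_real (?e n y) - 1) * f y)" "cmod (f y)" 2] by simp
    qed
    show "AE y in lebesgue_on S. (\<lambda>n. (cmod ((of_real (?e n y) - 1) * f y))\<^sup>2) \<longlonglongrightarrow> 0"
    proof (rule AE_I2)
      fix y
      have "isCont hat 0" using hat_DERIV DERIV_isCont by blast
      moreover have "(\<lambda>n. (y - p) / real (Suc n)) \<longlonglongrightarrow> 0"
        using LIMSEQ_Suc[OF lim_const_over_n[of "y - p"]] by simp
      ultimately have "(\<lambda>n. hat ((y - p) / real (Suc n))) \<longlonglongrightarrow> hat 0"
        by (rule isCont_tendsto_compose)
      then have "(\<lambda>n. ?e n y) \<longlonglongrightarrow> 1"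
        by (simp add: cutoff.\<eta>_def[OF c] hat_def sqpos_def del: of_nat_Suc)
      then have "(\<lambda>n. (cmod ((of_real (?e n y) - 1) * f y))\<^sup>2) \<longlonglongrightarrow> (cmod ((of_real 1 - 1) * f y))\<^sup>2"
        by (intro tendsto_intros)
      then show "(\<lambda>n. (cmod ((of_real (?e n y) - 1) * f y))\<^sup>2) \<longlonglongrightarrow> 0" by simp
    qed
  qed simp
  then have "(\<lambda>n. sqrt (LINT y|lebesgue_on S. (cmod ((of_real (?e n y) - 1) * f y))\<^sup>2)) \<longlonglongrightarrow> sqrt 0"
    by (intro tendsto_real_sqrt) simp
  then show ?thesis by (simp add: L2norm_def)
qed

text \<open>Zero extension creates a jump unless \<open>F\<close> vanishes at the end in question.
  The conditions \<open>left\<close> and \<open>right\<close> ask for this only if \<open>S\<close>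
  continues beyond that end, so at a true end point of \<Omega> the value may be nonzero.\<close>

lemma AD_extend_zero:
  assumes AD: "AD {a..b} f F" and ab: "a \<le> b"
    and left: "\<And>y. y \<in> S \<Longrightarrow> y < a \<Longrightarrow> F a = 0" and right: "\<And>y. y \<in> S \<Longrightarrow> b < y \<Longrightarrow> F b = 0"
  shows "AD S (\<lambda>y. if y \<in> {a..b} then f y else 0) (\<lambda>y. if y \<in> {a..b} then F y else 0)"
  unfolding AD_def
proof (intro ballI impI)
  fix x y assume xy: "x \<in> S" "y \<in> S" "x \<le> y"
  let ?f = "\<lambda>y. if y \<in> {a..b} then f y else 0" and ?F = "\<lambda>y. if y \<in> {a..b} then F y else 0"
  have "integrable (lebesgue_on {a..b}) f" using AD_D(1)[OF AD, of a b] ab by simp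
  then have "integrable lebesgue ?f"
    by (rule iffD2[OF Lebesgue_Measure.integrable_restrict_UNIV, rotated]) simp
  then have int: "integrable (lebesgue_on {x..y}) ?f"
    using integrable_lebesgue_on_mono[of UNIV ?f "{x..y}"] by (simp add: lebesgue_on_UNIV_eq)
  have "(LINT t|lebesgue_on {x..y}. ?f t) = (LINT t|lebesgue_on ({a..b} \<inter> {x..y}). f t)"
    by (rule Lebesgue_Measure.integral_restrict_Int) auto
  also have "{a..b} \<inter> {x..y} = {max a x..min b y}" by auto
  finally have eq: "(LINT t|lebesgue_on {x..y}. ?f t) = (LINT t|lebesgue_on {max a x..min b y}. f t)" .
  have "?F y - ?F x = (LINT t|lebesgue_on {max a x..min b y}. f t)"
  proof (cases "max a x \<le> min b y")
    case True
    have "F (min b y) - F (max a x) = (LINT t|lebesgue_on {max a x..min b y}. f t)"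
      by (rule AD_D(2)[OF AD]) (use True in auto)
    moreover have "F (min b y) = ?F y" using right[OF xy(2)] True ab by (auto simp: min_def)
    moreover have "F (max a x) = ?F x" using left[OF xy(1)] True ab by (auto simp: max_def)
    ultimately show ?thesis by simp
  next
    case False
    then have "?F y = 0" "?F x = 0" "{max a x..min b y} = {}" using xy(3) by auto
    then show ?thesis by (simp only: integral_lebesgue_on_empty diff_self)
  qed
  then show "integrable (lebesgue_on {x..y}) ?f \<and> ?F y - ?F x = (LINT t|lebesgue_on {x..y}. ?f t)"
    using int eq by simp
qed

section \<open>Lower bound and dense range\<close>

lemma L2norm_cong: "(\<And>y. y \<in> S \<Longrightarrow> f y = g y) \<Longrightarrow> L2norm S f = L2norm S g"
  unfolding L2norm_def by (intro arg_cong[where f=sqrt] Bochner_Integration.integral_cong) auto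

lemma const_over_Suc_tendsto:
  "(\<lambda>n. c / (real (Suc n))\<^sup>2) \<longlonglongrightarrow> 0" "(\<lambda>n. c / real (Suc n)) \<longlonglongrightarrow> 0"
proof -
  have t: "(\<lambda>n. d / real (Suc n)) \<longlonglongrightarrow> 0" for d
    by (rule LIMSEQ_Suc[OF lim_const_over_n])
  then show "(\<lambda>n. c / real (Suc n)) \<longlonglongrightarrow> 0" .
  have "(\<lambda>n. c / real (Suc n) * (1 / real (Suc n))) \<longlonglongrightarrow> 0 * 0"
    by (intro tendsto_mult t)
  then show "(\<lambda>n. c / (real (Suc n))\<^sup>2) \<longlonglongrightarrow> 0"
    by (simp add: power2_eq_square)
qed

context unbounded_interval
begin

text \<open>\<open>l\<close> and \<open>r\<close> tell whether \<open>\<Omega>\<close> is unbounded to the left and to the right.  Centring the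
  windows at the end point \<open>p\<close>, where \<^const>\<open>cutoff.\<eta>1\<close> vanishes, keeps the Neumann condition under
  multiplication by the cutoff.\<close>

definition lo :: "bool \<Rightarrow> real \<Rightarrow> real \<Rightarrow> real" where "lo l p R = (if l then p - R else p)"
definition hi :: "bool \<Rightarrow> real \<Rightarrow> real \<Rightarrow> real" where "hi r p R = (if r then p + R else p)"

definition window_at :: "real \<Rightarrow> bool \<Rightarrow> bool \<Rightarrow> bool" where
  "window_at p l r \<longleftrightarrow> (l \<or> r) \<and> (\<not> (l \<and> r) \<longrightarrow> p \<in> frontier \<Omega>) \<and> (l \<and> r \<longrightarrow> frontier \<Omega> = {})
     \<and> frontier \<Omega> \<subseteq> {p} \<and> (\<forall>R>0. lo l p R < hi r p R) \<and> (\<forall>R. {lo l p R..hi r p R} \<subseteq> closure \<Omega>)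
     \<and> (\<forall>R. \<forall>y\<in>closure \<Omega>. (y \<notin> {lo l p R..hi r p R} \<longrightarrow> R \<le> \<bar>y - p\<bar>)
         \<and> (y < lo l p R \<longrightarrow> l) \<and> (hi r p R < y \<longrightarrow> r))"

lemma window_exists: obtains p l r where "window_at p l r"
proof -
  consider "\<Omega> = UNIV" | L where "\<Omega> = {..<L}" | L where "\<Omega> = {L<..}" using shape by blast
  then show thesis
  proof cases
    case 1
    have "window_at 0 True True"
      unfolding window_at_def using 1 by (auto simp: lo_def hi_def abs_if)
    then show thesis by (rule that)
  next
    case (2 L)
    have "window_at L True False"
      unfolding window_at_def using 2
      by (auto simp: lo_def hi_def frontier_def interior_open abs_if)
    then show thesis by (rule that)
  next
    case (3 L)
    have "window_at L False True"
      unfolding window_at_def using 3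
      by (auto simp: lo_def hi_def frontier_def interior_open abs_if)
    then show thesis by (rule that)
  qed
qed

text \<open>The bound for compact intervals is applied to \<eta> G on windows whose size R tends to
  infinity. Cutting off changes F into \<eta> F minus \<nu> times the commutator, and the latter is
  O(1/R) because the norms of G and G1 are finite.\<close>

lemma H_rep_lower_bound:
  assumes \<nu>: "\<nu> > 0" and k: "k \<noteq> 0" and v: "continuous_on (closure \<Omega>) v" and \<kappa>: "\<kappa> \<ge> 0"
    and bound: "\<And>a b G G1 G2. {a..b} \<subseteq> closure \<Omega> \<Longrightarrow> interval_solution a b \<nu> k v G G1 G2 \<Longrightarrow>
      \<kappa> * L2norm {a..b} G \<le> L2norm {a..b} (\<lambda>y. - of_real \<nu> * G2 y + \<i> * of_real (k * (v y - l)) * G y)"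
    and rep: "H_rep v \<nu> k g G G1 G2"
  shows "\<kappa> * L2norm \<Omega> G \<le> L2norm \<Omega> (\<lambda>y. - of_real \<nu> * G2 y + \<i> * of_real (k * (v y - l)) * G y)"
proof -
  have AD: "AD (closure \<Omega>) G1 G" "AD (closure \<Omega>) G2 G1"
    and L2: "G \<in> L2 \<Omega>" "G1 \<in> L2 \<Omega>" "G2 \<in> L2 \<Omega>" and fr: "\<forall>y\<in>frontier \<Omega>. G1 y = 0"
    and H: "(\<lambda>y. - of_real \<nu> * G2 y + \<i> * of_real k * of_real (v y) * G y) \<in> L2 \<Omega>"
    using rep by (auto simp: H_rep_def)
  define F where "F y = - of_real \<nu> * G2 y + \<i> * of_real (k * (v y - l)) * G y" for y
  have "(\<lambda>y. (- of_real \<nu> * G2 y + \<i> * of_real k * of_real (v y) * G y) + (- \<i> * of_real (k * l)) * G y) \<in> L2 \<Omega>"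
    by (intro L2_add H L2_cmult L2)
  then have F: "F \<in> L2 \<Omega>"
    by (rule back_subst[of "\<lambda>h. h \<in> L2 \<Omega>"]) (simp add: F_def fun_eq_iff algebra_simps)
  obtain p ll rr where w: "window_at p ll rr" by (rule window_exists)
  then have lr: "ll \<or> rr" and pf: "\<not> (ll \<and> rr) \<Longrightarrow> p \<in> frontier \<Omega>"
    unfolding window_at_def by blast+
  let ?e = "\<lambda>n. cutoff.\<eta> p (real (Suc n))"
  define err where "err n = \<kappa> * L2norm \<Omega> (\<lambda>y. (of_real (?e n y) - 1) * G y)
     + (L2norm \<Omega> F + \<nu> * (30 / (real (Suc n))\<^sup>2 * L2norm \<Omega> G + 12 / real (Suc n) * L2norm \<Omega> G1))" for n
  have step: "\<kappa> * L2norm \<Omega> G \<le> err n" for n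
  proof -
    interpret cutoff p "real (Suc n)" by unfold_locales simp
    note of_nat_Suc [simp del]
    define a b where "a = lo ll p (real (Suc n))" and "b = hi rr p (real (Suc n))"
    have ab: "a < b" and sub: "{a..b} \<subseteq> closure \<Omega>"
      and out: "\<And>y. y \<in> closure \<Omega> \<Longrightarrow> y \<notin> {a..b} \<Longrightarrow> real (Suc n) \<le> \<bar>y - p\<bar>"
      using w unfolding window_at_def a_def b_def by auto
    have "interval_solution a b \<nu> k v (\<eta>G G) (\<eta>G1 G G1) (\<eta>G2 G G1 G2)"
    proof
      show "AD {a..b} (\<eta>G1 G G1) (\<eta>G G)" "AD {a..b} (\<eta>G2 G G1 G2) (\<eta>G1 G G1)"
        using \<eta>_AD[OF AD interval_closure] AD_subset[OF _ sub] by blast+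
      have L: "G \<in> L2 {a..b}" "G1 \<in> L2 {a..b}" "G2 \<in> L2 {a..b}" using L2 L2_Icc[OF _ sub] by blast+
      then show "\<eta>G2 G G1 G2 \<in> L2 {a..b}"
        unfolding \<eta>G2_eq[abs_def] by (intro L2_add \<eta>_L2 commutator_L2) auto
      \<comment> \<open>At a true end, which is the centre \<open>p\<close>, both \<open>G1\<close>
        and the derivative of the cutoff vanish, so the Neumann condition survives. At an artificial
        end the cutoff itself vanishes and a Dirichlet condition results. At least one end is
        artificial.\<close>
      have pa: "\<eta>G1 G G1 p = 0" if "p \<in> frontier \<Omega>"
        using fr that by (simp add: \<eta>G1_def \<eta>_center)
      have oa: "\<eta>G G a = 0" if ll using \<eta>_outside(1)[of a] that by (simp add: \<eta>G_def a_def lo_def)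
      have ob: "\<eta>G G b = 0" if rr using \<eta>_outside(1)[of b] that by (simp add: \<eta>G_def b_def hi_def)
      show "\<eta>G G a = 0 \<or> \<eta>G1 G G1 a = 0" using oa pa pf by (cases ll) (auto simp: a_def lo_def)
      show "\<eta>G G b = 0 \<or> \<eta>G1 G G1 b = 0" using ob pa pf by (cases rr) (auto simp: b_def hi_def)
      show "\<eta>G G a = 0 \<or> \<eta>G G b = 0" using oa ob lr by blast
    qed (use ab \<nu> k continuous_on_subset[OF v sub] in auto)
    from bound[OF sub this]
    have 1: "\<kappa> * L2norm {a..b} (\<eta>G G) \<le> L2norm {a..b} (\<lambda>y. - of_real \<nu> * \<eta>G2 G G1 G2 y + \<i> * of_real (k * (v y - l)) * \<eta>G G y)" .
    have eq: "- of_real \<nu> * \<eta>G2 G G1 G2 y + \<i> * of_real (k * (v y - l)) * \<eta>G G y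
       = of_real (\<eta> y) * F y + (- of_real \<nu>) * commutator G G1 y" for y
      by (simp add: \<eta>G2_eq \<eta>G_def F_def algebra_simps)
    have Fab: "F \<in> L2 {a..b}" "L2norm {a..b} F \<le> L2norm \<Omega> F" using L2_Icc[OF F sub] L2norm_Icc_le[OF F sub] .
    have Gab: "G \<in> L2 {a..b}" "L2norm {a..b} G \<le> L2norm \<Omega> G" using L2_Icc[OF L2(1) sub] L2norm_Icc_le[OF L2(1) sub] .
    have G1ab: "G1 \<in> L2 {a..b}" "L2norm {a..b} G1 \<le> L2norm \<Omega> G1" using L2_Icc[OF L2(2) sub] L2norm_Icc_le[OF L2(2) sub] .
    have cm: "commutator G G1 \<in> L2 {a..b}"
      "L2norm {a..b} (commutator G G1) \<le> 30 / (real (Suc n))\<^sup>2 * L2norm {a..b} G + 12 / real (Suc n) * L2norm {a..b} G1"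
      using commutator_L2[OF Gab(1) G1ab(1)] by auto
    have "L2norm {a..b} (\<lambda>y. of_real (\<eta> y) * F y + (- of_real \<nu>) * commutator G G1 y)
       \<le> L2norm {a..b} (\<lambda>y. of_real (\<eta> y) * F y) + L2norm {a..b} (\<lambda>y. (- of_real \<nu>) * commutator G G1 y)"
      by (intro L2norm_triangle \<eta>_L2 L2_cmult cm Fab) auto
    also have "L2norm {a..b} (\<lambda>y. (- of_real \<nu>) * commutator G G1 y) = \<nu> * L2norm {a..b} (commutator G G1)"
      using L2norm_cmult[of "{a..b}" "- of_real \<nu>"] \<nu> by simp
    also have "\<dots> \<le> \<nu> * (30 / (real (Suc n))\<^sup>2 * L2norm \<Omega> G + 12 / real (Suc n) * L2norm \<Omega> G1)"
    proof -
      have "30 / (real (Suc n))\<^sup>2 * L2norm {a..b} G + 12 / real (Suc n) * L2norm {a..b} G1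
          \<le> 30 / (real (Suc n))\<^sup>2 * L2norm \<Omega> G + 12 / real (Suc n) * L2norm \<Omega> G1"
        by (intro add_mono mult_left_mono Gab G1ab) auto
      from mult_left_mono[OF order_trans[OF cm(2) this], of \<nu>] show ?thesis using \<nu> by simp
    qed
    also have "L2norm {a..b} (\<lambda>y. of_real (\<eta> y) * F y) \<le> L2norm \<Omega> F"
      using \<eta>_L2(2)[OF Fab(1)] Fab(2) by simp
    finally have 2: "\<kappa> * L2norm {a..b} (\<eta>G G) \<le> L2norm \<Omega> F
       + \<nu> * (30 / (real (Suc n))\<^sup>2 * L2norm \<Omega> G + 12 / real (Suc n) * L2norm \<Omega> G1)"
      using 1 unfolding eq by simp
    have gL: "\<eta>G G \<in> L2 \<Omega>" unfolding \<eta>G_def[abs_def] by (rule \<eta>_L2(1)[OF L2(1)]) simp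
    have "L2norm \<Omega> (\<eta>G G) = L2norm (closure \<Omega>) (\<eta>G G)" by (rule L2norm_closure[OF gL, symmetric])
    also have "\<dots> = L2norm (closure \<Omega>) (\<lambda>y. if y \<in> {a..b} then \<eta>G G y else 0)"
      by (rule L2norm_cong) (use \<eta>_outside(1)[OF out] in \<open>auto simp: \<eta>G_def\<close>)
    also have "\<dots> = L2norm {a..b} (\<eta>G G)"
      by (rule L2_extend_zero(2)[OF L2_Icc[OF gL sub] sub]) auto
    finally have 3: "L2norm \<Omega> (\<eta>G G) = L2norm {a..b} (\<eta>G G)" .
    have "L2norm \<Omega> G \<le> L2norm \<Omega> (\<eta>G G) + L2norm \<Omega> (\<lambda>y. G y - \<eta>G G y)"
      by (rule L2norm_triangle_sub[OF L2(1) gL])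
    also have "L2norm \<Omega> (\<lambda>y. G y - \<eta>G G y) = L2norm \<Omega> (\<lambda>y. \<eta>G G y - G y)"
      by (rule L2norm_minus_commute)
    also have "(\<lambda>y. \<eta>G G y - G y) = (\<lambda>y. (of_real (\<eta> y) - 1) * G y)"
      by (simp add: \<eta>G_def fun_eq_iff algebra_simps)
    finally have "\<kappa> * L2norm \<Omega> G \<le> \<kappa> * (L2norm \<Omega> (\<eta>G G) + L2norm \<Omega> (\<lambda>y. (of_real (\<eta> y) - 1) * G y))"
      using \<kappa> by (intro mult_left_mono)
    then show ?thesis using 2 unfolding err_def 3 distrib_left by linarith
  qed
  have "(\<lambda>n. 30 / (real (Suc n))\<^sup>2) \<longlonglongrightarrow> 0" "(\<lambda>n. 12 / real (Suc n)) \<longlonglongrightarrow> 0"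
    by (rule const_over_Suc_tendsto)+
  then have "err \<longlonglongrightarrow> \<kappa> * 0 + (L2norm \<Omega> F + \<nu> * (0 * L2norm \<Omega> G + 0 * L2norm \<Omega> G1))"
    unfolding err_def[abs_def] by (intro tendsto_intros cutoff_tendsto[OF L2(1)]) simp_all
  then have "\<kappa> * L2norm \<Omega> G \<le> \<kappa> * 0 + (L2norm \<Omega> F + \<nu> * (0 * L2norm \<Omega> G + 0 * L2norm \<Omega> G1))"
    by (rule LIMSEQ_le_const) (use step in auto)
  then show ?thesis by (simp add: F_def[abs_def])
qed

text \<open>On a window the equation with right-hand side f is solved with Dirichlet conditions at
  artificial ends and a Neumann condition at a true end; cutting off and extending by zero gives an
  element of the domain. The residual, (\<eta> - 1) f minus \<nu> times the commutator, tends to 0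
  because the bounds on the solution are the same for all windows.\<close>

lemma H_dom_dense_range:
  assumes \<nu>: "\<nu> > 0" and k: "k \<noteq> 0" and v: "continuous_on (closure \<Omega>) v" and \<kappa>: "\<kappa> > 0"
    and bound: "\<And>a b G G1 G2. {a..b} \<subseteq> closure \<Omega> \<Longrightarrow> interval_solution a b \<nu> k v G G1 G2 \<Longrightarrow>
      \<kappa> * L2norm {a..b} G \<le> L2norm {a..b} (\<lambda>y. - of_real \<nu> * G2 y + \<i> * of_real (k * (v y - l)) * G y)"
    and f: "f \<in> L2 \<Omega>" and \<epsilon>: "\<epsilon> > 0"
  obtains g where "g \<in> H_dom \<Omega> v \<nu> k"
    "L2norm \<Omega> (\<lambda>y. (H_op \<Omega> v \<nu> k g y - \<i> * of_real (k * l) * g y) - f y) < \<epsilon>"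
proof -
  obtain p ll rr where w: "window_at p ll rr" by (rule window_exists)
  then have lr: "ll \<or> rr" and fr0: "ll \<and> rr \<Longrightarrow> frontier \<Omega> = {}" and ff: "frontier \<Omega> \<subseteq> {p}"
    unfolding window_at_def by blast+
  let ?e = "\<lambda>n. cutoff.\<eta> p (real (Suc n))"
  \<comment> \<open>A priori bounds for the solution on any window. In terms of norms, \<kappa> |G|
    \<le> |f| and \<nu> |G1|^2 \<le> |f| |G| \<le> |f|^2 / \<kappa>. They allow \<open>n\<close> to
    be fixed before the equation is solved.\<close>
  define A0 where "A0 = L2norm \<Omega> f / \<kappa>"
  define A1 where "A1 = L2norm \<Omega> f / sqrt (\<kappa> * \<nu>)"
  define err where "err n = L2norm \<Omega> (\<lambda>y. (of_real (?e n y) - 1) * f y)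
     + \<nu> * (30 / (real (Suc n))\<^sup>2 * A0 + 12 / real (Suc n) * A1)" for n
  have "(\<lambda>n. 30 / (real (Suc n))\<^sup>2) \<longlonglongrightarrow> 0" "(\<lambda>n. 12 / real (Suc n)) \<longlonglongrightarrow> 0"
    by (rule const_over_Suc_tendsto)+
  then have "err \<longlonglongrightarrow> 0 + \<nu> * (0 * A0 + 0 * A1)"
    unfolding err_def[abs_def] by (intro tendsto_intros cutoff_tendsto[OF f]) simp_all
  then have "\<forall>\<^sub>F n in sequentially. err n < \<epsilon>"
    using \<epsilon> by (intro order_tendstoD(2)) simp_all
  then obtain n where n: "err n < \<epsilon>" unfolding eventually_sequentially by blast
  interpret cutoff p "real (Suc n)" by unfold_locales simp
  note of_nat_Suc [simp del]
  define a b where "a = lo ll p (real (Suc n))" and "b = hi rr p (real (Suc n))"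
  have ab: "a < b" and sub: "{a..b} \<subseteq> closure \<Omega>"
    and out: "\<And>y. y \<in> closure \<Omega> \<Longrightarrow> y \<notin> {a..b} \<Longrightarrow> real (Suc n) \<le> \<bar>y - p\<bar>"
    using w unfolding window_at_def a_def b_def by auto
  have vab: "continuous_on {a..b} v" by (rule continuous_on_subset[OF v sub])
  have fab: "f \<in> L2 {a..b}" "L2norm {a..b} f \<le> L2norm \<Omega> f" using L2_Icc[OF f sub] L2norm_Icc_le[OF f sub] .
  obtain G G1 G2 where sol: "interval_solution a b \<nu> k v G G1 G2"
    and bca: "if ll then G a = 0 else G1 a = 0" and bcb: "if rr then G b = 0 else G1 b = 0"
    and eq: "\<And>y. - of_real \<nu> * G2 y + \<i> * of_real (k * (v y - l)) * G y = f y"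
    using boundary_value_problem[OF ab vab \<nu> k fab(1) lr, of l] by blast
  interpret sol: interval_solution a b \<nu> k l v G G1 G2 by (rule sol)
  have "\<kappa> * sol.nG \<le> L2norm {a..b} f" using bound[OF sub sol] unfolding eq .
  then have kG: "\<kappa> * sol.nG \<le> L2norm \<Omega> f" using fab(2) by simp
  then have nG: "sol.nG \<le> A0" unfolding A0_def using \<kappa> by (simp add: field_simps)
  have "sol.F = f" by (rule ext) (subst sol.F_def, rule eq)
  then have "\<nu> * sol.nG1\<^sup>2 \<le> L2norm {a..b} f * sol.nG" using sol.gradient_bound by simp
  then have "\<kappa> * (\<nu> * sol.nG1\<^sup>2) \<le> \<kappa> * (L2norm {a..b} f * sol.nG)" using \<kappa> by (intro mult_left_mono) auto
  also have "\<dots> = L2norm {a..b} f * (\<kappa> * sol.nG)" by simp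
  also have "\<dots> \<le> L2norm \<Omega> f * L2norm \<Omega> f" using kG fab(2) \<kappa> by (intro mult_mono) auto
  finally have "(sqrt (\<kappa> * \<nu>) * sol.nG1)\<^sup>2 \<le> (L2norm \<Omega> f)\<^sup>2"
    using \<kappa> \<nu> by (simp add: power_mult_distrib power2_eq_square[of "L2norm \<Omega> f"] mult.assoc)
  then have "sqrt (\<kappa> * \<nu>) * sol.nG1 \<le> L2norm \<Omega> f" by (rule power2_le_imp_le) simp
  then have nG1: "sol.nG1 \<le> A1" unfolding A1_def using \<kappa> \<nu> by (simp add: field_simps)
  define g where "g y = (if y \<in> {a..b} then \<eta>G G y else 0)" for y
  define g1 where "g1 y = (if y \<in> {a..b} then \<eta>G1 G G1 y else 0)" for y
  define g2 where "g2 y = (if y \<in> {a..b} then \<eta>G2 G G1 G2 y else 0)" for y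
  define cm where "cm y = (if y \<in> {a..b} then commutator G G1 y else 0)" for y
  note ad = \<eta>_AD[OF sol.AD1 sol.AD2 is_interval_cc]
  have comL: "commutator G G1 \<in> L2 {a..b}"
    "L2norm {a..b} (commutator G G1) \<le> 30 / (real (Suc n))\<^sup>2 * sol.nG + 12 / real (Suc n) * sol.nG1"
    using commutator_L2[OF sol.G_L2 sol.G1_L2] by auto
  have \<eta>GL: "\<eta>G G \<in> L2 {a..b}" unfolding \<eta>G_def[abs_def] by (rule \<eta>_L2(1)[OF sol.G_L2]) simp
  have \<eta>G1L: "\<eta>G1 G G1 \<in> L2 {a..b}"
    by (rule continuous_L2_Icc) (rule AD_continuous[OF ad(2) is_interval_cc])
  have \<eta>G2L: "\<eta>G2 G G1 G2 \<in> L2 {a..b}"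
    unfolding \<eta>G2_eq[abs_def] by (intro L2_add \<eta>_L2(1) sol.G2 comL) auto
  have lft: "\<And>y. y \<in> closure \<Omega> \<Longrightarrow> y < a \<Longrightarrow> ll" and rgt: "\<And>y. y \<in> closure \<Omega> \<Longrightarrow> b < y \<Longrightarrow> rr"
    using w unfolding window_at_def a_def b_def by blast+
  \<comment> \<open>At artificial ends the cutoff and its first derivative vanish, so the function
    and its derivative both extend by zero without a jump.\<close>
  have za: "\<eta>G G a = 0" "\<eta>G1 G G1 a = 0" if ll
    using \<eta>_outside[of a] that by (simp_all add: \<eta>G_def \<eta>G1_def a_def lo_def)
  have zb: "\<eta>G G b = 0" "\<eta>G1 G G1 b = 0" if rr
    using \<eta>_outside[of b] that by (simp_all add: \<eta>G_def \<eta>G1_def b_def hi_def)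
  have in\<Omega>: "(\<lambda>y. if y \<in> {a..b} then h y else 0) \<in> L2 \<Omega>" if h: "h \<in> L2 {a..b}" for h
    by (rule L2_subset(1)[OF L2_extend_zero(1)[OF h sub] closure_subset]) auto
  \<comment> \<open>The equation for \<open>G\<close> eliminates \<open>v\<close> and
    \<open>G2\<close> on the right. This form serves twice: for membership in the domain and for the
    residual.\<close>
  have opeq: "- of_real \<nu> * \<eta>G2 G G1 G2 y + \<i> * of_real k * of_real (v y) * \<eta>G G y
     = of_real (\<eta> y) * f y + (- of_real \<nu>) * commutator G G1 y + \<i> * of_real (k * l) * \<eta>G G y" for y
    unfolding eq[symmetric] by (simp add: \<eta>G2_eq \<eta>G_def algebra_simps)
  have rep: "H_rep v \<nu> k g g g1 g2"
    unfolding H_rep_def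
  proof (intro conjI ballI)
    show "AD (closure \<Omega>) g1 g"
      unfolding g1_def[abs_def] g_def[abs_def]
      by (rule AD_extend_zero[OF ad(1)]) (use ab za(1) zb(1) lft rgt in auto)
    show "AD (closure \<Omega>) g2 g1"
      unfolding g1_def[abs_def] g2_def[abs_def]
      by (rule AD_extend_zero[OF ad(2)]) (use ab za(2) zb(2) lft rgt in auto)
    show "g \<in> L2 \<Omega>" "g1 \<in> L2 \<Omega>" "g2 \<in> L2 \<Omega>"
      unfolding g_def[abs_def] g1_def[abs_def] g2_def[abs_def] by (intro in\<Omega> \<eta>GL \<eta>G1L \<eta>G2L)+
    show "AE y in lebesgue_on \<Omega>. g y = g y" by simp
    show "(\<lambda>y. - of_real \<nu> * g2 y + \<i> * of_real k * of_real (v y) * g y) \<in> L2 \<Omega>"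
    proof -
      have "(\<lambda>y. if y \<in> {a..b} then of_real (\<eta> y) * f y + (- of_real \<nu>) * commutator G G1 y + \<i> * of_real (k * l) * \<eta>G G y else 0) \<in> L2 \<Omega>"
        by (intro in\<Omega> L2_add L2_cmult \<eta>_L2(1) fab comL \<eta>GL) auto
      then show ?thesis
      proof (rule back_subst[of "\<lambda>h. h \<in> L2 \<Omega>"], intro ext)
        fix y
        show "(if y \<in> {a..b} then of_real (\<eta> y) * f y + (- of_real \<nu>) * commutator G G1 y + \<i> * of_real (k * l) * \<eta>G G y else 0)
          = - of_real \<nu> * g2 y + \<i> * of_real k * of_real (v y) * g y"
          by (cases "y \<in> {a..b}") (simp_all only: g_def g2_def opeq if_True if_False mult_zero_right add_0_left)
      qed
    qed
    fix y assume y: "y \<in> frontier \<Omega>"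
    then have [simp]: "y = p" using ff by blast
    have G1p: "G1 p = 0" if "\<not> (ll \<and> rr)"
      using that bca bcb by (auto simp: a_def b_def lo_def hi_def split: if_splits)
    have "\<not> (ll \<and> rr)" using y fr0 by blast
    then show "g1 y = 0" by (simp add: g1_def \<eta>G1_def \<eta>_center G1p)
  qed
  have dom: "g \<in> H_dom \<Omega> v \<nu> k"
    and op: "AE y in lebesgue_on \<Omega>. H_op \<Omega> v \<nu> k g y = - of_real \<nu> * g2 y + \<i> * of_real k * of_real (v y) * g y"
    using H_rep_imp_H_dom[OF rep] .
  have cmL: "cm \<in> L2 \<Omega>" unfolding cm_def[abs_def] by (rule in\<Omega>[OF comL(1)])
  have fL: "(\<lambda>y. (of_real (\<eta> y) - 1) * f y) \<in> L2 \<Omega>"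
    using L2_diff[OF \<eta>_L2(1)[OF f sets_dom] f] by (simp add: left_diff_distrib)
  have pt: "- of_real \<nu> * g2 y + \<i> * of_real k * of_real (v y) * g y - \<i> * of_real (k * l) * g y - f y
     = (of_real (\<eta> y) - 1) * f y + (- of_real \<nu>) * cm y" if y: "y \<in> \<Omega>" for y
  proof (cases "y \<in> {a..b}")
    case True
    then show ?thesis using opeq[of y] by (simp add: g_def g2_def cm_def algebra_simps)
  next
    case False
    have "y \<in> closure \<Omega>" using y closure_subset by blast
    then have "\<eta> y = 0" using \<eta>_outside(1)[OF out] False by blast
    then show ?thesis using False by (auto simp: g_def g2_def cm_def)
  qed
  have rL: "(\<lambda>y. (of_real (\<eta> y) - 1) * f y + (- of_real \<nu>) * cm y) \<in> L2 \<Omega>"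
    by (intro L2_add fL L2_cmult cmL)
  have ae: "AE y in lebesgue_on \<Omega>. (of_real (\<eta> y) - 1) * f y + (- of_real \<nu>) * cm y
     = (H_op \<Omega> v \<nu> k g y - \<i> * of_real (k * l) * g y) - f y"
    using op AE_space by eventually_elim (simp only: pt space_lebesgue_on)
  have "L2norm \<Omega> (\<lambda>y. (H_op \<Omega> v \<nu> k g y - \<i> * of_real (k * l) * g y) - f y)
     = L2norm \<Omega> (\<lambda>y. (of_real (\<eta> y) - 1) * f y + (- of_real \<nu>) * cm y)"
    by (rule L2norm_cong_AE[OF ae rL, symmetric]) simp
  also have "\<dots> \<le> L2norm \<Omega> (\<lambda>y. (of_real (\<eta> y) - 1) * f y) + L2norm \<Omega> (\<lambda>y. (- of_real \<nu>) * cm y)"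
    by (rule L2norm_triangle[OF fL L2_cmult[OF cmL]])
  also have "L2norm \<Omega> (\<lambda>y. (- of_real \<nu>) * cm y) = \<nu> * L2norm \<Omega> cm"
    using L2norm_cmult[of \<Omega> "- of_real \<nu>"] \<nu> by simp
  also have "L2norm \<Omega> cm = L2norm (closure \<Omega>) cm" by (rule L2norm_closure[OF cmL, symmetric])
  also have "\<dots> = L2norm {a..b} (commutator G G1)"
    unfolding cm_def[abs_def] by (rule L2_extend_zero(2)[OF comL(1) sub]) auto
  also have "\<nu> * L2norm {a..b} (commutator G G1) \<le> \<nu> * (30 / (real (Suc n))\<^sup>2 * A0 + 12 / real (Suc n) * A1)"
  proof -
    have "30 / (real (Suc n))\<^sup>2 * sol.nG + 12 / real (Suc n) * sol.nG1
        \<le> 30 / (real (Suc n))\<^sup>2 * A0 + 12 / real (Suc n) * A1"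
      by (intro add_mono mult_left_mono nG nG1) auto
    from mult_left_mono[OF order_trans[OF comL(2) this], of \<nu>] show ?thesis using \<nu> by simp
  qed
  finally have "L2norm \<Omega> (\<lambda>y. (H_op \<Omega> v \<nu> k g y - \<i> * of_real (k * l) * g y) - f y) \<le> err n"
    by (simp add: err_def)
  then show thesis using that[OF dom] n by simp
qed

end

section \<open>The resolvent\<close>

text \<open>Abstract setting: a linear operator whose shift by \<open>z\<close> is bounded below and
  has dense range, so that its closure shifted by \<open>z\<close> has a bounded inverse. Linearity
  of \<open>T\<close> is stated almost everywhere because the intended \<open>T\<close> is built
  from chosen weak derivatives.\<close>

locale bounded_below_operator =
  fixes \<Omega> :: "real set" and D :: "(real \<Rightarrow> complex) set" and T :: "(real \<Rightarrow> complex) \<Rightarrow> real \<Rightarrow> complex"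
    and z :: complex and \<kappa> :: real
  assumes meas: "\<Omega> \<in> sets lebesgue" and D_L2: "\<And>g. g \<in> D \<Longrightarrow> g \<in> L2 \<Omega>" and T_L2: "\<And>g. g \<in> D \<Longrightarrow> T g \<in> L2 \<Omega>"
    and D_lin: "\<And>g h c d. g \<in> D \<Longrightarrow> h \<in> D \<Longrightarrow> (\<lambda>y. c * g y + d * h y) \<in> D"
    and T_lin: "\<And>g h c d. g \<in> D \<Longrightarrow> h \<in> D \<Longrightarrow>
      AE y in lebesgue_on \<Omega>. T (\<lambda>y. c * g y + d * h y) y = c * T g y + d * T h y"
    and \<kappa>: "\<kappa> > 0"
    and lower: "\<And>g. g \<in> D \<Longrightarrow> \<kappa> * L2norm \<Omega> g \<le> L2norm \<Omega> (\<lambda>y. T g y - z * g y)"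
    and dense: "\<And>f \<epsilon>. f \<in> L2 \<Omega> \<Longrightarrow> \<epsilon> > 0 \<Longrightarrow> \<exists>g\<in>D. L2norm \<Omega> (\<lambda>y. (T g y - z * g y) - f y) < \<epsilon>"
begin

abbreviation "CG \<equiv> closed_graph \<Omega> D T"
abbreviation "nrm \<equiv> L2norm \<Omega>"

lemma CG_L2: "(g, f) \<in> CG \<Longrightarrow> g \<in> L2 \<Omega>" "(g, f) \<in> CG \<Longrightarrow> f \<in> L2 \<Omega>"
  by (auto simp: closed_graph_def)

lemma CG_lin:
  assumes "(g, f) \<in> CG" "(h, w) \<in> CG"
  shows "((\<lambda>y. c * g y + d * h y), (\<lambda>y. c * f y + d * w y)) \<in> CG"
proof -
  note L2 = CG_L2[OF assms(1)] CG_L2[OF assms(2)]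
  obtain gs where gs: "\<And>n. gs n \<in> D" "(\<lambda>n. nrm (\<lambda>y. gs n y - g y)) \<longlonglongrightarrow> 0" "(\<lambda>n. nrm (\<lambda>y. T (gs n) y - f y)) \<longlonglongrightarrow> 0"
    using assms(1) by (auto simp: closed_graph_def)
  obtain hs where hs: "\<And>n. hs n \<in> D" "(\<lambda>n. nrm (\<lambda>y. hs n y - h y)) \<longlonglongrightarrow> 0" "(\<lambda>n. nrm (\<lambda>y. T (hs n) y - w y)) \<longlonglongrightarrow> 0"
    using assms(2) by (auto simp: closed_graph_def)
  have comb: "nrm (\<lambda>y. c * u1 y + d * u2 y) \<le> cmod c * nrm u1 + cmod d * nrm u2"
    if "u1 \<in> L2 \<Omega>" "u2 \<in> L2 \<Omega>" for u1 u2
    using L2norm_triangle[OF L2_cmult[OF that(1), of c] L2_cmult[OF that(2), of d]] by (simp add: L2norm_cmult)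
  have lim0: "(\<lambda>n. nrm (x n)) \<longlonglongrightarrow> 0"
    if "\<And>n. nrm (x n) \<le> cmod c * s n + cmod d * t n" "s \<longlonglongrightarrow> 0" "t \<longlonglongrightarrow> 0" for x s t
  proof (rule tendsto_sandwich[of "\<lambda>_. 0"])
    have "(\<lambda>n. cmod c * s n + cmod d * t n) \<longlonglongrightarrow> cmod c * 0 + cmod d * 0"
      by (intro tendsto_intros that)
    then show "(\<lambda>n. cmod c * s n + cmod d * t n) \<longlonglongrightarrow> 0" by simp
  qed (use that(1) in auto)
  have "(\<lambda>n. nrm (\<lambda>y. (c * gs n y + d * hs n y) - (c * g y + d * h y))) \<longlonglongrightarrow> 0"
  proof (rule lim0[OF _ gs(2) hs(2)])
    fix n
    have "nrm (\<lambda>y. c * (gs n y - g y) + d * (hs n y - h y))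
        \<le> cmod c * nrm (\<lambda>y. gs n y - g y) + cmod d * nrm (\<lambda>y. hs n y - h y)"
      by (intro comb L2_diff D_L2 gs hs L2)
    then show "nrm (\<lambda>y. (c * gs n y + d * hs n y) - (c * g y + d * h y))
        \<le> cmod c * nrm (\<lambda>y. gs n y - g y) + cmod d * nrm (\<lambda>y. hs n y - h y)"
      by (simp add: algebra_simps)
  qed
  moreover have "(\<lambda>n. nrm (\<lambda>y. T (\<lambda>y. c * gs n y + d * hs n y) y - (c * f y + d * w y))) \<longlonglongrightarrow> 0"
  proof (rule lim0[OF _ gs(3) hs(3)])
    fix n
    have Lc: "(\<lambda>y. c * (T (gs n) y - f y) + d * (T (hs n) y - w y)) \<in> L2 \<Omega>"
      by (intro L2_add L2_cmult L2_diff T_L2 gs hs L2)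
    have ae: "AE y in lebesgue_on \<Omega>. c * (T (gs n) y - f y) + d * (T (hs n) y - w y)
        = T (\<lambda>y. c * gs n y + d * hs n y) y - (c * f y + d * w y)"
      using T_lin[OF gs(1)[of n] hs(1)[of n], of c d] by eventually_elim (simp add: algebra_simps)
    have "nrm (\<lambda>y. c * (T (gs n) y - f y) + d * (T (hs n) y - w y))
        \<le> cmod c * nrm (\<lambda>y. T (gs n) y - f y) + cmod d * nrm (\<lambda>y. T (hs n) y - w y)"
      by (intro comb L2_diff T_L2 gs hs L2)
    then show "nrm (\<lambda>y. T (\<lambda>y. c * gs n y + d * hs n y) y - (c * f y + d * w y))
        \<le> cmod c * nrm (\<lambda>y. T (gs n) y - f y) + cmod d * nrm (\<lambda>y. T (hs n) y - w y)"
      unfolding L2norm_cong_AE[OF ae Lc meas] .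
  qed
  moreover have "(\<lambda>y. c * gs n y + d * hs n y) \<in> D" for n by (intro D_lin gs hs)
  ultimately show ?thesis
    unfolding closed_graph_def using L2
    by (auto intro!: L2_add L2_cmult exI[of _ "\<lambda>n y. c * gs n y + d * hs n y"])
qed

text \<open>The lower bound survives the limits that define the closed graph, since both of its
  sides are continuous in the pair of the function and its image.\<close>

lemma CG_lower:
  assumes "(g, f) \<in> CG"
  shows "\<kappa> * nrm g \<le> nrm (\<lambda>y. f y - z * g y)"
proof -
  note L2 = CG_L2[OF assms]
  obtain gs where gs: "\<And>n. gs n \<in> D" "(\<lambda>n. nrm (\<lambda>y. gs n y - g y)) \<longlonglongrightarrow> 0" "(\<lambda>n. nrm (\<lambda>y. T (gs n) y - f y)) \<longlonglongrightarrow> 0"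
    using assms by (auto simp: closed_graph_def)
  let ?x = "\<lambda>n. nrm (\<lambda>y. gs n y - g y)" and ?t = "\<lambda>n. nrm (\<lambda>y. T (gs n) y - f y)"
  have le: "\<kappa> * nrm g \<le> \<kappa> * ?x n + (nrm (\<lambda>y. f y - z * g y) + (?t n + cmod z * ?x n))" for n
  proof -
    have "nrm g \<le> nrm (gs n) + nrm (\<lambda>y. g y - gs n y)"
      by (rule L2norm_triangle_sub[OF L2(1) D_L2[OF gs(1)]])
    then have "\<kappa> * nrm g \<le> \<kappa> * nrm (gs n) + \<kappa> * ?x n"
      using mult_left_mono[of "nrm g" "nrm (gs n) + ?x n" \<kappa>] \<kappa>
      by (simp add: L2norm_minus_commute[of \<Omega> g] distrib_left)
    moreover have "\<kappa> * nrm (gs n) \<le> nrm (\<lambda>y. T (gs n) y - z * gs n y)" by (rule lower[OF gs(1)])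
    moreover have "nrm (\<lambda>y. T (gs n) y - z * gs n y) \<le> nrm (\<lambda>y. f y - z * g y) + (?t n + cmod z * ?x n)"
    proof -
      have a: "(\<lambda>y. f y - z * g y) \<in> L2 \<Omega>" "(\<lambda>y. T (gs n) y - f y) \<in> L2 \<Omega>" "(\<lambda>y. (- z) * (gs n y - g y)) \<in> L2 \<Omega>"
        by (intro L2_diff L2_cmult L2 T_L2 D_L2 gs)+
      have "(\<lambda>y. T (gs n) y - z * gs n y) = (\<lambda>y. (f y - z * g y) + ((T (gs n) y - f y) + (- z) * (gs n y - g y)))"
        by (simp add: algebra_simps)
      then have "nrm (\<lambda>y. T (gs n) y - z * gs n y)
          \<le> nrm (\<lambda>y. f y - z * g y) + nrm (\<lambda>y. (T (gs n) y - f y) + (- z) * (gs n y - g y))"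
        using L2norm_triangle[OF a(1) L2_add[OF a(2,3)]] by simp
      also have "nrm (\<lambda>y. (T (gs n) y - f y) + (- z) * (gs n y - g y)) \<le> ?t n + nrm (\<lambda>y. (- z) * (gs n y - g y))"
        by (rule L2norm_triangle[OF a(2,3)])
      also have "nrm (\<lambda>y. (- z) * (gs n y - g y)) = cmod z * ?x n"
        using L2norm_cmult[of \<Omega> "- z"] by simp
      finally show ?thesis by simp
    qed
    ultimately show ?thesis by linarith
  qed
  have "(\<lambda>n. \<kappa> * ?x n + (nrm (\<lambda>y. f y - z * g y) + (?t n + cmod z * ?x n)))
      \<longlonglongrightarrow> \<kappa> * 0 + (nrm (\<lambda>y. f y - z * g y) + (0 + cmod z * 0))"
    by (intro tendsto_intros gs)
  then have "\<kappa> * nrm g \<le> \<kappa> * 0 + (nrm (\<lambda>y. f y - z * g y) + (0 + cmod z * 0))"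
    by (rule LIMSEQ_le_const) (use le in auto)
  then show ?thesis by simp
qed

text \<open>By linearity of the closed graph, \<open>CG_lower\<close> applies to the difference and
  gives norm 0. This injectivity is the source of linearity and of the left inverse property of the
  resolvent.\<close>

lemma CG_unique:
  assumes "(g, f) \<in> CG" "(h, w) \<in> CG" "\<And>y. f y - z * g y = w y - z * h y"
  shows "L2eq \<Omega> g h"
proof -
  have "(\<lambda>y. 1 * g y + (- 1) * h y, \<lambda>y. 1 * f y + (- 1) * w y) \<in> CG" by (rule CG_lin[OF assms(1,2)])
  from CG_lower[OF this]
  have "\<kappa> * nrm (\<lambda>y. g y - h y) \<le> nrm (\<lambda>y. (f y - w y) - z * (g y - h y))" by simp
  also have "(\<lambda>y. (f y - w y) - z * (g y - h y)) = (\<lambda>y. 0)"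
    using assms(3) by (simp add: fun_eq_iff algebra_simps)
  finally have "\<kappa> * nrm (\<lambda>y. g y - h y) \<le> 0" by (simp add: L2norm_def)
  then have "nrm (\<lambda>y. g y - h y) \<le> 0" using \<kappa> by (simp add: mult_le_0_iff)
  then have "nrm (\<lambda>y. g y - h y) = 0" using L2norm_nonneg[of \<Omega> "\<lambda>y. g y - h y"] by linarith
  then have "AE y in lebesgue_on \<Omega>. g y - h y = 0"
    using L2norm_0_iff[OF L2_diff[OF CG_L2(1)[OF assms(1)] CG_L2(1)[OF assms(2)]]] by simp
  then show ?thesis unfolding L2eq_def by eventually_elim simp
qed

text \<open>Density of the range provides approximate solutions with residual below 1/(n+1). The
  lower bound makes them a Cauchy sequence, and their limit lies in the closed graph.\<close>

lemma CG_surj: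
  assumes f: "f \<in> L2 \<Omega>"
  shows "\<exists>g. (g, \<lambda>y. f y + z * g y) \<in> CG"
proof -
  have "\<forall>n. \<exists>g\<in>D. nrm (\<lambda>y. (T g y - z * g y) - f y) < 1 / real (Suc n)"
    by (intro allI dense[OF f]) simp
  then obtain gs where gs: "\<And>n. gs n \<in> D"
    and b: "\<And>n. nrm (\<lambda>y. (T (gs n) y - z * gs n y) - f y) < 1 / real (Suc n)" by metis
  let ?r = "\<lambda>n y. (T (gs n) y - z * gs n y) - f y"
  have rL: "?r n \<in> L2 \<Omega>" for n by (intro L2_diff L2_cmult T_L2 D_L2 gs f)
  have inv: "(\<lambda>n. 1 / real (Suc n)) \<longlonglongrightarrow> 0" by (rule const_over_Suc_tendsto(2))
  have r0: "(\<lambda>n. nrm (?r n)) \<longlonglongrightarrow> 0"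
    by (rule tendsto_sandwich[OF _ _ tendsto_const inv]) (auto intro!: always_eventually less_imp_le[OF b] simp del: of_nat_Suc)
  have cau: "\<kappa> * nrm (\<lambda>y. gs m y - gs n y) \<le> nrm (?r m) + nrm (?r n)" for m n
  proof -
    have dD: "(\<lambda>y. 1 * gs m y + (- 1) * gs n y) \<in> D" by (rule D_lin[OF gs gs])
    have eq: "(\<lambda>y. 1 * gs m y + (- 1) * gs n y) = (\<lambda>y. gs m y - gs n y)" by simp
    have "\<kappa> * nrm (\<lambda>y. gs m y - gs n y) \<le> nrm (\<lambda>y. T (\<lambda>y. gs m y - gs n y) y - z * (gs m y - gs n y))"
      using lower[OF dD] by simp
    also have "\<dots> = nrm (\<lambda>y. ?r m y - ?r n y)"
    proof (rule L2norm_cong_AE[symmetric, OF _ L2_diff[OF rL rL] meas])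
      show "AE y in lebesgue_on \<Omega>. ?r m y - ?r n y = T (\<lambda>y. gs m y - gs n y) y - z * (gs m y - gs n y)"
        using T_lin[OF gs gs, of 1 m "- 1" n] unfolding eq by eventually_elim (simp add: algebra_simps)
    qed
    also have "\<dots> \<le> nrm (?r m) + nrm (?r n)" by (rule L2norm_diff_triangle[OF rL rL])
    finally show ?thesis .
  qed
  have "\<exists>g\<in>L2 \<Omega>. (\<lambda>n. nrm (\<lambda>y. gs n y - g y)) \<longlonglongrightarrow> 0"
  proof (rule L2_complete)
    show "gs n \<in> L2 \<Omega>" for n by (rule D_L2[OF gs])
    fix e :: real assume "e > 0"
    then have "\<kappa> * e / 2 > 0" using \<kappa> by simp
    from order_tendstoD(2)[OF r0 this] obtain N where N: "\<And>n. n \<ge> N \<Longrightarrow> nrm (?r n) < \<kappa> * e / 2"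
      unfolding eventually_sequentially by blast
    have "nrm (\<lambda>y. gs m y - gs n y) < e" if "m \<ge> N" "n \<ge> N" for m n
    proof -
      have "\<kappa> * nrm (\<lambda>y. gs m y - gs n y) < \<kappa> * e"
        using cau[of m n] N[OF that(1)] N[OF that(2)] by linarith
      then show ?thesis using \<kappa> by simp
    qed
    then show "\<exists>N. \<forall>m\<ge>N. \<forall>n\<ge>N. nrm (\<lambda>y. gs m y - gs n y) < e" by blast
  qed
  then obtain g where g: "g \<in> L2 \<Omega>" and lim: "(\<lambda>n. nrm (\<lambda>y. gs n y - g y)) \<longlonglongrightarrow> 0" by blast
  have "(\<lambda>n. nrm (\<lambda>y. T (gs n) y - (f y + z * g y))) \<longlonglongrightarrow> 0"
  proof (rule tendsto_sandwich[OF _ _ tendsto_const])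
    show "\<forall>\<^sub>F n in sequentially. nrm (\<lambda>y. T (gs n) y - (f y + z * g y)) \<le> nrm (?r n) + cmod z * nrm (\<lambda>y. gs n y - g y)"
    proof (rule always_eventually, rule allI)
      fix n
      have "(\<lambda>y. T (gs n) y - (f y + z * g y)) = (\<lambda>y. ?r n y + z * (gs n y - g y))"
        by (simp add: algebra_simps)
      then show "nrm (\<lambda>y. T (gs n) y - (f y + z * g y)) \<le> nrm (?r n) + cmod z * nrm (\<lambda>y. gs n y - g y)"
        using L2norm_triangle[OF rL[of n] L2_cmult[OF L2_diff[OF D_L2[OF gs] g], of z n]] by (simp add: L2norm_cmult)
    qed
    have "(\<lambda>n. nrm (?r n) + cmod z * nrm (\<lambda>y. gs n y - g y)) \<longlonglongrightarrow> 0 + cmod z * 0"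
      by (intro tendsto_intros r0 lim)
    then show "(\<lambda>n. nrm (?r n) + cmod z * nrm (\<lambda>y. gs n y - g y)) \<longlonglongrightarrow> 0" by simp
  qed simp
  moreover have "(\<lambda>y. f y + z * g y) \<in> L2 \<Omega>" by (intro L2_add L2_cmult f g)
  ultimately have "(g, \<lambda>y. f y + z * g y) \<in> CG"
    unfolding closed_graph_def using g gs lim by auto
  then show ?thesis by blast
qed

text \<open>Solutions from \<open>CG_surj\<close> are picked by choice and are determined only up to
  null sets; linearity and the left inverse property come from \<open>CG_unique\<close>, the norm
  from \<open>CG_lower\<close>.\<close>

lemma resolvent_norm_le: "resolvent_norm \<Omega> D T z \<le> ennreal (1 / \<kappa>)"
proof -
  define R where "R f = (SOME g. (g, \<lambda>y. f y + z * g y) \<in> CG)" for f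
  have R: "(R f, \<lambda>y. f y + z * R f y) \<in> CG" if "f \<in> L2 \<Omega>" for f
    unfolding R_def by (rule someI_ex[OF CG_surj[OF that]])
  have nR: "nrm (R f) \<le> nrm f / \<kappa>" if "f \<in> L2 \<Omega>" for f
    using CG_lower[OF R[OF that]] \<kappa> by (simp add: field_simps)
  have op: "op_norm \<Omega> R \<le> ennreal (1 / \<kappa>)"
    unfolding op_norm_def
  proof (rule SUP_least)
    fix f assume f: "f \<in> {f \<in> L2 \<Omega>. nrm f \<le> 1}"
    then have "nrm (R f) \<le> nrm f / \<kappa>" using nR by simp
    also have "\<dots> \<le> 1 / \<kappa>" using f \<kappa> by (intro divide_right_mono) auto
    finally show "ennreal (nrm (R f)) \<le> ennreal (1 / \<kappa>)" by (rule ennreal_leI)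
  qed
  have "linear_L2 \<Omega> R"
    unfolding linear_L2_def
  proof (intro conjI ballI allI)
    show "R f \<in> L2 \<Omega>" if "f \<in> L2 \<Omega>" for f using CG_L2(1)[OF R[OF that]] .
    show "L2eq \<Omega> (R (\<lambda>y. f y + g y)) (\<lambda>y. R f y + R g y)" if f: "f \<in> L2 \<Omega>" and g: "g \<in> L2 \<Omega>" for f g
      using CG_unique[OF R[OF L2_add[OF f g]] CG_lin[OF R[OF f] R[OF g], of 1 1]]
      by (simp add: algebra_simps)
    show "L2eq \<Omega> (R (\<lambda>y. c * f y)) (\<lambda>y. c * R f y)" if f: "f \<in> L2 \<Omega>" for c f
      using CG_unique[OF R[OF L2_cmult[OF f, of c]] CG_lin[OF R[OF f] R[OF f], of c 0]]
      by (simp add: algebra_simps)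
  qed
  moreover have "op_norm \<Omega> R < \<infinity>" using op by (rule le_less_trans) simp
  moreover have "L2eq \<Omega> (R (\<lambda>y. h y - z * g y)) g" if gh: "(g, h) \<in> CG" for g h
  proof (rule CG_unique[OF R gh])
    show "(\<lambda>y. h y - z * g y) \<in> L2 \<Omega>" by (intro L2_diff L2_cmult CG_L2[OF gh])
  qed simp
  ultimately have "is_resolvent \<Omega> D T z R"
    unfolding is_resolvent_def using R by blast
  then have "resolvent_norm \<Omega> D T z \<le> op_norm \<Omega> R"
    unfolding resolvent_norm_def by (intro INF_lower) simp
  then show ?thesis using op by (rule order_trans)
qed

end

lemma ennreal_inverse_le_swap:
  assumes "x \<le> ennreal (1 / \<kappa>)" "\<kappa> > 0"
  shows "ennreal \<kappa> \<le> inverse x"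
proof -
  have "x < top" using assms(1) by (rule le_less_trans) simp
  then obtain r where r: "r \<ge> 0" "x = ennreal r" by (cases x) auto
  show ?thesis
  \<comment> \<open>If x = 0, its inverse is infinite and the claim is trivial.\<close>
  proof (cases "r = 0")
    case False
    have "r \<le> 1 / \<kappa>" using assms r by simp
    then have "\<kappa> \<le> inverse r" using False r(1) assms(2) by (simp add: field_simps)
    then show ?thesis using False r by (simp add: inverse_ennreal ennreal_leI)
  qed (use r in simp)
qed

section \<open>The abstract resolvent estimate applied to the operator on \<Omega>\<close>

context unbounded_interval
begin

text \<open>Linearity is proved on the regular representatives, whose derivatives are definite
  functions and not choices.\<close>

lemma H_rep_lin:
  assumes g: "H_rep v \<nu> k g G G1 G2" and h: "H_rep v \<nu> k h W W1 W2"
  shows "H_rep v \<nu> k (\<lambda>y. c * g y + d * h y) (\<lambda>y. c * G y + d * W y)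
    (\<lambda>y. c * G1 y + d * W1 y) (\<lambda>y. c * G2 y + d * W2 y)"
proof -
  have "AE y in lebesgue_on \<Omega>. g y = G y" "AE y in lebesgue_on \<Omega>. h y = W y"
    using g h by (auto simp: H_rep_def)
  then have ae: "AE y in lebesgue_on \<Omega>. c * g y + d * h y = c * G y + d * W y"
    by eventually_elim simp
  have "(\<lambda>y. c * (- of_real \<nu> * G2 y + \<i> * of_real k * of_real (v y) * G y)
      + d * (- of_real \<nu> * W2 y + \<i> * of_real k * of_real (v y) * W y)) \<in> L2 \<Omega>"
    by (rule L2_add[OF L2_cmult L2_cmult]) (use g h in \<open>unfold H_rep_def, blast+\<close>)
  then have H: "(\<lambda>y. - of_real \<nu> * (c * G2 y + d * W2 y) + \<i> * of_real k * of_real (v y) * (c * G y + d * W y)) \<in> L2 \<Omega>"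
    by (rule back_subst[of "\<lambda>h. h \<in> L2 \<Omega>"]) (simp add: fun_eq_iff algebra_simps)
  show ?thesis
    unfolding H_rep_def
  proof (intro conjI ae H)
    show "\<forall>y\<in>frontier \<Omega>. c * G1 y + d * W1 y = 0" using g h by (simp add: H_rep_def)
  qed (use g h in \<open>auto simp: H_rep_def intro!: AD_add AD_cmult L2_add L2_cmult\<close>)
qed

text \<open>The lower bound and the density of the range both rest on the one estimate for compact
  intervals. The shift has the form i k l so that it merges with the potential into k (v -
  l).\<close>

lemma bounded_below_H_op:
  assumes \<nu>: "\<nu> > 0" and k: "k \<noteq> 0" and v: "continuous_on (closure \<Omega>) v" and \<kappa>: "\<kappa> > 0"
    and bound: "\<And>a b G G1 G2. {a..b} \<subseteq> closure \<Omega> \<Longrightarrow> interval_solution a b \<nu> k v G G1 G2 \<Longrightarrow>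
      \<kappa> * L2norm {a..b} G \<le> L2norm {a..b} (\<lambda>y. - of_real \<nu> * G2 y + \<i> * of_real (k * (v y - l)) * G y)"
  shows "bounded_below_operator \<Omega> (H_dom \<Omega> v \<nu> k) (H_op \<Omega> v \<nu> k) (\<i> * of_real (k * l)) \<kappa>"
proof
  let ?D = "H_dom \<Omega> v \<nu> k" and ?T = "H_op \<Omega> v \<nu> k"
  show "\<Omega> \<in> sets lebesgue" by simp
  show D: "g \<in> L2 \<Omega>" if "g \<in> ?D" for g using that by (simp add: H_dom_def H2_def)
  show T: "?T g \<in> L2 \<Omega>" if "g \<in> ?D" for g using that by (simp add: H_dom_def)
  fix g h c d assume g: "g \<in> ?D" and h: "h \<in> ?D"
  obtain G G1 G2 where G: "H_rep v \<nu> k g G G1 G2" using H_dom_imp_H_rep[OF g] .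
  obtain W W1 W2 where W: "H_rep v \<nu> k h W W1 W2" using H_dom_imp_H_rep[OF h] .
  note r = H_rep_lin[OF G W, of c d]
  show "(\<lambda>y. c * g y + d * h y) \<in> ?D" by (rule H_rep_imp_H_dom(1)[OF r])
  show "AE y in lebesgue_on \<Omega>. ?T (\<lambda>y. c * g y + d * h y) y = c * ?T g y + d * ?T h y"
    using H_rep_imp_H_dom(2)[OF r] H_rep_imp_H_dom(2)[OF G] H_rep_imp_H_dom(2)[OF W]
  proof eventually_elim
    fix y
    assume e1: "?T (\<lambda>y. c * g y + d * h y) y = - of_real \<nu> * (c * G2 y + d * W2 y) + \<i> * of_real k * of_real (v y) * (c * G y + d * W y)"
      and e2: "?T g y = - of_real \<nu> * G2 y + \<i> * of_real k * of_real (v y) * G y"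
      and e3: "?T h y = - of_real \<nu> * W2 y + \<i> * of_real k * of_real (v y) * W y"
    show "?T (\<lambda>y. c * g y + d * h y) y = c * ?T g y + d * ?T h y"
      unfolding e1 e2 e3 by (simp add: algebra_simps)
  qed
next
  show "\<kappa> > 0" by (rule \<kappa>)
next
  fix g assume g: "g \<in> H_dom \<Omega> v \<nu> k"
  obtain G G1 G2 where G: "H_rep v \<nu> k g G G1 G2" using H_dom_imp_H_rep[OF g] .
  have aeg: "AE y in lebesgue_on \<Omega>. g y = G y" using G by (simp add: H_rep_def)
  have gL: "g \<in> L2 \<Omega>" and TL: "H_op \<Omega> v \<nu> k g \<in> L2 \<Omega>" using g by (simp_all add: H_dom_def H2_def)
  have "\<kappa> * L2norm \<Omega> G \<le> L2norm \<Omega> (\<lambda>y. - of_real \<nu> * G2 y + \<i> * of_real (k * (v y - l)) * G y)"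
    by (rule H_rep_lower_bound[OF \<nu> k v _ bound G]) (use \<kappa> in auto)
  also have "\<dots> = L2norm \<Omega> (\<lambda>y. H_op \<Omega> v \<nu> k g y - \<i> * of_real (k * l) * g y)"
  proof (rule L2norm_cong_AE[symmetric, OF _ L2_diff[OF TL L2_cmult[OF gL]]])
    show "AE y in lebesgue_on \<Omega>. H_op \<Omega> v \<nu> k g y - \<i> * of_real (k * l) * g y
        = - of_real \<nu> * G2 y + \<i> * of_real (k * (v y - l)) * G y"
      using H_rep_imp_H_dom(2)[OF G] aeg by eventually_elim (simp add: algebra_simps)
  qed simp
  also have "L2norm \<Omega> G = L2norm \<Omega> g" by (rule L2norm_cong_AE[symmetric, OF aeg gL]) simp
  finally show "\<kappa> * L2norm \<Omega> g \<le> L2norm \<Omega> (\<lambda>y. H_op \<Omega> v \<nu> k g y - \<i> * of_real (k * l) * g y)" .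
next
  fix f and \<epsilon> :: real assume f: "f \<in> L2 \<Omega>" "\<epsilon> > 0"
  show "\<exists>g\<in>H_dom \<Omega> v \<nu> k. L2norm \<Omega> (\<lambda>y. (H_op \<Omega> v \<nu> k g y - \<i> * of_real (k * l) * g y) - f y) < \<epsilon>"
  proof (rule H_dom_dense_range[OF \<nu> k v \<kappa> _ f, where l=l])
    show "\<kappa> * L2norm {a..b} G \<le> L2norm {a..b} (\<lambda>y. - of_real \<nu> * G2 y + \<i> * of_real (k * (v y - l)) * G y)"
      if "{a..b} \<subseteq> closure \<Omega>" "interval_solution a b \<nu> k v G G1 G2" for a b G G1 G2
      by (rule bound[OF that])
  qed blast
qed

end

theorem proposition1p4:
  fixes \<Omega> :: "real set" and m :: nat and v :: "real \<Rightarrow> real"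
  assumes "m \<ge> 1"
    and "\<Omega> = UNIV \<or> (\<exists>L1. \<Omega> = {..<L1}) \<or> (\<exists>L2. \<Omega> = {L2<..})"
    and "Cm_on m (closure \<Omega>) v"
    and "\<forall>y\<in>closure \<Omega>. (\<Sum>j=1..m. \<bar>nderiv_on (closure \<Omega>) j v y\<bar>) > 0"
    and "\<exists>c0>0. Liminf (inf at_infinity (principal (closure \<Omega>)))
                   (\<lambda>y. ereal \<bar>nderiv_on (closure \<Omega>) 1 v y\<bar>) \<ge> ereal c0"
  shows "\<exists>C>0. \<forall>\<nu>>0. \<forall>k. k \<noteq> 0 \<longrightarrow> \<Psi> \<Omega> v \<nu> k \<ge> ennreal (C * rate m \<nu> k)"
proof -
  interpret unbounded_interval \<Omega> by unfold_locales (rule assms(2))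
  have und: "uniformly_nondegenerate m v (closure \<Omega>)"
    using assms(5) uniformly_nondegenerate_profile[OF assms(1) closed_closure interval_closure assms(3,4)] by blast
  have v: "continuous_on (closure \<Omega>) v"
    using nderiv_on_continuous[OF assms(3), of 0] by simp
  obtain C where C: "C > 0" and bound: "\<And>\<nu> k l a b G G1 G2. {a..b} \<subseteq> closure \<Omega> \<Longrightarrow>
      interval_solution a b \<nu> k v G G1 G2 \<Longrightarrow>
      C * rate m \<nu> k * L2norm {a..b} G
        \<le> L2norm {a..b} (\<lambda>y. - of_real \<nu> * G2 y + \<i> * of_real (k * (v y - l)) * G y)"
    using interval_solution_resolvent_bound[OF und assms(1)] by blast
  have "\<Psi> \<Omega> v \<nu> k \<ge> ennreal (C * rate m \<nu> k)" if \<nu>: "\<nu> > 0" and k: "k \<noteq> 0" for \<nu> k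
  proof -
    have "rate m \<nu> k > 0" using rate_scale[OF \<nu> k assms(1)] by blast
    then have \<kappa>: "C * rate m \<nu> k > 0" using C by simp
    have "resolvent_norm \<Omega> (H_dom \<Omega> v \<nu> k) (H_op \<Omega> v \<nu> k) z \<le> ennreal (1 / (C * rate m \<nu> k))"
      if z: "Re z = 0" for z
    proof -
      \<comment> \<open>A point z of the imaginary axis is i k l with l = Im z / k; here uniformity
        in the level becomes uniformity in z.\<close>
      interpret bounded_below_operator \<Omega> "H_dom \<Omega> v \<nu> k" "H_op \<Omega> v \<nu> k" "\<i> * of_real (k * (Im z / k))" "C * rate m \<nu> k"
        by (rule bounded_below_H_op[OF \<nu> k v \<kappa> bound])
      have "\<i> * of_real (k * (Im z / k)) = z" using z k by (simp add: complex_eq_iff)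
      then show ?thesis using resolvent_norm_le by (simp only:)
    qed
    then have "(SUP z\<in>{z. Re z = 0}. resolvent_norm \<Omega> (H_dom \<Omega> v \<nu> k) (H_op \<Omega> v \<nu> k) z) \<le> ennreal (1 / (C * rate m \<nu> k))"
      by (intro SUP_least) simp
    then show ?thesis
      unfolding \<Psi>_def pseudospectral_abscissa_def using \<kappa> by (rule ennreal_inverse_le_swap)
  qed
  then show ?thesis using C by blast
qed

end
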